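(* Let $u$ be the solution to the elliptic interface problem $$-\nabla\cdot(a\nabla u)=f\ \text{ in }\Omega\setminus\Gamma_I,\qquad[u]=g_D,\quad[a\nabla u\cdot\vec n]=g_N\ \text{ on }\Gamma_I$$ (with boundary conditions on $\partial\Omega$), and let $\Gamma_I$ be parametrized near $(x_i^*,y_j^* )\in\Gamma_I$ by $x=r(t)+x_i^*$, $y=s(t)+y_j^*$, $t\in(-\epsilon,\epsilon)$, with $r,s$ smooth, $r(0)=s(0)=0$ and $(r'(t))^2+(s'(t))^2>0$. Let $M$ be a positive integer. Then for all $(m',n')\in\Lambda_{M+1}^{V,1}$, $$u_-^{(m',n')}=\sum_{\substack{(m,n)\in\Lambda_{M+1}^{V,1}\\ m+n\le m'+n'}}T^{u_+}_{m',n',m,n}u_+^{(m,n)}+\sum_{(m,n)\in\Lambda_{M-1}}\Big(T^+_{m',n',m,n}f_+^{(m,n)}+T^-_{m',n',m,n}f_-^{(m,n)}\Big)$$ $$\qquad+\sum_{(m,n)\in\Lambda_{M+1}}T^{g_D}_{m',n',m,n}g_D^{(m,n)}+\sum_{(m,n)\in\Lambda_M}T^{g_N}_{m',n',m,n}g_N^{(m,n)},$$ where all the transmission coefficients $T^{u_+},T^\pm,T^{g_D},T^{g_N}$ are uniquely determined by $r^{(k)}(0),s^{(k)}(0)$ for $k=0,\dots,M+1$ and $\{a_\pm^{(m,n)}:(m,n)\in\Lambda_M\}$. Moreover, if $(m,n),(m',n')\in\Lambda_{M+1}^{V,1}$ and $m+n=m'+n'$, then the transmission coefficient $T^{u_+}_{m',n',m,n}$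 of $u_+^{(m,n)}$ depends only on $r^{(k)}(0),s^{(k)}(0)$ for $k=0,\dots,M+1$ and on $a_\pm^{(0,0)}$. In particular, $$T^{u_+}_{0,0,0,0}=1\quad\text{and}\quad T^{u_+}_{m',n',0,0}=0\ \text{ if }(m',n')\ne(0,0).$$
   Context: $\Omega=(l_1,l_2)\times(l_3,l_4)$; $\psi$ is a smooth function, $\Gamma_I=\{(x,y)\in\Omega:\psi(x,y)=0\}$ is a smooth curve splitting $\Omega$ into $\Omega^+=\{\psi>0\}$ and $\Omega^-=\{\psi<0\}$. $[w]$ at a point of $\Gamma_I$ is the limit of $w$ from $\Omega^+$ minus the limit from $\Omega^-$, and $\vec n$ is the unit normal of $\Gamma_I$ pointing towards $\Omega^+$ (so $\vec n=\pm(s'(t),-r'(t))/\sqrt{(r'(t))^2+(s'(t))^2}$, with the sign fixed by this orientation). $a_\pm,u_\pm,f_\pm$ are the restrictions of $a,u,f$ to $\Omega^\pm$. The coefficient $a$ is positive, and $a_\pm,u_\pm,f_\pm$ are smooth (sufficiently many continuous derivatives up to $\Gamma_I$); $a,u,f$ may be discontinuous across $\Gamma_I$. The functions $g_D,g_N$ are regarded as smooth functions near $(x_i^*,y_j^* )$. Notation: $a_\pm^{(m,n)},u_\pm^{(m,n)},f_\pm^{(m,n)},g_D^{(m,n)},g_N^{(m,n)}$ denote $\partial_x^m\partial_y^n$ of the respective functions at $(x_i^*,y_j^* )$ (one-sided limits from $\Omega^\pm$ for $a_\pm,u_\pm,f_\pm$). For an integer $N\ge0$: $\Lambda_N=\{(m,n)\in\mathbb{N}_0^2:m+n\le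 N\}$, $\Lambda_N^{V,1}=\{(m,n)\in\Lambda_N:m\in\{0,1\}\}$. The coefficients are universal in the sense that the displayed identity holds for all $u,f,g_D,g_N$ satisfying the interface problem with the given $a_\pm$ and $\Gamma_I$.
   Formalization: The coefficients T^{g_N} are determined by the derivatives of r, s, a_± together with the sign in n=±(s',-r')/|(s',-r')|; without it the claim fails: for Γ_I={x=0}, a=1, r=0, s=t, swapping Ω^+ and Ω^- flips T^{g_N}_{1,0,0,0}. *)

theory Defs
  imports "HOL-Analysis.Analysis"
begin

type_synonym plane = "real \<times> real"

definition px :: "(plane \<Rightarrow> real) \<Rightarrow> plane \<Rightarrow> real" where
  "px g = (\<lambda>(x, y). deriv (\<lambda>t. g (t, y)) x)"

definition py :: "(plane \<Rightarrow> real) \<Rightarrow> plane \<Rightarrow> real" where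
  "py g = (\<lambda>(x, y). deriv (\<lambda>t. g (x, t)) y)"

definition pd :: "nat \<times> nat \<Rightarrow> (plane \<Rightarrow> real) \<Rightarrow> plane \<Rightarrow> real" where
  "pd = (\<lambda>(m, n) g. (px ^^ m) ((py ^^ n) g))"

definition grad :: "(plane \<Rightarrow> real) \<Rightarrow> plane \<Rightarrow> plane" where
  "grad g q = (px g q, py g q)"

definition div_flux :: "(plane \<Rightarrow> real) \<Rightarrow> (plane \<Rightarrow> real) \<Rightarrow> plane \<Rightarrow> real" where
  "div_flux a u q = px (\<lambda>z. a z * px u z) q + py (\<lambda>z. a z * py u z) q"

(* C^k regularity; meaningful for open S and open I only, since deriv looks at a full neighbourhood. *)
fun Ck_on :: "nat \<Rightarrow> plane set \<Rightarrow> (plane \<Rightarrow> real) \<Rightarrow> bool" where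
  "Ck_on 0 S g \<longleftrightarrow> continuous_on S g"
| "Ck_on (Suc k) S g \<longleftrightarrow> g differentiable_on S \<and> Ck_on k S (px g) \<and> Ck_on k S (py g)"

definition Ck_real_on :: "nat \<Rightarrow> real set \<Rightarrow> (real \<Rightarrow> real) \<Rightarrow> bool" where
  "Ck_real_on k I g \<longleftrightarrow>
     (\<forall>j<k. (deriv ^^ j) g differentiable_on I) \<and> continuous_on I ((deriv ^^ k) g)"

(* C^k on the open set S, with all partial derivatives of order at most k extending
   continuously from S to the part B of its boundary. *)
definition Ck_upto :: "nat \<Rightarrow> plane set \<Rightarrow> plane set \<Rightarrow> (plane \<Rightarrow> real) \<Rightarrow> bool" where
  "Ck_upto k S B g \<longleftrightarrow> Ck_on k S g \<and>
     (\<forall>m n. m + n \<le> k \<longrightarrow> (\<forall>q\<in>B. \<exists>l. (pd (m, n) g \<longlongrightarrow> l) (at q within S)))"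

definition Omega_pos :: "plane set \<Rightarrow> (plane \<Rightarrow> real) \<Rightarrow> plane set" where
  "Omega_pos \<Omega> \<psi> = {q \<in> \<Omega>. \<psi> q > 0}"

definition Omega_neg :: "plane set \<Rightarrow> (plane \<Rightarrow> real) \<Rightarrow> plane set" where
  "Omega_neg \<Omega> \<psi> = {q \<in> \<Omega>. \<psi> q < 0}"

definition Gamma :: "plane set \<Rightarrow> (plane \<Rightarrow> real) \<Rightarrow> plane set" where
  "Gamma \<Omega> \<psi> = {q \<in> \<Omega>. \<psi> q = 0}"

definition side_lim :: "plane set \<Rightarrow> plane \<Rightarrow> (plane \<Rightarrow> real) \<Rightarrow> real" where
  "side_lim S q w = Lim (at q within S) w"

definition jump :: "plane set \<Rightarrow> (plane \<Rightarrow> real) \<Rightarrow> plane \<Rightarrow> (plane \<Rightarrow> real) \<Rightarrow> real" where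
  "jump \<Omega> \<psi> q w = side_lim (Omega_pos \<Omega> \<psi>) q w - side_lim (Omega_neg \<Omega> \<psi>) q w"

(* t |-> (r t, s t) + q is a regular C^k parametrization of a relatively open piece of G
   containing q. Requiring a homeomorphism onto that piece is what makes G an embedded curve at q. *)
definition local_param ::
  "nat \<Rightarrow> plane set \<Rightarrow> plane \<Rightarrow> (real \<Rightarrow> real) \<Rightarrow> (real \<Rightarrow> real) \<Rightarrow> real \<Rightarrow> bool" where
  "local_param k G q r s \<epsilon> \<longleftrightarrow>
     0 < \<epsilon> \<and> Ck_real_on k {-\<epsilon><..<\<epsilon>} r \<and> Ck_real_on k {-\<epsilon><..<\<epsilon>} s \<and>
     r 0 = 0 \<and> s 0 = 0 \<and>
     (\<forall>t\<in>{-\<epsilon><..<\<epsilon>}. (deriv r t)\<^sup>2 + (deriv s t)\<^sup>2 > 0) \<and>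
     (\<exists>U. open U \<and> q \<in> U \<and>
        (\<exists>h. homeomorphism {-\<epsilon><..<\<epsilon>} (G \<inter> U) (\<lambda>t. (r t + fst q, s t + snd q)) h))"

(* For a smooth_interface the normal line at q is well defined and exactly one of its two unit
   vectors leads into Omega_pos, so the description below determines a unique vector. *)
definition unit_normal :: "plane set \<Rightarrow> (plane \<Rightarrow> real) \<Rightarrow> plane \<Rightarrow> plane" where
  "unit_normal \<Omega> \<psi> q = (THE n. norm n = 1 \<and>
     (\<exists>r s \<epsilon>. local_param 1 (Gamma \<Omega> \<psi>) q r s \<epsilon> \<and> n \<bullet> (deriv r 0, deriv s 0) = 0) \<and>
     (\<forall>\<^sub>F \<delta> in at_right 0. q + \<delta> *\<^sub>R n \<in> Omega_pos \<Omega> \<psi>))"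

(* The last conjunct says that Gamma separates the two sides: an embedded curve locally has two
   sides, on each of which psi has a constant sign, and the two signs have to differ. *)
definition smooth_interface :: "nat \<Rightarrow> plane set \<Rightarrow> (plane \<Rightarrow> real) \<Rightarrow> bool" where
  "smooth_interface k \<Omega> \<psi> \<longleftrightarrow> Ck_on k \<Omega> \<psi> \<and>
     (\<forall>q\<in>Gamma \<Omega> \<psi>. \<exists>r s \<epsilon>. local_param k (Gamma \<Omega> \<psi>) q r s \<epsilon>) \<and>
     Gamma \<Omega> \<psi> \<subseteq> closure (Omega_pos \<Omega> \<psi>) \<inter> closure (Omega_neg \<Omega> \<psi>)"

definition piecewise_Ck :: "nat \<Rightarrow> plane set \<Rightarrow> (plane \<Rightarrow> real) \<Rightarrow> (plane \<Rightarrow> real) \<Rightarrow> bool" where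
  "piecewise_Ck k \<Omega> \<psi> g \<longleftrightarrow>
     Ck_upto k (Omega_pos \<Omega> \<psi>) (Gamma \<Omega> \<psi>) g \<and> Ck_upto k (Omega_neg \<Omega> \<psi>) (Gamma \<Omega> \<psi>) g"

definition positive_coefficient :: "plane set \<Rightarrow> (plane \<Rightarrow> real) \<Rightarrow> (plane \<Rightarrow> real) \<Rightarrow> bool" where
  "positive_coefficient \<Omega> \<psi> a \<longleftrightarrow>
     (\<forall>q\<in>\<Omega> - Gamma \<Omega> \<psi>. a q > 0) \<and>
     (\<forall>q\<in>Gamma \<Omega> \<psi>. side_lim (Omega_pos \<Omega> \<psi>) q a > 0 \<and> side_lim (Omega_neg \<Omega> \<psi>) q a > 0)"

(* The orders of differentiability here and in interface_problem are exactly those of the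
   derivatives occurring in the transmission identity for M. *)
definition interface_setting ::
  "nat \<Rightarrow> plane set \<Rightarrow> (plane \<Rightarrow> real) \<Rightarrow> (plane \<Rightarrow> real) \<Rightarrow> plane \<Rightarrow>
   (real \<Rightarrow> real) \<Rightarrow> (real \<Rightarrow> real) \<Rightarrow> real \<Rightarrow> bool" where
  "interface_setting M \<Omega> \<psi> a p r s \<epsilon> \<longleftrightarrow>
     smooth_interface (M + 1) \<Omega> \<psi> \<and> piecewise_Ck M \<Omega> \<psi> a \<and> positive_coefficient \<Omega> \<psi> a \<and>
     p \<in> Gamma \<Omega> \<psi> \<and> local_param (M + 1) (Gamma \<Omega> \<psi>) p r s \<epsilon>"

definition interface_problem ::
  "nat \<Rightarrow> plane set \<Rightarrow> (plane \<Rightarrow> real) \<Rightarrow> (plane \<Rightarrow> real) \<Rightarrow> plane \<Rightarrow> (plane \<Rightarrow> real) \<Rightarrow>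
   (plane \<Rightarrow> real) \<Rightarrow> (plane \<Rightarrow> real) \<Rightarrow> (plane \<Rightarrow> real) \<Rightarrow> bool" where
  "interface_problem M \<Omega> \<psi> a p u f g\<^sub>D g\<^sub>N \<longleftrightarrow>
     piecewise_Ck (M + 1) \<Omega> \<psi> u \<and> piecewise_Ck (M - 1) \<Omega> \<psi> f \<and>
     (\<exists>U. open U \<and> p \<in> U \<and> Ck_on (M + 1) U g\<^sub>D \<and> Ck_on M U g\<^sub>N) \<and>
     (\<forall>q\<in>\<Omega> - Gamma \<Omega> \<psi>. - div_flux a u q = f q) \<and>
     (\<forall>q\<in>Gamma \<Omega> \<psi>. jump \<Omega> \<psi> q u = g\<^sub>D q \<and>
        jump \<Omega> \<psi> q (\<lambda>z. (a z *\<^sub>R grad u z) \<bullet> unit_normal \<Omega> \<psi> q) = g\<^sub>N q)"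

definition Lam :: "nat \<Rightarrow> (nat \<times> nat) set" where
  "Lam N = {(m, n). m + n \<le> N}"

definition LamV1 :: "nat \<Rightarrow> (nat \<times> nat) set" where
  "LamV1 N = {(m, n) \<in> Lam N. m \<in> {0, 1}}"

abbreviation deg :: "nat \<times> nat \<Rightarrow> nat" where
  "deg \<alpha> \<equiv> fst \<alpha> + snd \<alpha>"

(* Multi-indices are pairs; a coefficient T \<beta> \<alpha> is T_{m',n',m,n} with \<beta> = (m',n'), \<alpha> = (m,n). *)
type_synonym coeffs = "nat \<times> nat \<Rightarrow> nat \<times> nat \<Rightarrow> real"

definition transmission_identity ::
  "nat \<Rightarrow> plane set \<Rightarrow> (plane \<Rightarrow> real) \<Rightarrow> plane \<Rightarrow> (plane \<Rightarrow> real) \<Rightarrow> (plane \<Rightarrow> real) \<Rightarrow>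
   (plane \<Rightarrow> real) \<Rightarrow> (plane \<Rightarrow> real) \<Rightarrow> coeffs \<Rightarrow> coeffs \<Rightarrow> coeffs \<Rightarrow> coeffs \<Rightarrow> coeffs \<Rightarrow> bool" where
  "transmission_identity M \<Omega> \<psi> p u f g\<^sub>D g\<^sub>N T\<^sub>u T\<^sub>p T\<^sub>m T\<^sub>D T\<^sub>N \<longleftrightarrow>
     (\<forall>\<beta>\<in>LamV1 (M + 1).
        side_lim (Omega_neg \<Omega> \<psi>) p (pd \<beta> u) =
          (\<Sum>\<alpha>\<in>{\<alpha> \<in> LamV1 (M + 1). deg \<alpha> \<le> deg \<beta>}.
              T\<^sub>u \<beta> \<alpha> * side_lim (Omega_pos \<Omega> \<psi>) p (pd \<alpha> u))
        + (\<Sum>\<alpha>\<in>Lam (M - 1). T\<^sub>p \<beta> \<alpha> * side_lim (Omega_pos \<Omega> \<psi>) p (pd \<alpha> f)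
                          + T\<^sub>m \<beta> \<alpha> * side_lim (Omega_neg \<Omega> \<psi>) p (pd \<alpha> f))
        + (\<Sum>\<alpha>\<in>Lam (M + 1). T\<^sub>D \<beta> \<alpha> * pd \<alpha> g\<^sub>D p)
        + (\<Sum>\<alpha>\<in>Lam M. T\<^sub>N \<beta> \<alpha> * pd \<alpha> g\<^sub>N p))"

definition universal_coeffs ::
  "nat \<Rightarrow> plane set \<Rightarrow> (plane \<Rightarrow> real) \<Rightarrow> (plane \<Rightarrow> real) \<Rightarrow> plane \<Rightarrow>
   coeffs \<Rightarrow> coeffs \<Rightarrow> coeffs \<Rightarrow> coeffs \<Rightarrow> coeffs \<Rightarrow> bool" where
  "universal_coeffs M \<Omega> \<psi> a p T\<^sub>u T\<^sub>p T\<^sub>m T\<^sub>D T\<^sub>N \<longleftrightarrow>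
     (\<forall>u f g\<^sub>D g\<^sub>N. interface_problem M \<Omega> \<psi> a p u f g\<^sub>D g\<^sub>N \<longrightarrow>
        transmission_identity M \<Omega> \<psi> p u f g\<^sub>D g\<^sub>N T\<^sub>u T\<^sub>p T\<^sub>m T\<^sub>D T\<^sub>N)"

(* Equality of the coefficients that actually occur in the transmission identity. *)
definition same_coeffs ::
  "nat \<Rightarrow> coeffs \<Rightarrow> coeffs \<Rightarrow> coeffs \<Rightarrow> coeffs \<Rightarrow> coeffs \<Rightarrow>
   coeffs \<Rightarrow> coeffs \<Rightarrow> coeffs \<Rightarrow> coeffs \<Rightarrow> coeffs \<Rightarrow> bool" where
  "same_coeffs M T\<^sub>u T\<^sub>p T\<^sub>m T\<^sub>D T\<^sub>N S\<^sub>u S\<^sub>p S\<^sub>m S\<^sub>D S\<^sub>N \<longleftrightarrow>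
     (\<forall>\<beta>\<in>LamV1 (M + 1).
        (\<forall>\<alpha>\<in>LamV1 (M + 1). deg \<alpha> \<le> deg \<beta> \<longrightarrow> S\<^sub>u \<beta> \<alpha> = T\<^sub>u \<beta> \<alpha>) \<and>
        (\<forall>\<alpha>\<in>Lam (M - 1). S\<^sub>p \<beta> \<alpha> = T\<^sub>p \<beta> \<alpha> \<and> S\<^sub>m \<beta> \<alpha> = T\<^sub>m \<beta> \<alpha>) \<and>
        (\<forall>\<alpha>\<in>Lam (M + 1). S\<^sub>D \<beta> \<alpha> = T\<^sub>D \<beta> \<alpha>) \<and>
        (\<forall>\<alpha>\<in>Lam M. S\<^sub>N \<beta> \<alpha> = T\<^sub>N \<beta> \<alpha>))"

(* Finite jets, restricted to the relevant indices so that a function of a jet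
   cannot depend on any other derivative. *)
definition curve_jet :: "nat \<Rightarrow> (real \<Rightarrow> real) \<Rightarrow> nat \<Rightarrow> real" where
  "curve_jet N r = restrict (\<lambda>k. (deriv ^^ k) r 0) {..N}"

definition side_jet :: "nat \<Rightarrow> plane set \<Rightarrow> plane \<Rightarrow> (plane \<Rightarrow> real) \<Rightarrow> nat \<times> nat \<Rightarrow> real" where
  "side_jet N S p a = restrict (\<lambda>\<alpha>. side_lim S p (pd \<alpha> a)) (Lam N)"

(* The sign in n = +-(s', -r') / |(s', -r')|. The jets of r and s do not determine it, and
   reversing it reverses the sign of g_N, hence of its transmission coefficients. *)
definition orientation ::
  "plane set \<Rightarrow> (plane \<Rightarrow> real) \<Rightarrow> plane \<Rightarrow> (real \<Rightarrow> real) \<Rightarrow> (real \<Rightarrow> real) \<Rightarrow> real" where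
  "orientation \<Omega> \<psi> p r s = sgn (unit_normal \<Omega> \<psi> p \<bullet> (deriv s 0, - deriv r 0))"

end

theory Submission
  imports Defs
begin

text \<open>Everything in the identity happens at the single point \<open>p\<close>, so the proof compares jets, that is, lists of
partial derivatives at \<open>p\<close>. A solution of the interface problem has a jet \<open>Up\<close> from the positive side and a
jet \<open>Um\<close> from the negative side, and the problem turns into a finite system of linear equations for the two:
the derivatives of the equation \<open>- div (a grad u) = f\<close> on each side, the derivatives of \<open>[u] = g\<^sub>D\<close> along the
curve up to order \<open>M + 1\<close>, and those of the flux condition, multiplied by the length of the tangent, up to order
\<open>M\<close>. The coefficients of this system (\<open>jet_system\<close>) are built from the
derivatives of \<open>r\<close>, \<open>s\<close> and of the two branches of \<open>a\<close> at \<open>p\<close> only, and from the sign that orients the normal.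

The system is triangular with respect to the order of differentiation. At order \<open>n\<close> the unknowns enter through
\<open>U (i + 2, j) + U (i, j + 2)\<close>, so up to known terms the entries of order \<open>n\<close> are the derivatives of a harmonic
polynomial: \<open>U (i, n - i) = Re (\<i> ^ i * z)\<close> for one complex number \<open>z\<close>. With \<open>w = s'(0) + \<i> r'(0)\<close>
the two jump conditions of order \<open>n\<close> then prescribe the real part of \<open>z w ^ n\<close> and, up to the factor \<open>- a\<close>, its
imaginary part. As \<open>w\<close> is nonzero, \<open>z\<close> is determined. Hence \<open>Um\<close> exists and is unique for arbitrary data, namely
for the entries of \<open>Up\<close> with at most one derivative in \<open>x\<close> and the jets of \<open>f\<close> on the two sides, of \<open>g\<^sub>D\<close> and of
\<open>g\<^sub>N\<close>. It depends linearly on these data, and the transmission coefficients are the solutions for unit data.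
Triangularity gives the restriction \<open>m + n \<le> m' + n'\<close>; the fact that only \<open>a(p)\<close> occurs in the leading part gives
the statement on \<open>m + n = m' + n'\<close>; constants solve the homogeneous problem, which gives the last two claims.

Two analytic facts link the jets to the problem. First, the one-sided limits of the derivatives of \<open>u\<close> are
differentiable along the interface and obey the chain rule there. This rests on a description of the interface near
\<open>p\<close> as a curve with exactly one side in each of the two regions, which also identifies the unit normal. Second, every
solution of the system of jets comes from an interface problem: take polynomials for the two branches of \<open>u\<close>, define
\<open>f\<close> by the equation, and extend the resulting jumps from the curve to a neighbourhood. The second fact makes all data
independent of each other, so that the coefficients are unique.\<close>

section \<open>Formal jets\<close>

text \<open>Pascal's rule for binomial sums; it carries all inductions on the Leibniz rule.\<close>

lemma sum_choose_Suc:
  fixes h :: "nat \<Rightarrow> nat \<Rightarrow> real"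
  shows "(\<Sum>l\<le>Suc k. real (Suc k choose l) * h l (Suc k - l)) =
         (\<Sum>l\<le>k. real (k choose l) * (h (Suc l) (k - l) + h l (Suc (k - l))))"
proof -
  have "(\<Sum>l\<le>Suc k. real (Suc k choose l) * h l (Suc k - l)) =
      h 0 (Suc k) + (\<Sum>l\<le>k. real (Suc k choose Suc l) * h (Suc l) (k - l))"
    by (simp add: sum.atMost_Suc_shift del: sum.atMost_Suc binomial_Suc_Suc)
  also have "\<dots> = h 0 (Suc k) + (\<Sum>l\<le>k. real (k choose Suc l) * h (Suc l) (k - l)) +
      (\<Sum>l\<le>k. real (k choose l) * h (Suc l) (k - l))"
    by (simp add: sum.distrib algebra_simps)
  also have "h 0 (Suc k) + (\<Sum>l\<le>k. real (k choose Suc l) * h (Suc l) (k - l)) =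
      (\<Sum>l\<le>Suc k. real (k choose l) * h l (Suc k - l))"
    by (simp add: sum.atMost_Suc_shift del: sum.atMost_Suc)
  also have "\<dots> = (\<Sum>l\<le>k. real (k choose l) * h l (Suc (k - l)))"
    by (simp add: Suc_diff_le)
  finally show ?thesis by (simp add: sum.distrib algebra_simps)
qed

type_synonym jet = "nat \<times> nat \<Rightarrow> real"

text \<open>The derivatives of a product at one point, computed from the derivatives of the two factors.\<close>

definition leib :: "(nat \<Rightarrow> real) \<Rightarrow> (nat \<Rightarrow> real) \<Rightarrow> nat \<Rightarrow> real" where
  "leib F G k = (\<Sum>l\<le>k. real (k choose l) * (F l * G (k - l)))"

text \<open>The Leibniz rule in each variable in turn gives the jet of a product of two functions of the plane.\<close>

definition leib2 :: "jet \<Rightarrow> jet \<Rightarrow> jet" where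
  "leib2 A U = (\<lambda>(i, j). \<Sum>k\<le>i. real (i choose k) *
     (\<Sum>l\<le>j. real (j choose l) * (A (k, l) * U (i - k, j - l))))"

definition jet_dx :: "jet \<Rightarrow> jet" where
  "jet_dx U = (\<lambda>(i, j). U (Suc i, j))"

definition jet_dy :: "jet \<Rightarrow> jet" where
  "jet_dy U = (\<lambda>(i, j). U (i, Suc j))"

text \<open>Let \<open>U\<close> be the jet of a function \<open>u\<close> at \<open>\<gamma>(0)\<close>, and let \<open>R\<close>, \<open>S\<close> list the derivatives of the coordinates
\<open>r\<close>, \<open>s\<close> of a curve \<open>\<gamma>\<close> at \<open>0\<close>. The value below is then the \<open>k\<close>-th derivative at \<open>0\<close> of
\<open>\<partial>\<^sup>\<alpha> u \<circ> \<gamma>\<close>: the recursion differentiates the chain rule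
\<open>(\<partial>\<^sup>\<alpha> u \<circ> \<gamma>)' = r' (\<partial>\<^sub>x \<partial>\<^sup>\<alpha> u \<circ> \<gamma>) + s' (\<partial>\<^sub>y \<partial>\<^sup>\<alpha> u \<circ> \<gamma>)\<close> by the Leibniz rule.\<close>

fun curve_jets :: "(nat \<Rightarrow> real) \<Rightarrow> (nat \<Rightarrow> real) \<Rightarrow> jet \<Rightarrow> nat \<Rightarrow> jet" where
  "curve_jets R S U 0 \<alpha> = U \<alpha>"
| "curve_jets R S U (Suc k) \<alpha> =
     (\<Sum>l\<le>k. real (k choose l) *
       (R (Suc (k - l)) * curve_jets R S U l (Suc (fst \<alpha>), snd \<alpha>) +
        S (Suc (k - l)) * curve_jets R S U l (fst \<alpha>, Suc (snd \<alpha>))))"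

lemma jet_dx_apply: "jet_dx U (i, j) = U (Suc i, j)" and jet_dy_apply: "jet_dy U (i, j) = U (i, Suc j)"
  by (simp_all add: jet_dx_def jet_dy_def)

text \<open>The jet of \<open>div (a grad u)\<close>.\<close>

definition pde_jet :: "jet \<Rightarrow> jet \<Rightarrow> jet" where
  "pde_jet A U = (\<lambda>(i, j). leib2 A (jet_dx U) (Suc i, j) + leib2 A (jet_dy U) (i, Suc j))"

text \<open>The \<open>k\<close>-th derivative along the curve of \<open>a (s' \<partial>\<^sub>x u - r' \<partial>\<^sub>y u)\<close>, the flux in the direction of the normal vector
\<open>(s', - r')\<close>. Leaving this vector unnormalized keeps square roots out of the unknowns.\<close>

definition flux_jet :: "(nat \<Rightarrow> real) \<Rightarrow> (nat \<Rightarrow> real) \<Rightarrow> jet \<Rightarrow> jet \<Rightarrow> nat \<Rightarrow> real" where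
  "flux_jet R S A U k = (\<Sum>l\<le>k. real (k choose l) *
     (S (Suc (k - l)) * curve_jets R S (leib2 A (jet_dx U)) l (0, 0) -
      R (Suc (k - l)) * curve_jets R S (leib2 A (jet_dy U)) l (0, 0)))"

lemma curve_jets_comb:
  "curve_jets R S (\<lambda>\<beta>. a * U \<beta> + b * V \<beta>) k \<alpha> =
   a * curve_jets R S U k \<alpha> + b * curve_jets R S V k \<alpha>"
proof (induction k arbitrary: \<alpha> rule: less_induct)
  case (less k)
  show ?case
  proof (cases k)
    case (Suc m)
    then show ?thesis
      using less by (simp add: sum_distrib_left sum.distrib[symmetric] algebra_simps)
  qed simp
qed

lemma curve_jets_zero: "curve_jets R S (\<lambda>\<alpha>. 0) k \<alpha> = 0"
  using curve_jets_comb[of R S 0 "\<lambda>\<alpha>. 0" 0 "\<lambda>\<alpha>. 0" k \<alpha>] by simp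

lemma leib2_comb: "leib2 A (\<lambda>\<beta>. a * U \<beta> + b * V \<beta>) \<alpha> = a * leib2 A U \<alpha> + b * leib2 A V \<alpha>"
  by (cases \<alpha>) (simp add: leib2_def sum_distrib_left sum.distrib[symmetric] algebra_simps)

lemma jet_dx_comb: "jet_dx (\<lambda>\<beta>. a * U \<beta> + b * V \<beta>) = (\<lambda>\<beta>. a * jet_dx U \<beta> + b * jet_dx V \<beta>)"
  by (auto simp: jet_dx_def fun_eq_iff)

lemma jet_dy_comb: "jet_dy (\<lambda>\<beta>. a * U \<beta> + b * V \<beta>) = (\<lambda>\<beta>. a * jet_dy U \<beta> + b * jet_dy V \<beta>)"
  by (auto simp: jet_dy_def fun_eq_iff)

lemma pde_jet_comb: "pde_jet A (\<lambda>\<beta>. a * U \<beta> + b * V \<beta>) \<alpha> = a * pde_jet A U \<alpha> + b * pde_jet A V \<alpha>"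
  by (cases \<alpha>) (simp add: pde_jet_def jet_dx_comb jet_dy_comb leib2_comb algebra_simps)

lemma flux_jet_comb:
  "flux_jet R S A (\<lambda>\<beta>. a * U \<beta> + b * V \<beta>) k = a * flux_jet R S A U k + b * flux_jet R S A V k"
proof -
  have "leib2 A (jet_dx (\<lambda>\<beta>. a * U \<beta> + b * V \<beta>)) =
      (\<lambda>\<beta>. a * leib2 A (jet_dx U) \<beta> + b * leib2 A (jet_dx V) \<beta>)"
    "leib2 A (jet_dy (\<lambda>\<beta>. a * U \<beta> + b * V \<beta>)) =
      (\<lambda>\<beta>. a * leib2 A (jet_dy U) \<beta> + b * leib2 A (jet_dy V) \<beta>)"
    by (auto simp: fun_eq_iff jet_dx_comb jet_dy_comb leib2_comb)
  then show ?thesis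
    by (simp add: flux_jet_def curve_jets_comb sum_distrib_left sum.distrib[symmetric] algebra_simps)
qed

lemma curve_jets_cong_curve:
  assumes "\<And>j. j \<le> k \<Longrightarrow> R j = R' j" "\<And>j. j \<le> k \<Longrightarrow> S j = S' j"
    "\<And>\<beta>. deg \<beta> \<le> deg \<alpha> + k \<Longrightarrow> U \<beta> = V \<beta>"
  shows "curve_jets R S U k \<alpha> = curve_jets R' S' V k \<alpha>"
  using assms
proof (induction k arbitrary: \<alpha> rule: less_induct)
  case (less k)
  show ?case
  proof (cases k)
    case 0
    then show ?thesis using less.prems by simp
  next
    case (Suc m)
    have "curve_jets R S U l (Suc (fst \<alpha>), snd \<alpha>) = curve_jets R' S' V l (Suc (fst \<alpha>), snd \<alpha>)"
      "curve_jets R S U l (fst \<alpha>, Suc (snd \<alpha>)) = curve_jets R' S' V l (fst \<alpha>, Suc (snd \<alpha>))"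
      if "l \<le> m" for l
      using that Suc by (auto intro!: less)
    moreover have "R (Suc (m - l)) = R' (Suc (m - l))" "S (Suc (m - l)) = S' (Suc (m - l))" for l
      using less.prems(1,2) Suc by auto
    ultimately show ?thesis using Suc by simp
  qed
qed

lemmas curve_jets_cong = curve_jets_cong_curve[OF refl refl]

lemma leib2_cong:
  assumes "\<And>\<beta>. deg \<beta> \<le> deg \<alpha> \<Longrightarrow> A \<beta> = B \<beta>" "\<And>\<beta>. deg \<beta> \<le> deg \<alpha> \<Longrightarrow> U \<beta> = V \<beta>"
  shows "leib2 A U \<alpha> = leib2 B V \<alpha>"
  using assms by (cases \<alpha>) (auto simp: leib2_def intro!: sum.cong)

lemma pde_jet_cong:
  assumes "\<And>\<beta>. deg \<beta> \<le> Suc (deg \<alpha>) \<Longrightarrow> A \<beta> = B \<beta>" "\<And>\<beta>. deg \<beta> \<le> Suc (Suc (deg \<alpha>)) \<Longrightarrow> U \<beta> = V \<beta>"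
  shows "pde_jet A U \<alpha> = pde_jet B V \<alpha>"
proof -
  obtain i j where \<alpha>: "\<alpha> = (i, j)" by force
  have "leib2 A (jet_dx U) (Suc i, j) = leib2 B (jet_dx V) (Suc i, j)"
    "leib2 A (jet_dy U) (i, Suc j) = leib2 B (jet_dy V) (i, Suc j)"
    using assms \<alpha> by (auto intro!: leib2_cong simp: jet_dx_def jet_dy_def)
  then show ?thesis by (simp add: pde_jet_def \<alpha>)
qed

lemma flux_jet_cong:
  assumes "\<And>j. j \<le> Suc k \<Longrightarrow> R j = R' j" "\<And>j. j \<le> Suc k \<Longrightarrow> S j = S' j"
    "\<And>\<beta>. deg \<beta> \<le> k \<Longrightarrow> A \<beta> = B \<beta>" "\<And>\<beta>. deg \<beta> \<le> Suc k \<Longrightarrow> U \<beta> = V \<beta>"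
  shows "flux_jet R S A U k = flux_jet R' S' B V k"
proof -
  have "curve_jets R S (leib2 A (jet_dx U)) l (0, 0) = curve_jets R' S' (leib2 B (jet_dx V)) l (0, 0)"
    "curve_jets R S (leib2 A (jet_dy U)) l (0, 0) = curve_jets R' S' (leib2 B (jet_dy V)) l (0, 0)"
    if "l \<le> k" for l
    using assms that by (auto intro!: curve_jets_cong_curve leib2_cong simp: jet_dx_def jet_dy_def)
  moreover have "R (Suc (k - l)) = R' (Suc (k - l))" "S (Suc (k - l)) = S' (Suc (k - l))" for l
    using assms(1,2) by auto
  ultimately show ?thesis by (simp add: flux_jet_def)
qed

section \<open>The leading part of the equations\<close>

text \<open>Jets without entries of order less than \<open>n\<close>. On such a jet every operator above reduces in order \<open>n\<close> to its leading
part, with the coefficient \<open>a\<close> and the tangent frozen at the point, and vanishes in lower order. The lemmas with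
suffix \<open>top\<close> and \<open>low\<close> record this.\<close>

definition vanishes_below :: "nat \<Rightarrow> jet \<Rightarrow> bool" where
  "vanishes_below n U \<longleftrightarrow> (\<forall>\<alpha>. deg \<alpha> < n \<longrightarrow> U \<alpha> = 0)"

lemma vanishes_belowD: "vanishes_below n U \<Longrightarrow> i + j < n \<Longrightarrow> U (i, j) = 0"
  by (simp add: vanishes_below_def)

lemma curve_jets_low:
  assumes "vanishes_below n U" "k + i + j < n"
  shows "curve_jets R S U k (i, j) = 0"
  using assms(2)
proof (induction k arbitrary: i j rule: less_induct)
  case (less k)
  show ?case
  proof (cases k)
    case 0 with less.prems assms(1) show ?thesis by (simp add: vanishes_belowD)
  next
    case (Suc m)
    then show ?thesis using less by (auto intro!: sum.neutral)
  qed
qed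

lemma sum_top: "(\<And>l. l < k \<Longrightarrow> h l = 0) \<Longrightarrow> (\<Sum>l\<le>k. h l) = (h k :: real)" for k :: nat
  by (subst sum.mono_neutral_cong_right[of _ "{k}" _ h]) auto

lemma curve_jets_top:
  assumes "vanishes_below n U" "Suc k + i + j = n"
  shows "curve_jets R S U (Suc k) (i, j) =
    R 1 * curve_jets R S U k (Suc i, j) + S 1 * curve_jets R S U k (i, Suc j)"
  using assms by (simp add: sum_top curve_jets_low[OF assms(1)])

lemma leib2_low:
  assumes "vanishes_below n U" "i + j < n"
  shows "leib2 A U (i, j) = 0"
  using assms(2) by (simp add: leib2_def vanishes_belowD[OF assms(1)])

lemma leib2_top:
  assumes "vanishes_below n U" "i + j = n"
  shows "leib2 A U (i, j) = A (0, 0) * U (i, j)"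
proof -
  have "leib2 A U (i, j) = (\<Sum>k\<le>i. if k = 0 then A (0, 0) * U (i, j) else 0)"
    unfolding leib2_def prod.case
  proof (rule sum.cong)
    fix k assume k: "k \<in> {..i}"
    show "real (i choose k) * (\<Sum>l\<le>j. real (j choose l) * (A (k, l) * U (i - k, j - l))) =
      (if k = 0 then A (0, 0) * U (i, j) else 0)"
    proof (cases "k = 0")
      case True
      have "(\<Sum>l\<le>j. real (j choose l) * (A (k, l) * U (i - k, j - l))) =
        (\<Sum>l\<le>j. if l = 0 then A (0, 0) * U (i, j) else 0)"
        using True assms(2) by (intro sum.cong) (auto simp: vanishes_belowD[OF assms(1)])
      with True show ?thesis by simp
    next
      case False
      then show ?thesis using k assms(2) by (simp add: vanishes_belowD[OF assms(1)])
    qed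
  qed simp
  then show ?thesis by simp
qed

lemma vanishes_below_dx: "vanishes_below n U \<Longrightarrow> vanishes_below (n - 1) (jet_dx U)"
  by (auto simp: vanishes_below_def jet_dx_def)

lemma vanishes_below_dy: "vanishes_below n U \<Longrightarrow> vanishes_below (n - 1) (jet_dy U)"
  by (auto simp: vanishes_below_def jet_dy_def)

lemma vanishes_below_leib2: "vanishes_below n U \<Longrightarrow> vanishes_below n (leib2 A U)"
  by (auto simp: vanishes_below_def[of _ "leib2 A U"] leib2_low)

lemma pde_jet_low:
  assumes "vanishes_below n U" "i + j + 2 < n"
  shows "pde_jet A U (i, j) = 0"
  using assms vanishes_below_dx[OF assms(1)] vanishes_below_dy[OF assms(1)]
  by (simp add: pde_jet_def leib2_low)

lemma pde_jet_top:
  assumes "vanishes_below n U" "i + j + 2 = n"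
  shows "pde_jet A U (i, j) = A (0, 0) * (U (i + 2, j) + U (i, j + 2))"
  using assms vanishes_below_dx[OF assms(1)] vanishes_below_dy[OF assms(1)]
  by (simp add: pde_jet_def leib2_top jet_dx_def jet_dy_def algebra_simps)

lemma flux_jet_low:
  assumes "vanishes_below n U" "Suc k < n"
  shows "flux_jet R S A U k = 0"
  using assms(2)
  by (simp add: flux_jet_def
      curve_jets_low[OF vanishes_below_leib2[OF vanishes_below_dx[OF assms(1)]]]
      curve_jets_low[OF vanishes_below_leib2[OF vanishes_below_dy[OF assms(1)]]])

lemma flux_jet_top:
  assumes "vanishes_below n U" "Suc k = n"
  shows "flux_jet R S A U k = S 1 * curve_jets R S (leib2 A (jet_dx U)) k (0, 0) -
    R 1 * curve_jets R S (leib2 A (jet_dy U)) k (0, 0)"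
  using assms(2) unfolding flux_jet_def
  by (subst sum_top)
     (auto simp:
      curve_jets_low[OF vanishes_below_leib2[OF vanishes_below_dx[OF assms(1)]]]
      curve_jets_low[OF vanishes_below_leib2[OF vanishes_below_dy[OF assms(1)]]])

text \<open>A derivative along the frozen tangent sends \<open>\<i> ^ i z\<close> to \<open>r' \<i> ^ Suc i z + s' \<i> ^ i z = \<i> ^ i z (s' + \<i> r')\<close>, so
that on harmonic jets it is multiplication by \<open>w = s' + \<i> r'\<close>.\<close>

lemma curve_jets_harmonic:
  assumes "vanishes_below n U" "\<And>i j. i + j = n \<Longrightarrow> U (i, j) = Re (\<i> ^ i * z)" "k + i + j = n"
  shows "curve_jets R S U k (i, j) = Re (\<i> ^ i * z * Complex (S 1) (R 1) ^ k)"
  using assms(3)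
proof (induction k arbitrary: i j)
  case 0 then show ?case using assms(2) by simp
next
  case (Suc k)
  then have "curve_jets R S U (Suc k) (i, j) =
     Re (of_real (R 1) * (\<i> ^ Suc i * z * Complex (S 1) (R 1) ^ k) +
         of_real (S 1) * (\<i> ^ i * z * Complex (S 1) (R 1) ^ k))"
    by (subst curve_jets_top[OF assms(1)]) auto
  also have "of_real (R 1) * (\<i> ^ Suc i * z * Complex (S 1) (R 1) ^ k) +
         of_real (S 1) * (\<i> ^ i * z * Complex (S 1) (R 1) ^ k) =
         \<i> ^ i * z * Complex (S 1) (R 1) ^ Suc k"
    by (simp add: Complex_eq algebra_simps)
  finally show ?case .
qed

text \<open>The flux replaces one tangential derivative by the normal one, that is, \<open>w\<close> by \<open>\<i> w\<close>; hence the imaginary part where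
\<open>curve_jets_harmonic\<close> has the real part.\<close>

lemma flux_jet_harmonic:
  assumes "vanishes_below n U" "\<And>i j. i + j = n \<Longrightarrow> U (i, j) = Re (\<i> ^ i * z)" "Suc k = n"
  shows "flux_jet R S A U k = - A (0, 0) * Im (z * Complex (S 1) (R 1) ^ n)"
proof -
  let ?w = "Complex (S 1) (R 1)"
  have vx: "vanishes_below k (jet_dx U)" and vy: "vanishes_below k (jet_dy U)"
    using vanishes_below_dx[OF assms(1)] vanishes_below_dy[OF assms(1)] assms(3) by auto
  have jx: "leib2 A (jet_dx U) (i, j) = Re (\<i> ^ i * (of_real (A (0, 0)) * (\<i> * z)))"
    and jy: "leib2 A (jet_dy U) (i, j) = Re (\<i> ^ i * (of_real (A (0, 0)) * z))"
    if "i + j = k" for i j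
  proof -
    have "jet_dx U (i, j) = Re (\<i> ^ Suc i * z)" "jet_dy U (i, j) = Re (\<i> ^ i * z)"
      using that assms(3) by (simp_all add: jet_dx_apply jet_dy_apply assms(2) del: power_Suc)
    then show "leib2 A (jet_dx U) (i, j) = Re (\<i> ^ i * (of_real (A (0, 0)) * (\<i> * z)))"
      "leib2 A (jet_dy U) (i, j) = Re (\<i> ^ i * (of_real (A (0, 0)) * z))"
      by (simp_all add: leib2_top[OF vx that] leib2_top[OF vy that])
         (simp_all add: algebra_simps)
  qed
  define P where "P = z * ?w ^ k"
  have "curve_jets R S (leib2 A (jet_dx U)) k (0, 0) =
      Re (\<i> ^ 0 * (of_real (A (0, 0)) * (\<i> * z)) * ?w ^ k)"
    by (intro curve_jets_harmonic[OF vanishes_below_leib2[OF vx]] jx) auto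
  also have "\<i> ^ 0 * (of_real (A (0, 0)) * (\<i> * z)) * ?w ^ k = of_real (A (0, 0)) * (\<i> * P)"
    by (simp add: P_def)
  finally have cx: "curve_jets R S (leib2 A (jet_dx U)) k (0, 0) = - A (0, 0) * Im P"
    by simp
  have "curve_jets R S (leib2 A (jet_dy U)) k (0, 0) =
      Re (\<i> ^ 0 * (of_real (A (0, 0)) * z) * ?w ^ k)"
    by (intro curve_jets_harmonic[OF vanishes_below_leib2[OF vy]] jy) auto
  also have "\<i> ^ 0 * (of_real (A (0, 0)) * z) * ?w ^ k = of_real (A (0, 0)) * P"
    by (simp add: P_def)
  finally have cy: "curve_jets R S (leib2 A (jet_dy U)) k (0, 0) = A (0, 0) * Re P"
    by simp
  have "z * ?w ^ n = ?w * P"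
    using assms(3) by (auto simp: P_def)
  then have "Im (z * ?w ^ n) = S 1 * Im P + R 1 * Re P"
    by simp
  then show ?thesis
    unfolding flux_jet_top[OF assms(1,3)] cx cy by (simp add: algebra_simps)
qed

text \<open>The recursion \<open>U (i + 2, j) = - U (i, j + 2)\<close> leaves two free real entries, which are packed into the complex number
\<open>z\<close>. In order \<open>0\<close> there is only one entry, and the normalization \<open>Im z = 0\<close> takes the place of the other.\<close>

lemma harmonic_level:
  assumes rec: "\<And>i j. i + j + 2 = n \<Longrightarrow> U (i + 2, j) + U (i, j + 2) = (0::real)"
  shows "\<exists>z. (\<forall>i j. i + j = n \<longrightarrow> U (i, j) = Re (\<i> ^ i * z)) \<and>
    Re z = U (0, n) \<and> (n = 0 \<longrightarrow> Im z = 0) \<and> (n > 0 \<longrightarrow> Im z = - U (1, n - 1))"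
proof -
  let ?z = "Complex (U (0, n)) (if n = 0 then 0 else - U (1, n - 1))"
  have *: "U (i, j) = Re (\<i> ^ i * ?z)" if "i + j = n" for i j
    using that
  proof (induction i arbitrary: j rule: induct_nat_012)
    case 0
    then show ?case by simp
  next
    case 1
    then have n: "n = Suc j" by simp
    show ?case by (simp add: n)
  next
    case (ge2 i)
    have "U (i, j + 2) = Re (\<i> ^ i * ?z)" by (rule ge2(1)) (use ge2(3) in simp)
    with rec[of i j] ge2(3) show ?case by simp
  qed
  show ?thesis
    by (intro exI[of _ ?z] conjI allI impI *) simp_all
qed

text \<open>The inhomogeneous recursion in the first index can be solved from any two initial entries.\<close>

lemma level_extension:
  fixes \<phi> :: jet
  assumes "a \<noteq> 0"
  shows "\<exists>V. (\<forall>\<beta>. deg \<beta> \<noteq> n \<longrightarrow> V \<beta> = 0) \<and> V (0, n) = x0 \<and> (n > 0 \<longrightarrow> V (1, n - 1) = x1) \<and>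
    (\<forall>i j. i + j + 2 = n \<longrightarrow> a * (V (i + 2, j) + V (i, j + 2)) = \<phi> (i, j))"
proof -
  have "\<exists>v. v 0 = x0 \<and> v 1 = x1 \<and> (\<forall>i. v (i + 2) = \<phi> (i, n - 2 - i) / a - v i)"
  proof -
    define w where "w = rec_nat (x0, x1) (\<lambda>i (p, q). (q, \<phi> (i, n - 2 - i) / a - p))"
    have w0: "w 0 = (x0, x1)" and wS: "\<And>i. w (Suc i) = (snd (w i), \<phi> (i, n - 2 - i) / a - fst (w i))"
      by (auto simp: w_def split: prod.split)
    show ?thesis by (rule exI[of _ "\<lambda>i. fst (w i)"]) (simp add: w0 wS)
  qed
  then obtain v where v: "v 0 = x0" "v 1 = x1" "\<And>i. v (i + 2) = \<phi> (i, n - 2 - i) / a - v i"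
    by blast
  have "a * (v (i + 2) + v i) = \<phi> (i, j)" if "i + j + 2 = n" for i j
  proof -
    have "n - 2 - i = j" using that by auto
    then show ?thesis using v(3)[of i] assms by simp
  qed
  then show ?thesis
    using v(1,2) by (intro exI[of _ "\<lambda>(i, j). if i + j = n then v i else 0"]) auto
qed

text \<open>One order of the problem on the negative side. A particular solution of the recursion is corrected by a harmonic jet,
whose complex parameter is adjusted to the tangential derivative and the flux.\<close>

lemma level_transmission:
  fixes \<phi> :: jet
  assumes a: "A (0, 0) \<noteq> 0" and w: "(R 1)\<^sup>2 + (S 1)\<^sup>2 > 0"
  shows "\<exists>V. (\<forall>\<beta>. deg \<beta> \<noteq> n \<longrightarrow> V \<beta> = 0) \<and>
    (\<forall>i j. i + j + 2 = n \<longrightarrow> A (0, 0) * (V (i + 2, j) + V (i, j + 2)) = \<phi> (i, j)) \<and>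
    curve_jets R S V n (0, 0) = d \<and> (\<forall>k. Suc k = n \<longrightarrow> flux_jet R S A V k = e)"
proof -
  obtain V0 :: jet where V0: "\<And>\<beta>. deg \<beta> \<noteq> n \<Longrightarrow> V0 \<beta> = 0"
    "\<And>i j. i + j + 2 = n \<Longrightarrow> A (0, 0) * (V0 (i + 2, j) + V0 (i, j + 2)) = \<phi> (i, j)"
    using level_extension[OF a, of n 0 0 \<phi>] by blast
  let ?w = "Complex (S 1) (R 1)"
  have wn: "?w \<noteq> 0" using w by (auto simp: complex_eq_iff)
  \<comment> \<open>The harmonic jet with this parameter contributes exactly the missing tangential derivative and flux.\<close>
  define z where "z = Complex (d - curve_jets R S V0 n (0, 0))
    (- (e - flux_jet R S A V0 (n - 1)) / A (0, 0)) / ?w ^ n"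
  have zw: "z * ?w ^ n = Complex (d - curve_jets R S V0 n (0, 0))
    (- (e - flux_jet R S A V0 (n - 1)) / A (0, 0))"
    using wn by (simp add: z_def)
  define H where "H = (\<lambda>(i, j). if i + j = n then Re (\<i> ^ i * z) else 0)"
  have H0: "\<And>\<beta>. deg \<beta> \<noteq> n \<Longrightarrow> H \<beta> = 0" by (auto simp: H_def)
  have Hv: "vanishes_below n H" by (auto simp: vanishes_below_def H0)
  have Hn: "\<And>i j. i + j = n \<Longrightarrow> H (i, j) = Re (\<i> ^ i * z)" by (auto simp: H_def)
  have c: "curve_jets R S H n (0, 0) = d - curve_jets R S V0 n (0, 0)"
    using curve_jets_harmonic[OF Hv Hn, of n 0 0 R S] by (simp add: zw[unfolded One_nat_def] del: times_complex.sel)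
  have f: "flux_jet R S A H k = e - flux_jet R S A V0 k" if "Suc k = n" for k
    using flux_jet_harmonic[OF Hv Hn that, of R S A] a that by (auto simp: zw[unfolded One_nat_def] simp del: times_complex.sel)
  show ?thesis
  proof (intro exI[of _ "\<lambda>\<beta>. 1 * V0 \<beta> + 1 * H \<beta>"] conjI allI impI)
    fix i j assume ij: "i + j + 2 = n"
    then have "H (i + 2, j) = - H (i, j + 2)" by (simp add: Hn)
    then show "A (0, 0) * (1 * V0 (i + 2, j) + 1 * H (i + 2, j) + (1 * V0 (i, j + 2) + 1 * H (i, j + 2)))
      = \<phi> (i, j)"
      using V0(2)[OF ij] by (simp add: algebra_simps)
  next
    show "curve_jets R S (\<lambda>\<beta>. 1 * V0 \<beta> + 1 * H \<beta>) n (0, 0) = d"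
      unfolding curve_jets_comb using c by simp
  next
    fix k assume "Suc k = n"
    then show "flux_jet R S A (\<lambda>\<beta>. 1 * V0 \<beta> + 1 * H \<beta>) k = e"
      unfolding flux_jet_comb using f by simp
  qed (use V0 H0 in auto)
qed

section \<open>The system of equations between the jets\<close>

datatype slot = Uplus | Fplus | Fminus | GDirichlet | GNeumann

lemma UNIV_slot: "UNIV = {Uplus, Fplus, Fminus, GDirichlet, GNeumann}"
  using slot.exhaust by auto

text \<open>The derivatives at \<open>0\<close> of the speed \<open>\<rho> = sqrt (r'\<^sup>2 + s'\<^sup>2)\<close>. Solving the Leibniz rule for
\<open>\<rho> * \<rho> = r'\<^sup>2 + s'\<^sup>2\<close> for the highest derivative shows that they depend on the derivatives of \<open>r\<close> and \<open>s\<close> at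
\<open>0\<close> only.\<close>

fun speed_jets :: "(nat \<Rightarrow> real) \<Rightarrow> (nat \<Rightarrow> real) \<Rightarrow> nat \<Rightarrow> real" where
  "speed_jets R S 0 = sqrt ((R 1)\<^sup>2 + (S 1)\<^sup>2)"
| "speed_jets R S (Suc k) =
    (leib (\<lambda>l. R (Suc l)) (\<lambda>l. R (Suc l)) (Suc k) + leib (\<lambda>l. S (Suc l)) (\<lambda>l. S (Suc l)) (Suc k)
     - (\<Sum>l\<in>{1..k}. real (Suc k choose l) * (speed_jets R S l * speed_jets R S (Suc k - l))))
    / (2 * sqrt ((R 1)\<^sup>2 + (S 1)\<^sup>2))"

lemma speed_jets_unique:
  assumes "L 0 > 0"
    and "\<And>k. k \<le> m \<Longrightarrow> leib L L k =
      leib (\<lambda>l. R (Suc l)) (\<lambda>l. R (Suc l)) k + leib (\<lambda>l. S (Suc l)) (\<lambda>l. S (Suc l)) k"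
    and "k \<le> m"
  shows "L k = speed_jets R S k"
  using assms(3)
proof (induction k rule: less_induct)
  case (less k)
  have L0: "L 0 = sqrt ((R 1)\<^sup>2 + (S 1)\<^sup>2)"
    using assms(2)[of 0] assms(1) by (simp add: leib_def power2_eq_square real_sqrt_unique)
  show ?case
  proof (cases k)
    case 0
    then show ?thesis using L0 by simp
  next
    case (Suc j)
    have "leib L L k = 2 * L 0 * L k + (\<Sum>l\<in>{1..j}. real (Suc j choose l) * (L l * L (Suc j - l)))"
    proof -
      have "{..Suc j} = insert 0 (insert (Suc j) {1..j})" by auto
      then show ?thesis by (simp add: leib_def Suc algebra_simps del: sum.atMost_Suc)
    qed
    also have "(\<Sum>l\<in>{1..j}. real (Suc j choose l) * (L l * L (Suc j - l))) =
      (\<Sum>l\<in>{1..j}. real (Suc j choose l) * (speed_jets R S l * speed_jets R S (Suc j - l)))"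
      using less Suc by (intro sum.cong) auto
    finally have "2 * L 0 * L k = leib L L k -
      (\<Sum>l\<in>{1..j}. real (Suc j choose l) * (speed_jets R S l * speed_jets R S (Suc j - l)))"
      by simp
    then have "L k = (leib L L k -
      (\<Sum>l\<in>{1..j}. real (Suc j choose l) * (speed_jets R S l * speed_jets R S (Suc j - l)))) / (2 * L 0)"
      using assms(1) by (simp add: field_simps)
    then show ?thesis
      using assms(2)[OF less.prems] Suc L0 by simp
  qed
qed

lemma speed_jets_cong:
  assumes "\<And>j. j \<le> Suc k \<Longrightarrow> R j = R' j" "\<And>j. j \<le> Suc k \<Longrightarrow> S j = S' j"
  shows "speed_jets R S k = speed_jets R' S' k"
  using assms
proof (induction k rule: less_induct)
  case (less k)
  show ?case
  proof (cases k)
    case 0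
    then show ?thesis using less.prems by simp
  next
    case (Suc m)
    have "(\<Sum>l\<in>{1..m}. real (Suc m choose l) * (speed_jets R S l * speed_jets R S (Suc m - l))) =
        (\<Sum>l\<in>{1..m}. real (Suc m choose l) * (speed_jets R' S' l * speed_jets R' S' (Suc m - l)))"
      using Suc less by (intro sum.cong refl arg_cong2[of _ _ _ _ "(*)"]) auto
    moreover have "leib (\<lambda>l. R (Suc l)) (\<lambda>l. R (Suc l)) k = leib (\<lambda>l. R' (Suc l)) (\<lambda>l. R' (Suc l)) k"
      "leib (\<lambda>l. S (Suc l)) (\<lambda>l. S (Suc l)) k = leib (\<lambda>l. S' (Suc l)) (\<lambda>l. S' (Suc l)) k"
      using less.prems by (auto simp: leib_def intro!: sum.cong)
    moreover have "R 1 = R' 1" "S 1 = S' 1" using less.prems by auto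
    ultimately show ?thesis using Suc by simp
  qed
qed

text \<open>The interface problem seen through jets up to, but not including, order \<open>n\<close>. Here \<open>\<sigma>\<close> is the sign in
\<open>n = \<sigma> (s', - r') / \<rho>\<close>; the flux condition \<open>[a grad u \<bullet> n] = g\<^sub>N\<close> has been multiplied by \<open>\<sigma> \<rho>\<close>, which is why
the derivatives of the speed appear next to the Neumann datum.\<close>

definition jet_system :: "nat \<Rightarrow> (nat \<Rightarrow> real) \<Rightarrow> (nat \<Rightarrow> real) \<Rightarrow> jet \<Rightarrow> jet \<Rightarrow> real \<Rightarrow>
    (slot \<Rightarrow> jet) \<Rightarrow> jet \<Rightarrow> jet \<Rightarrow> bool" where
  "jet_system n R S Ap Am \<sigma> D Up Um \<longleftrightarrow>
     (\<forall>\<alpha>. fst \<alpha> \<le> 1 \<and> deg \<alpha> < n \<longrightarrow> Up \<alpha> = D Uplus \<alpha>) \<and>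
     (\<forall>\<alpha>. deg \<alpha> + 2 < n \<longrightarrow> pde_jet Ap Up \<alpha> = - D Fplus \<alpha> \<and> pde_jet Am Um \<alpha> = - D Fminus \<alpha>) \<and>
     (\<forall>k<n. curve_jets R S Up k (0, 0) - curve_jets R S Um k (0, 0) =
        curve_jets R S (D GDirichlet) k (0, 0)) \<and>
     (\<forall>k. Suc k < n \<longrightarrow> flux_jet R S Ap Up k - flux_jet R S Am Um k =
        \<sigma> * leib (speed_jets R S) (\<lambda>l. curve_jets R S (D GNeumann) l (0, 0)) k)"

lemma jet_system_mono: "jet_system n R S Ap Am \<sigma> D Up Um \<Longrightarrow> m \<le> n \<Longrightarrow> jet_system m R S Ap Am \<sigma> D Up Um"
  by (auto simp: jet_system_def)

lemma leib_comb: "leib F (\<lambda>l. a * G l + b * H l) k = a * leib F G k + b * leib F H k"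
  by (simp add: leib_def sum_distrib_left sum.distrib[symmetric] algebra_simps)

lemma jet_system_comb:
  assumes "jet_system n R S Ap Am \<sigma> D Up Um" "jet_system n R S Ap Am \<sigma> E Vp Vm"
  shows "jet_system n R S Ap Am \<sigma> (\<lambda>s \<alpha>. a * D s \<alpha> + b * E s \<alpha>)
    (\<lambda>\<alpha>. a * Up \<alpha> + b * Vp \<alpha>) (\<lambda>\<alpha>. a * Um \<alpha> + b * Vm \<alpha>)"
proof -
  have *: "(a * x + b * y) - (a * x' + b * y') = a * (x - x') + b * (y - y')" for x y x' y' :: real
    by (simp add: algebra_simps)
  have **: "\<sigma> * (a * x + b * y) = a * (\<sigma> * x) + b * (\<sigma> * y)" for x y :: real
    by (simp add: algebra_simps)
  show ?thesis
    using assms unfolding jet_system_def curve_jets_comb pde_jet_comb flux_jet_comb leib_comb * **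
    by auto
qed

lemma vanishes_belowI: "(\<And>\<beta>. deg \<beta> \<noteq> n \<Longrightarrow> V \<beta> = 0) \<Longrightarrow> vanishes_below n V"
  by (auto simp: vanishes_below_def)

text \<open>Orders are added one at a time. A correction that is concentrated in order \<open>n\<close> does not disturb the equations of lower
order, and in order \<open>n\<close> it is found by \<open>level_extension\<close> on the positive side and by \<open>level_transmission\<close>
on the negative side.\<close>

lemma jet_system_exists:
  assumes a: "Ap (0, 0) \<noteq> 0" "Am (0, 0) \<noteq> 0" and w: "(R 1)\<^sup>2 + (S 1)\<^sup>2 > 0"
  shows "\<exists>Up Um. jet_system n R S Ap Am \<sigma> D Up Um"
proof (induction n)
  case 0
  show ?case by (simp add: jet_system_def)
next
  case (Suc n)
  then obtain Up Um where U: "jet_system n R S Ap Am \<sigma> D Up Um" by blast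
  obtain Vp where Vp: "\<And>\<beta>. deg \<beta> \<noteq> n \<Longrightarrow> Vp \<beta> = 0"
      "Vp (0, n) = D Uplus (0, n) - Up (0, n)" "n > 0 \<Longrightarrow> Vp (1, n - 1) = D Uplus (1, n - 1) - Up (1, n - 1)"
      "\<And>i j. i + j + 2 = n \<Longrightarrow> Ap (0, 0) * (Vp (i + 2, j) + Vp (i, j + 2)) =
         (\<lambda>(i, j). - D Fplus (i, j) - pde_jet Ap Up (i, j)) (i, j)"
    using level_extension[OF a(1), of n "D Uplus (0, n) - Up (0, n)" "D Uplus (1, n - 1) - Up (1, n - 1)"
        "\<lambda>(i, j). - D Fplus (i, j) - pde_jet Ap Up (i, j)"] by blast
  note vp = vanishes_belowI[of n Vp, OF Vp(1)]
  define Up' where "Up' = (\<lambda>\<beta>. 1 * Up \<beta> + 1 * Vp \<beta>)"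
  obtain Vm where Vm: "\<And>\<beta>. deg \<beta> \<noteq> n \<Longrightarrow> Vm \<beta> = 0"
      "\<And>i j. i + j + 2 = n \<Longrightarrow> Am (0, 0) * (Vm (i + 2, j) + Vm (i, j + 2)) =
         (\<lambda>(i, j). - D Fminus (i, j) - pde_jet Am Um (i, j)) (i, j)"
      "curve_jets R S Vm n (0, 0) = curve_jets R S Up' n (0, 0)
         - curve_jets R S (D GDirichlet) n (0, 0) - curve_jets R S Um n (0, 0)"
      "\<And>k. Suc k = n \<Longrightarrow> flux_jet R S Am Vm k = flux_jet R S Ap Up' (n - 1)
         - \<sigma> * leib (speed_jets R S) (\<lambda>l. curve_jets R S (D GNeumann) l (0, 0)) (n - 1)
         - flux_jet R S Am Um (n - 1)"
    using level_transmission[where A = Am and R = R and S = S, OF a(2) w, of n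
        "\<lambda>(i, j). - D Fminus (i, j) - pde_jet Am Um (i, j)"
        "curve_jets R S Up' n (0, 0) - curve_jets R S (D GDirichlet) n (0, 0) - curve_jets R S Um n (0, 0)"
        "flux_jet R S Ap Up' (n - 1)
         - \<sigma> * leib (speed_jets R S) (\<lambda>l. curve_jets R S (D GNeumann) l (0, 0)) (n - 1)
         - flux_jet R S Am Um (n - 1)"] by blast
  note vm = vanishes_belowI[of n Vm, OF Vm(1)]
  define Um' where "Um' = (\<lambda>\<beta>. 1 * Um \<beta> + 1 * Vm \<beta>)"
  have "jet_system (Suc n) R S Ap Am \<sigma> D Up' Um'"
    unfolding jet_system_def
  proof (intro conjI allI impI)
    fix \<alpha> :: "nat \<times> nat" assume \<alpha>: "fst \<alpha> \<le> 1 \<and> deg \<alpha> < Suc n"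
    obtain i j where ij: "\<alpha> = (i, j)" by force
    show "Up' \<alpha> = D Uplus \<alpha>"
    proof (cases "deg \<alpha> < n")
      case True
      then have "Up \<alpha> = D Uplus \<alpha>" using U \<alpha> unfolding jet_system_def by blast
      then show ?thesis using True Vp(1)[of \<alpha>] by (simp add: Up'_def)
    next
      case False
      then have "i + j = n" "i = 0 \<or> i = 1" using \<alpha> ij by auto
      then show ?thesis using Vp(2,3) ij by (auto simp: Up'_def)
    qed
  next
    fix \<alpha> :: "nat \<times> nat" assume \<alpha>: "deg \<alpha> + 2 < Suc n"
    obtain i j where ij: "\<alpha> = (i, j)" by force
    show "pde_jet Ap Up' \<alpha> = - D Fplus \<alpha>"
    proof (cases "i + j + 2 = n")
      case True
      then show ?thesis using Vp(4)[OF True] pde_jet_top[OF vp True, of Ap]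
        unfolding Up'_def pde_jet_comb ij by simp
    next
      case False
      then have "i + j + 2 < n" using \<alpha> ij by simp
      then have "pde_jet Ap Up \<alpha> = - D Fplus \<alpha>" using U ij unfolding jet_system_def by simp
      then show ?thesis using pde_jet_low[OF vp \<open>i + j + 2 < n\<close>, of Ap]
        unfolding Up'_def pde_jet_comb ij by simp
    qed
    show "pde_jet Am Um' \<alpha> = - D Fminus \<alpha>"
    proof (cases "i + j + 2 = n")
      case True
      then show ?thesis using Vm(2)[OF True] pde_jet_top[OF vm True, of Am]
        unfolding Um'_def pde_jet_comb ij by simp
    next
      case False
      then have "i + j + 2 < n" using \<alpha> ij by simp
      then have "pde_jet Am Um \<alpha> = - D Fminus \<alpha>" using U ij unfolding jet_system_def by simp
      then show ?thesis using pde_jet_low[OF vm \<open>i + j + 2 < n\<close>, of Am]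
        unfolding Um'_def pde_jet_comb ij by simp
    qed
  next
    fix k assume k: "k < Suc n"
    show "curve_jets R S Up' k (0, 0) - curve_jets R S Um' k (0, 0) = curve_jets R S (D GDirichlet) k (0, 0)"
    proof (cases "k < n")
      case True
      then show ?thesis using U curve_jets_low[OF vp, of k 0 0] curve_jets_low[OF vm, of k 0 0]
        unfolding Up'_def Um'_def curve_jets_comb by (simp add: jet_system_def)
    next
      case False
      then have "k = n" using k by simp
      then show ?thesis using Vm(3) unfolding Um'_def curve_jets_comb by simp
    qed
  next
    fix k assume k: "Suc k < Suc n"
    show "flux_jet R S Ap Up' k - flux_jet R S Am Um' k =
        \<sigma> * leib (speed_jets R S) (\<lambda>l. curve_jets R S (D GNeumann) l (0, 0)) k"
    proof (cases "Suc k < n")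
      case True
      then show ?thesis using U flux_jet_low[OF vp True] flux_jet_low[OF vm True]
        unfolding Up'_def Um'_def flux_jet_comb by (simp add: jet_system_def)
    next
      case False
      then have "Suc k = n" "n - 1 = k" using k by simp_all
      then show ?thesis using Vm(4)[of k] unfolding Um'_def flux_jet_comb by simp
    qed
  qed
  then show ?case by blast
qed

lemma harmonic_zero:
  fixes U :: jet
  assumes "vanishes_below n U" "\<And>i j. i + j = n \<Longrightarrow> U (i, j) = Re (\<i> ^ i * 0)"
  shows "vanishes_below (Suc n) U"
  using assms by (auto simp: vanishes_below_def less_Suc_eq)

text \<open>Once the lower orders vanish, the entries of order \<open>n\<close> are harmonic. On the positive side their parameter \<open>z\<close> is part of
the data; on the negative side the two jump conditions say \<open>y w ^ n = 0\<close>.\<close>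

lemma jet_system_homogeneous:
  assumes a: "Ap (0, 0) \<noteq> 0" "Am (0, 0) \<noteq> 0" and w: "(R 1)\<^sup>2 + (S 1)\<^sup>2 > 0"
    and "jet_system n R S Ap Am \<sigma> (\<lambda>s \<alpha>. 0) Up Um"
  shows "vanishes_below n Up \<and> vanishes_below n Um"
  using assms(4)
proof (induction n)
  case 0
  show ?case by (simp add: vanishes_below_def)
next
  case (Suc n)
  have "vanishes_below n Up" "vanishes_below n Um"
    using Suc.IH jet_system_mono[OF Suc.prems] by auto
  note vp = this(1) and vm = this(2)
  have sys: "\<And>\<alpha>. fst \<alpha> \<le> 1 \<Longrightarrow> deg \<alpha> \<le> n \<Longrightarrow> Up \<alpha> = 0"
    "\<And>\<alpha>. deg \<alpha> + 2 \<le> n \<Longrightarrow> pde_jet Ap Up \<alpha> = 0"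
    "\<And>\<alpha>. deg \<alpha> + 2 \<le> n \<Longrightarrow> pde_jet Am Um \<alpha> = 0"
    "\<And>k. k \<le> n \<Longrightarrow> curve_jets R S Up k (0, 0) = curve_jets R S Um k (0, 0)"
    "\<And>k. Suc k \<le> n \<Longrightarrow> flux_jet R S Ap Up k = flux_jet R S Am Um k"
    using Suc.prems by (auto simp: jet_system_def curve_jets_zero leib_def)
  have "Up (i + 2, j) + Up (i, j + 2) = 0" if "i + j + 2 = n" for i j
    using pde_jet_top[OF vp that, of Ap] sys(2)[of "(i, j)"] a that by simp
  then obtain z where z: "\<And>i j. i + j = n \<Longrightarrow> Up (i, j) = Re (\<i> ^ i * z)"
    "Re z = Up (0, n)" "n = 0 \<Longrightarrow> Im z = 0" "n > 0 \<Longrightarrow> Im z = - Up (1, n - 1)"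
    using harmonic_level[of n Up] by blast
  have "Re z = 0" using z(2) sys(1)[of "(0, n)"] by simp
  moreover have "Im z = 0" using z(3,4) sys(1)[of "(1, n - 1)"] by (cases n) simp_all
  ultimately have "z = 0" by (simp add: complex_eq_iff)
  with z(1) have up: "vanishes_below (Suc n) Up" by (intro harmonic_zero[OF vp]) auto
  have "Um (i + 2, j) + Um (i, j + 2) = 0" if "i + j + 2 = n" for i j
    using pde_jet_top[OF vm that, of Am] sys(3)[of "(i, j)"] a that by simp
  then obtain y where y: "\<And>i j. i + j = n \<Longrightarrow> Um (i, j) = Re (\<i> ^ i * y)"
    "Re y = Um (0, n)" "n = 0 \<Longrightarrow> Im y = 0" "n > 0 \<Longrightarrow> Im y = - Um (1, n - 1)"
    using harmonic_level[of n Um] by blast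
  let ?w = "Complex (S 1) (R 1)"
  have "Re (y * ?w ^ n) = 0"
    using curve_jets_harmonic[OF vm y(1), of n 0 0 R S] sys(4)[of n] curve_jets_low[OF up, of n 0 0 R S]
    by simp
  moreover have "Im (y * ?w ^ n) = 0"
  proof (cases n)
    case 0 then show ?thesis using y(3) by simp
  next
    case (Suc k)
    then have k: "Suc k = n" by simp
    have "flux_jet R S Am Um k = - Am (0, 0) * Im (y * ?w ^ n)"
      by (rule flux_jet_harmonic[OF vm y(1) k])
    moreover have "flux_jet R S Am Um k = 0"
      using sys(5)[of k] flux_jet_low[OF up, of k R S Ap] k by simp
    ultimately show ?thesis using a(2) by (metis mult_eq_0_iff neg_equal_0_iff_equal)
  qed
  ultimately have "y * ?w ^ n = 0" by (simp add: complex_eq_iff)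
  moreover have "?w \<noteq> 0" using w by (auto simp: complex_eq_iff)
  ultimately have "y = 0" by simp
  with y(1) have "vanishes_below (Suc n) Um" by (intro harmonic_zero[OF vm]) auto
  with up show ?case by simp
qed

lemma jet_system_unique:
  assumes "Ap (0, 0) \<noteq> 0" "Am (0, 0) \<noteq> 0" "(R 1)\<^sup>2 + (S 1)\<^sup>2 > 0"
    and "jet_system n R S Ap Am \<sigma> D Up Um" "jet_system n R S Ap Am \<sigma> D Vp Vm" "deg \<beta> < n"
  shows "Um \<beta> = Vm \<beta>"
proof -
  have "vanishes_below n (\<lambda>\<alpha>. 1 * Um \<alpha> + (-1) * Vm \<alpha>)"
    using jet_system_homogeneous[where Ap = Ap and Am = Am and R = R and S = S, OF assms(1-3)]
      jet_system_comb[OF assms(4,5), of 1 "-1"] by auto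
  then have "1 * Um \<beta> + (-1) * Vm \<beta> = 0"
    using assms(6) unfolding vanishes_below_def by blast
  then show ?thesis by simp
qed

section \<open>Transmission coefficients\<close>

text \<open>The entries of the data that occur in the equations of orders below \<open>n\<close>.\<close>

definition data_indices :: "nat \<Rightarrow> slot \<Rightarrow> (nat \<times> nat) set" where
  "data_indices n s = (case s of
     Uplus \<Rightarrow> {\<alpha>. fst \<alpha> \<le> 1 \<and> deg \<alpha> < n}
   | Fplus \<Rightarrow> {\<alpha>. deg \<alpha> + 2 < n}
   | Fminus \<Rightarrow> {\<alpha>. deg \<alpha> + 2 < n}
   | GDirichlet \<Rightarrow> {\<alpha>. deg \<alpha> < n}
   | GNeumann \<Rightarrow> {\<alpha>. deg \<alpha> + 1 < n})"

lemma finite_deg_less: "finite {\<alpha>. deg \<alpha> < (n::nat)}"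
  by (rule finite_subset[of _ "{..<n} \<times> {..<n}"]) auto

lemma finite_data_indices: "finite (data_indices n s)"
  by (rule finite_subset[OF _ finite_deg_less[of n]]) (auto simp: data_indices_def split: slot.splits)

lemma jet_system_cong:
  assumes "\<And>s \<alpha>. \<alpha> \<in> data_indices n s \<Longrightarrow> D s \<alpha> = E s \<alpha>" "jet_system n R S Ap Am \<sigma> D Up Um"
  shows "jet_system n R S Ap Am \<sigma> E Up Um"
proof -
  have "curve_jets R S (D GDirichlet) k (0, 0) = curve_jets R S (E GDirichlet) k (0, 0)" if "k < n" for k
    using that by (intro curve_jets_cong assms(1)) (auto simp: data_indices_def)
  moreover have "leib (speed_jets R S) (\<lambda>l. curve_jets R S (D GNeumann) l (0, 0)) k =
    leib (speed_jets R S) (\<lambda>l. curve_jets R S (E GNeumann) l (0, 0)) k" if "Suc k < n" for k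
  proof -
    have "curve_jets R S (D GNeumann) (k - l) (0, 0) = curve_jets R S (E GNeumann) (k - l) (0, 0)" for l
      using that by (intro curve_jets_cong assms(1)) (auto simp: data_indices_def)
    then show ?thesis by (simp add: leib_def)
  qed
  moreover have "D Uplus \<alpha> = E Uplus \<alpha>" if "fst \<alpha> \<le> 1" "deg \<alpha> < n" for \<alpha>
    using that by (intro assms(1)) (auto simp: data_indices_def)
  moreover have "D Fplus \<alpha> = E Fplus \<alpha>" "D Fminus \<alpha> = E Fminus \<alpha>" if "deg \<alpha> + 2 < n" for \<alpha>
    using that by (auto intro!: assms(1) simp: data_indices_def)
  ultimately show ?thesis
    using assms(2) by (simp add: jet_system_def)
qed

text \<open>This expresses that the coefficients depend on finitely many derivatives of \<open>r\<close>, \<open>s\<close> and \<open>a\<close>. With it the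
truncated jets of the theorem, whose entries beyond the given order are undefined, can be
replaced by the full ones.\<close>

lemma jet_system_cong_coefficients:
  assumes "\<And>j. j < n \<Longrightarrow> R j = R' j" "\<And>j. j < n \<Longrightarrow> S j = S' j"
    "\<And>\<beta>. deg \<beta> + 1 < n \<Longrightarrow> Ap \<beta> = Ap' \<beta>" "\<And>\<beta>. deg \<beta> + 1 < n \<Longrightarrow> Am \<beta> = Am' \<beta>"
  shows "jet_system n R S Ap Am = jet_system n R' S' Ap' Am'"
proof -
  have "curve_jets R S U k (0, 0) = curve_jets R' S' U k (0, 0)" if "k < n" for U k
    using that assms by (intro curve_jets_cong_curve) auto
  moreover have "leib (speed_jets R S) (\<lambda>l. curve_jets R S U l (0, 0)) k =
      leib (speed_jets R' S') (\<lambda>l. curve_jets R' S' U l (0, 0)) k" if "Suc k < n" for U k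
    unfolding leib_def using that assms
    by (intro sum.cong refl arg_cong2[of _ _ _ _ "(*)"] curve_jets_cong_curve speed_jets_cong) auto
  moreover have "flux_jet R S Ap U k = flux_jet R' S' Ap' U k" "flux_jet R S Am U k = flux_jet R' S' Am' U k"
    if "Suc k < n" for U k
    using that assms by (auto intro!: flux_jet_cong)
  moreover have "pde_jet Ap U \<alpha> = pde_jet Ap' U \<alpha>" "pde_jet Am U \<alpha> = pde_jet Am' U \<alpha>"
    if "deg \<alpha> + 2 < n" for U \<alpha>
    using that assms by (auto intro!: pde_jet_cong)
  ultimately show ?thesis
    unfolding jet_system_def by (intro ext) (simp cong: conj_cong)
qed

definition jet_unit :: "slot \<Rightarrow> nat \<times> nat \<Rightarrow> slot \<Rightarrow> jet" where
  "jet_unit s \<alpha> = (\<lambda>s' \<alpha>'. if s' = s \<and> \<alpha>' = \<alpha> then 1 else 0)"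

text \<open>The response of the negative side to a unit datum. By
\<open>jet_system_unique\<close> the choice matters only for entries of order \<open>n\<close> or more.\<close>

definition transmission :: "nat \<Rightarrow> (nat \<Rightarrow> real) \<Rightarrow> (nat \<Rightarrow> real) \<Rightarrow> jet \<Rightarrow> jet \<Rightarrow> real \<Rightarrow> slot \<Rightarrow> coeffs" where
  "transmission n R S Ap Am \<sigma> s \<beta> \<alpha> =
     (SOME Um. \<exists>Up. jet_system n R S Ap Am \<sigma> (jet_unit s \<alpha>) Up Um) \<beta>"

lemma transmission_cong:
  assumes "\<And>j. j < n \<Longrightarrow> R j = R' j" "\<And>j. j < n \<Longrightarrow> S j = S' j"
    "\<And>\<beta>. deg \<beta> + 1 < n \<Longrightarrow> Ap \<beta> = Ap' \<beta>" "\<And>\<beta>. deg \<beta> + 1 < n \<Longrightarrow> Am \<beta> = Am' \<beta>"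
  shows "transmission n R S Ap Am = transmission n R' S' Ap' Am'"
proof -
  have "jet_system n R S Ap Am = jet_system n R' S' Ap' Am'"
    using assms by (rule jet_system_cong_coefficients)
  then show ?thesis by (intro ext) (simp add: transmission_def)
qed

locale nondegenerate_jets =
  fixes R S :: "nat \<Rightarrow> real" and Ap Am :: jet
  assumes coeff_nonzero: "Ap (0, 0) \<noteq> 0" "Am (0, 0) \<noteq> 0"
    and regular_curve: "(R 1)\<^sup>2 + (S 1)\<^sup>2 > 0"
begin

lemmas solvable = jet_system_exists[where Ap = Ap and Am = Am and R = R and S = S, OF coeff_nonzero regular_curve]
lemmas unique = jet_system_unique[where Ap = Ap and Am = Am and R = R and S = S, OF coeff_nonzero regular_curve]
lemmas homogeneous = jet_system_homogeneous[where Ap = Ap and Am = Am and R = R and S = S, OF coeff_nonzero regular_curve]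

lemma transmission_system:
  "\<exists>Up. jet_system n R S Ap Am \<sigma> (jet_unit s \<alpha>) Up (\<lambda>\<beta>. transmission n R S Ap Am \<sigma> s \<beta> \<alpha>)"
proof -
  have "\<exists>Um Up. jet_system n R S Ap Am \<sigma> (jet_unit s \<alpha>) Up Um"
    using solvable by blast
  from someI_ex[OF this] show ?thesis by (simp add: transmission_def)
qed

lemma transmission_unit:
  "jet_system n R S Ap Am \<sigma> (jet_unit s \<alpha>) Up Um \<Longrightarrow> deg \<beta> < n \<Longrightarrow>
   transmission n R S Ap Am \<sigma> s \<beta> \<alpha> = Um \<beta>"
  using transmission_system[of n \<sigma> s \<alpha>] unique by blast

text \<open>Induction on the set of data that are switched on: the solution for \<open>insert x P\<close> must agree with the one for \<open>P\<close> plus a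
multiple of the unit response to \<open>x\<close>.\<close>

lemma superposition_finite:
  assumes "finite P" "jet_system n R S Ap Am \<sigma> (\<lambda>s \<alpha>. if (s, \<alpha>) \<in> P then D s \<alpha> else 0) Up Um" "deg \<beta> < n"
  shows "Um \<beta> = (\<Sum>x\<in>P. transmission n R S Ap Am \<sigma> (fst x) \<beta> (snd x) * D (fst x) (snd x))"
  using assms(1,2)
proof (induction P arbitrary: Up Um)
  case empty
  then have "vanishes_below n Um" using homogeneous by simp
  then have "Um \<beta> = 0" using assms(3) unfolding vanishes_below_def by blast
  then show ?case by simp
next
  case (insert x P)
  obtain s \<alpha> where x: "x = (s, \<alpha>)" by (cases x) blast
  obtain Vp Vm where V: "jet_system n R S Ap Am \<sigma> (\<lambda>s \<alpha>. if (s, \<alpha>) \<in> P then D s \<alpha> else 0) Vp Vm"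
    using solvable by blast
  obtain Wp where W: "jet_system n R S Ap Am \<sigma> (jet_unit s \<alpha>) Wp (\<lambda>\<beta>. transmission n R S Ap Am \<sigma> s \<beta> \<alpha>)"
    using transmission_system by blast
  have eq: "(\<lambda>s' \<alpha>'. 1 * (if (s', \<alpha>') \<in> P then D s' \<alpha>' else 0) + D s \<alpha> * jet_unit s \<alpha> s' \<alpha>') =
    (\<lambda>s' \<alpha>'. if (s', \<alpha>') \<in> insert x P then D s' \<alpha>' else 0)"
    using insert.hyps by (auto simp: fun_eq_iff jet_unit_def x)
  have "Um \<beta> = 1 * Vm \<beta> + D s \<alpha> * transmission n R S Ap Am \<sigma> s \<beta> \<alpha>"
    using unique[OF insert.prems jet_system_comb[OF V W, of 1 "D s \<alpha>", unfolded eq] assms(3)] .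
  then show ?case
    using insert.IH[OF V] insert.hyps by (simp add: x mult.commute)
qed

theorem superposition:
  assumes "jet_system n R S Ap Am \<sigma> D Up Um" "deg \<beta> < n"
  shows "Um \<beta> = (\<Sum>s\<in>UNIV. \<Sum>\<alpha>\<in>data_indices n s. transmission n R S Ap Am \<sigma> s \<beta> \<alpha> * D s \<alpha>)"
proof -
  let ?P = "SIGMA s:UNIV. data_indices n s"
  have fin: "finite ?P" by (auto intro!: finite_SigmaI finite_data_indices simp: UNIV_slot)
  have "jet_system n R S Ap Am \<sigma> (\<lambda>s \<alpha>. if (s, \<alpha>) \<in> ?P then D s \<alpha> else 0) Up Um"
    by (rule jet_system_cong[OF _ assms(1)]) auto
  from superposition_finite[OF fin this assms(2)] show ?thesis
    by (subst sum.Sigma) (auto simp: finite_data_indices UNIV_slot case_prod_unfold)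
qed

text \<open>The unit datum \<open>\<alpha>\<close> on the positive side does not occur in the equations of orders below \<open>deg \<alpha>\<close>, which are
therefore homogeneous.\<close>

lemma transmission_triangular:
  assumes "deg \<alpha> < n" "deg \<beta> < deg \<alpha>"
  shows "transmission n R S Ap Am \<sigma> Uplus \<beta> \<alpha> = 0"
proof -
  obtain Up where "jet_system n R S Ap Am \<sigma> (jet_unit Uplus \<alpha>) Up (\<lambda>\<beta>. transmission n R S Ap Am \<sigma> Uplus \<beta> \<alpha>)"
    using transmission_system by blast
  then have "jet_system (deg \<alpha>) R S Ap Am \<sigma> (jet_unit Uplus \<alpha>) Up (\<lambda>\<beta>. transmission n R S Ap Am \<sigma> Uplus \<beta> \<alpha>)"
    using assms(1) by (auto intro: jet_system_mono)
  then have "jet_system (deg \<alpha>) R S Ap Am \<sigma> (\<lambda>s \<alpha>. 0) Up (\<lambda>\<beta>. transmission n R S Ap Am \<sigma> Uplus \<beta> \<alpha>)"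
    by (rule jet_system_cong[rotated]) (auto simp: data_indices_def jet_unit_def)
  then show ?thesis using homogeneous assms(2) unfolding vanishes_below_def by blast
qed

end

lemma leib2_top_cong:
  assumes "vanishes_below n U" "A (0, 0) = B (0, 0)" "deg \<alpha> \<le> n"
  shows "leib2 A U \<alpha> = leib2 B U \<alpha>"
  using assms leib2_low[OF assms(1)] leib2_top[OF assms(1)]
  by (cases \<alpha>) (auto simp: le_less)

lemma pde_jet_top_cong:
  assumes "vanishes_below n U" "A (0, 0) = B (0, 0)" "deg \<alpha> + 2 \<le> n"
  shows "pde_jet A U \<alpha> = pde_jet B U \<alpha>"
  using assms pde_jet_low[OF assms(1)] pde_jet_top[OF assms(1)]
  by (cases \<alpha>) (auto simp: le_less)

lemma flux_jet_top_cong: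
  assumes "vanishes_below n U" "A (0, 0) = B (0, 0)" "Suc k \<le> n"
  shows "flux_jet R S A U k = flux_jet R S B U k"
proof -
  have "curve_jets R S (leib2 A (jet_dx U)) l (0, 0) = curve_jets R S (leib2 B (jet_dx U)) l (0, 0)"
    "curve_jets R S (leib2 A (jet_dy U)) l (0, 0) = curve_jets R S (leib2 B (jet_dy U)) l (0, 0)"
    if "l \<le> k" for l
    using that assms vanishes_below_dx[OF assms(1)] vanishes_below_dy[OF assms(1)]
    by (auto intro!: curve_jets_cong leib2_top_cong)
  then show ?thesis by (simp add: flux_jet_def)
qed

text \<open>The response to a unit datum of order \<open>m\<close> vanishes below order \<open>m\<close>, and in order \<open>m\<close> the equations only see the values
of the coefficients at the point. Hence the two responses solve the same system up to order \<open>m\<close>.\<close>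

lemma transmission_top:
  assumes "nondegenerate_jets R S Ap Am" "nondegenerate_jets R S Bp Bm"
    and "Ap (0, 0) = Bp (0, 0)" "Am (0, 0) = Bm (0, 0)" "deg \<alpha> = deg \<beta>" "deg \<beta> < n"
  shows "transmission n R S Ap Am \<sigma> Uplus \<beta> \<alpha> = transmission n R S Bp Bm \<sigma> Uplus \<beta> \<alpha>"
proof -
  define m where "m = deg \<alpha>"
  obtain Up where U0: "jet_system n R S Ap Am \<sigma> (jet_unit Uplus \<alpha>) Up (\<lambda>\<beta>. transmission n R S Ap Am \<sigma> Uplus \<beta> \<alpha>)"
    using nondegenerate_jets.transmission_system[OF assms(1)] by blast
  define Um where "Um = (\<lambda>\<beta>. transmission n R S Ap Am \<sigma> Uplus \<beta> \<alpha>)"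
  obtain Vp where V0: "jet_system n R S Bp Bm \<sigma> (jet_unit Uplus \<alpha>) Vp (\<lambda>\<beta>. transmission n R S Bp Bm \<sigma> Uplus \<beta> \<alpha>)"
    using nondegenerate_jets.transmission_system[OF assms(2)] by blast
  define Vm where "Vm = (\<lambda>\<beta>. transmission n R S Bp Bm \<sigma> Uplus \<beta> \<alpha>)"
  have U: "jet_system (Suc m) R S Ap Am \<sigma> (jet_unit Uplus \<alpha>) Up Um"
    and V: "jet_system (Suc m) R S Bp Bm \<sigma> (jet_unit Uplus \<alpha>) Vp Vm"
    using U0 V0 assms(5,6) by (auto simp: m_def Um_def Vm_def intro: jet_system_mono)
  \<comment> \<open>Up to order \<open>m\<close> the unit datum of order \<open>m\<close> is indistinguishable from zero data.\<close>
  have "jet_system m R S Bp Bm \<sigma> (\<lambda>s \<alpha>. 0) Vp Vm"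
    by (rule jet_system_cong[OF _ jet_system_mono[OF V]]) (auto simp: data_indices_def jet_unit_def m_def)
  from nondegenerate_jets.homogeneous[OF assms(2) this]
  have vp: "vanishes_below m Vp" and vm: "vanishes_below m Vm" by blast+
  have "jet_system (Suc m) R S Ap Am \<sigma> (jet_unit Uplus \<alpha>) Vp Vm"
    using V by (simp add: jet_system_def
      pde_jet_top_cong[where A = Ap and B = Bp, OF vp assms(3)] pde_jet_top_cong[where A = Am and B = Bm, OF vm assms(4)]
      flux_jet_top_cong[where A = Ap and B = Bp, OF vp assms(3)] flux_jet_top_cong[where A = Am and B = Bm, OF vm assms(4)])
  then have "Um \<beta> = Vm \<beta>"
    using nondegenerate_jets.unique[OF assms(1) U] assms(5) by (simp add: m_def)
  then show ?thesis by (simp add: Um_def Vm_def)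
qed

text \<open>The constant function \<open>1\<close> on both sides is the response to the unit datum of order \<open>0\<close>.\<close>

lemma transmission_const:
  assumes "nondegenerate_jets R S Ap Am" "deg \<beta> < n"
  shows "transmission n R S Ap Am \<sigma> Uplus \<beta> (0, 0) = (if \<beta> = (0, 0) then 1 else 0)"
proof -
  define U :: jet where "U = (\<lambda>\<beta>. if \<beta> = (0, 0) then 1 else 0)"
  have d: "jet_dx U = (\<lambda>\<alpha>. 0)" "jet_dy U = (\<lambda>\<alpha>. 0)"
    by (auto simp: U_def jet_dx_def jet_dy_def)
  have l: "leib2 A (\<lambda>\<alpha>. 0) = (\<lambda>\<alpha>. 0)" for A
    by (auto simp: leib2_def)
  have "jet_unit Uplus (0, 0) Uplus = U" "\<And>s. s \<noteq> Uplus \<Longrightarrow> jet_unit Uplus (0, 0) s = (\<lambda>\<alpha>. 0)"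
    by (auto simp: jet_unit_def U_def)
  then have "jet_system n R S Ap Am \<sigma> (jet_unit Uplus (0, 0)) U U"
    by (simp add: jet_system_def pde_jet_def flux_jet_def d l curve_jets_zero leib_def)
  from nondegenerate_jets.transmission_unit[OF assms(1) this assms(2)] show ?thesis
    by (simp add: U_def)
qed

text \<open>The sign of the normal enters the system only together with the Neumann datum.\<close>

lemma transmission_orientation:
  assumes "s \<noteq> GNeumann"
  shows "transmission n R S Ap Am \<sigma> s \<beta> \<alpha> = transmission n R S Ap Am \<tau> s \<beta> \<alpha>"
proof -
  have "jet_unit s \<alpha> GNeumann = (\<lambda>\<alpha>. 0)" using assms by (auto simp: jet_unit_def)
  then have "leib (speed_jets R S) (\<lambda>l. curve_jets R S (jet_unit s \<alpha> GNeumann) l (0, 0)) k = 0" for k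
    by (simp add: curve_jets_zero leib_def)
  then have "jet_system n R S Ap Am \<sigma> (jet_unit s \<alpha>) = jet_system n R S Ap Am \<tau> (jet_unit s \<alpha>)"
    by (intro ext) (simp only: jet_system_def mult_zero_right)
  then show ?thesis by (simp add: transmission_def)
qed

section \<open>Derivatives of functions of one variable\<close>

text \<open>\<open>F j\<close> is the \<open>j\<close>-th derivative of \<open>F 0\<close>. Carrying the whole sequence along makes Leibniz and chain rules explicit and
avoids reasoning about iterates of \<^const>\<open>deriv\<close>.\<close>

definition jets1 :: "nat \<Rightarrow> real set \<Rightarrow> (nat \<Rightarrow> real \<Rightarrow> real) \<Rightarrow> bool" where
  "jets1 k I F \<longleftrightarrow>
     (\<forall>j<k. \<forall>t\<in>I. (F j has_real_derivative F (Suc j) t) (at t)) \<and> continuous_on I (F k)"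

lemma jets1_0: "jets1 0 I F \<longleftrightarrow> continuous_on I (F 0)"
  by (simp add: jets1_def)

lemma jets1_Suc:
  "jets1 (Suc k) I F \<longleftrightarrow>
     (\<forall>t\<in>I. (F 0 has_real_derivative F (Suc 0) t) (at t)) \<and> jets1 k I (\<lambda>j. F (Suc j))"
  by (auto simp: jets1_def All_less_Suc2)

lemma jets1D: "jets1 k I F \<Longrightarrow> j < k \<Longrightarrow> t \<in> I \<Longrightarrow> (F j has_real_derivative F (Suc j) t) (at t)"
  by (simp add: jets1_def)

lemma jets1_continuous:
  assumes "jets1 k I F" "j \<le> k"
  shows "continuous_on I (F j)"
proof (cases "j = k")
  case False
  then have "(F j has_real_derivative F (Suc j) t) (at t within I)" if "t \<in> I" for t
    using jets1D[OF assms(1) _ that, of j] assms(2) has_field_derivative_at_within by auto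
  then show ?thesis by (rule DERIV_continuous_on)
qed (use assms in \<open>simp add: jets1_def\<close>)

lemma jets1_mono: "jets1 k I F \<Longrightarrow> j \<le> k \<Longrightarrow> jets1 j I F"
  using jets1_continuous[of k I F j] by (auto simp: jets1_def)

lemma jets1_subset: "jets1 k I F \<Longrightarrow> J \<subseteq> I \<Longrightarrow> jets1 k J F"
  by (auto simp: jets1_def intro: continuous_on_subset)

lemma jets1_unique:
  assumes "open I" "jets1 k I F" "jets1 k I G" "\<And>t. t \<in> I \<Longrightarrow> F 0 t = G 0 t" "j \<le> k" "t \<in> I"
  shows "F j t = G j t"
  using assms(5,6)
proof (induction j arbitrary: t)
  case 0 then show ?case using assms(4) by simp
next
  case (Suc j)
  have "(F j has_real_derivative F (Suc j) t) (at t)" "(G j has_real_derivative G (Suc j) t) (at t)"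
    using Suc.prems assms(2,3) by (auto intro: jets1D)
  moreover from this(2) have "(F j has_real_derivative G (Suc j) t) (at t)"
    by (rule has_field_derivative_transform_within_open[OF _ assms(1) Suc.prems(2)]) (use Suc in auto)
  ultimately show ?case using DERIV_unique by blast
qed

lemma jets1_deriv:
  assumes "open I" "Ck_real_on k I g"
  shows "jets1 k I (\<lambda>j. (deriv ^^ j) g)"
proof -
  have "((deriv ^^ j) g has_real_derivative (deriv ^^ Suc j) g t) (at t)" if "j < k" "t \<in> I" for j t
  proof -
    have "(deriv ^^ j) g differentiable_on I"
      using assms(2) that(1) unfolding Ck_real_on_def by blast
    then have "(deriv ^^ j) g differentiable (at t)"
      using that(2) assms(1) unfolding differentiable_on_def by (metis at_within_open)
    then show ?thesis by (simp only: DERIV_deriv_iff_real_differentiable funpow.simps o_apply)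
  qed
  then show ?thesis using assms(2) by (simp add: jets1_def Ck_real_on_def)
qed

lemma leib_Suc: "leib F G (Suc k) = leib (\<lambda>l. F (Suc l)) G k + leib F (\<lambda>l. G (Suc l)) k"
  unfolding leib_def using sum_choose_Suc[of k "\<lambda>l m. F l * G m"]
  by (simp add: sum.distrib algebra_simps)

lemma jets1_leib:
  assumes "jets1 k I F" "jets1 k I G"
  shows "jets1 k I (\<lambda>j t. leib (\<lambda>l. F l t) (\<lambda>l. G l t) j)"
  unfolding jets1_def
proof (intro conjI allI impI ballI)
  fix j t assume j: "j < k" "t \<in> I"
  have "((\<lambda>t. \<Sum>l\<le>j. real (j choose l) * (F l t * G (j - l) t)) has_real_derivative
     (\<Sum>l\<le>j. real (j choose l) * (F (Suc l) t * G (j - l) t + G (Suc (j - l)) t * F l t))) (at t)"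
    using j by (intro DERIV_sum DERIV_cmult DERIV_mult jets1D[OF assms(1)] jets1D[OF assms(2)]) auto
  then show "((\<lambda>t. leib (\<lambda>l. F l t) (\<lambda>l. G l t) j) has_real_derivative
      leib (\<lambda>l. F l t) (\<lambda>l. G l t) (Suc j)) (at t)"
    unfolding leib_Suc by (simp add: leib_def sum.distrib algebra_simps)
next
  show "continuous_on I (\<lambda>t. leib (\<lambda>l. F l t) (\<lambda>l. G l t) k)"
    unfolding leib_def
    by (intro continuous_intros jets1_continuous[OF assms(1)] jets1_continuous[OF assms(2)]) auto
qed

lemma jets1_comb:
  assumes "jets1 k I F" "jets1 k I G"
  shows "jets1 k I (\<lambda>j t. a * F j t + b * G j t)"
  using assms by (auto simp: jets1_def intro!: continuous_intros derivative_eq_intros)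

lemma jets1_cons:
  assumes "\<And>t. t \<in> I \<Longrightarrow> (f has_real_derivative G 0 t) (at t)" "jets1 k I G"
  shows "jets1 (Suc k) I (\<lambda>j. case j of 0 \<Rightarrow> f | Suc i \<Rightarrow> G i)"
  using assms by (simp add: jets1_Suc)

text \<open>Existence of the higher derivatives by induction on their number: the derivative of \<open>F 0 powr a\<close> is a product of
\<open>F 1\<close> and \<open>F 0 powr (a - 1)\<close>. The cases needed are square roots and reciprocals.\<close>

lemma jets1_powr:
  assumes "jets1 k I F" "\<And>t. t \<in> I \<Longrightarrow> F 0 t > 0"
  shows "\<exists>G. jets1 k I G \<and> (\<forall>t\<in>I. G 0 t = F 0 t powr a)"
  using assms(1)
proof (induction k arbitrary: a)
  case 0
  then show ?case using assms(2)
    by (intro exI[of _ "\<lambda>j t. F 0 t powr a"])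
       (auto simp: jets1_0 intro!: continuous_intros dest: less_imp_neq[OF assms(2)])
next
  case (Suc k)
  obtain G where G: "jets1 k I G" "\<forall>t\<in>I. G 0 t = F 0 t powr (a - 1)"
    using Suc.IH[of "a - 1"] jets1_mono[OF Suc.prems] by auto
  define H where "H = (\<lambda>j t. a * leib (\<lambda>l. F (Suc l) t) (\<lambda>l. G l t) j + 0 * G j t)"
  have H: "jets1 k I H"
    unfolding H_def using Suc.prems G(1) by (intro jets1_comb jets1_leib) (auto simp: jets1_Suc)
  have "((\<lambda>t. F 0 t powr a) has_real_derivative H 0 t) (at t)" if "t \<in> I" for t
  proof -
    have "(F 0 has_real_derivative F (Suc 0) t) (at t)" using Suc.prems that by (simp add: jets1_Suc)
    from DERIV_fun_powr[OF this assms(2)[OF that], of a] show ?thesis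
      using G(2) that by (simp add: H_def leib_def mult_ac)
  qed
  from jets1_cons[OF this H] show ?case by (intro exI[of _ "\<lambda>j. case j of 0 \<Rightarrow> (\<lambda>t. F 0 t powr a) | Suc i \<Rightarrow> H i"]) auto
qed

text \<open>The composition \<open>f \<circ> T\<close> with the inverse \<open>T\<close> of \<open>X\<close> has the derivative \<open>(f' / X') \<circ> T\<close>, which is of the same
form with one order less. So the induction never has to differentiate \<open>T\<close> more than once, and it also shows that a
point at which \<open>f\<close> is flat remains flat.\<close>

lemma jets1_reparametrize:
  assumes X: "jets1 k J XX" "\<And>t. t \<in> J \<Longrightarrow> XX (Suc 0) t > 0" "open (XX 0 ` J)"
    and T: "continuous_on (XX 0 ` J) T" "\<And>t. t \<in> J \<Longrightarrow> T (XX 0 t) = t"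
    and F: "jets1 k J F"
  shows "\<exists>G. jets1 k (XX 0 ` J) G \<and> (\<forall>t\<in>J. G 0 (XX 0 t) = F 0 t) \<and>
    (\<forall>t\<in>J. (\<forall>j\<le>k. F j t = 0) \<longrightarrow> (\<forall>j\<le>k. G j (XX 0 t) = 0))"
  using X(1) F
proof (induction k arbitrary: F)
  case 0
  then have "continuous_on (XX 0 ` J) (\<lambda>y. F 0 (T y))"
    using T by (intro continuous_on_compose2[of J "F 0" _ T]) (auto simp: jets1_0)
  then show ?case using T(2) by (intro exI[of _ "\<lambda>j y. F 0 (T y)"]) (auto simp: jets1_0)
next
  case (Suc k)
  obtain Q where Q: "jets1 k J Q" "\<forall>t\<in>J. Q 0 t = XX (Suc 0) t powr (-1)"
    using jets1_powr[of k J "\<lambda>j. XX (Suc j)" "-1"] Suc.prems X(2) by (auto simp: jets1_Suc)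
  define D where "D = (\<lambda>j t. leib (\<lambda>l. F (Suc l) t) (\<lambda>l. Q l t) j)"
  have D: "jets1 k J D"
    unfolding D_def using Suc.prems Q(1) by (intro jets1_leib) (auto simp: jets1_Suc)
  obtain G where G: "jets1 k (XX 0 ` J) G" "\<forall>t\<in>J. G 0 (XX 0 t) = D 0 t"
    "\<forall>t\<in>J. (\<forall>j\<le>k. D j t = 0) \<longrightarrow> (\<forall>j\<le>k. G j (XX 0 t) = 0)"
    using Suc.IH[OF jets1_mono[OF Suc.prems(1)] D] by auto
  have "((\<lambda>y. F 0 (T y)) has_real_derivative G 0 y) (at y)" if y: "y \<in> XX 0 ` J" for y
  proof -
    obtain t where t: "t \<in> J" "y = XX 0 t" using y by auto
    obtain e where e: "e > 0" "ball y e \<subseteq> XX 0 ` J" using X(3) y openE by blast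
    have "(T has_real_derivative inverse (XX (Suc 0) t)) (at y)"
    proof (rule DERIV_inverse_function[where f = "XX 0" and g = T and a = "y - e" and b = "y + e"])
      show "(XX 0 has_real_derivative XX (Suc 0) t) (at (T y))"
        using Suc.prems(1) t T(2) by (simp add: jets1_Suc)
      show "XX (Suc 0) t \<noteq> 0" using X(2)[OF t(1)] by simp
      show "isCont T y" using T(1) X(3) y continuous_on_eq_continuous_at by blast
      fix z assume "y - e < z" "z < y + e"
      then have "z \<in> ball y e" by (simp add: dist_real_def)
      then show "XX 0 (T z) = z" using e(2) T(2) by force
    qed (use e in auto)
    moreover have "(F 0 has_real_derivative F (Suc 0) t) (at (T y))"
      using Suc.prems(2) t T(2) by (simp add: jets1_Suc)
    ultimately have "((\<lambda>y. F 0 (T y)) has_real_derivative F (Suc 0) t * inverse (XX (Suc 0) t)) (at y)"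
      using DERIV_chain2 by blast
    moreover have "G 0 y = F (Suc 0) t * inverse (XX (Suc 0) t)"
      using G(2) Q(2) t X(2)[OF t(1)] by (simp add: D_def leib_def powr_minus)
    ultimately show ?thesis by simp
  qed
  note J = jets1_cons[OF this G(1)]
  have "(\<lambda>j. case j of 0 \<Rightarrow> (\<lambda>y. F 0 (T y)) | Suc i \<Rightarrow> G i) j (XX 0 t) = 0"
    if "t \<in> J" "\<forall>j\<le>Suc k. F j t = 0" "j \<le> Suc k" for j t
  proof (cases j)
    case 0
    then show ?thesis using that T(2) by simp
  next
    case (Suc i)
    have "D l t = 0" if "l \<le> k" for l
      using \<open>\<forall>j\<le>Suc k. F j t = 0\<close> that by (simp add: D_def leib_def)
    then show ?thesis using G(3) that Suc by simp
  qed
  with J T(2) show ?case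
    by (intro exI[of _ "\<lambda>j. case j of 0 \<Rightarrow> (\<lambda>y. F 0 (T y)) | Suc i \<Rightarrow> G i"] conjI ballI impI allI) auto
qed

section \<open>Partial derivatives\<close>

text \<open>The counterpart of \<^const>\<open>jets1\<close> in the plane. Indexing the derivatives by pairs builds in the symmetry of mixed partial
derivatives.\<close>

definition jets2 :: "nat \<Rightarrow> plane set \<Rightarrow> (nat \<times> nat \<Rightarrow> plane \<Rightarrow> real) \<Rightarrow> bool" where
  "jets2 k S v \<longleftrightarrow>
     (\<forall>i j q. i + j < k \<longrightarrow> q \<in> S \<longrightarrow>
        (v (i, j) has_derivative (\<lambda>h. fst h * v (Suc i, j) q + snd h * v (i, Suc j) q)) (at q)) \<and>
     (\<forall>i j. i + j = k \<longrightarrow> continuous_on S (v (i, j)))"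

lemma jets2D:
  "jets2 k S v \<Longrightarrow> i + j < k \<Longrightarrow> q \<in> S \<Longrightarrow>
   (v (i, j) has_derivative (\<lambda>h. fst h * v (Suc i, j) q + snd h * v (i, Suc j) q)) (at q)"
  unfolding jets2_def by blast

lemma jets2_continuous:
  assumes "jets2 k S v" "deg \<alpha> \<le> k"
  shows "continuous_on S (v \<alpha>)"
proof -
  obtain i j where \<alpha>: "\<alpha> = (i, j)" by force
  show ?thesis
  proof (cases "i + j = k")
    case False
    then have "i + j < k" using assms(2) \<alpha> by simp
    then have "(v \<alpha> has_derivative (\<lambda>h. fst h * v (Suc i, j) q + snd h * v (i, Suc j) q)) (at q within S)"
      if "q \<in> S" for q
      using jets2D[OF assms(1) _ that] \<alpha> by (simp add: has_derivative_at_withinI)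
    then show ?thesis by (rule has_derivative_continuous_on)
  qed (use assms \<alpha> in \<open>auto simp: jets2_def\<close>)
qed

lemma jets2_subset: "jets2 k S v \<Longrightarrow> S' \<subseteq> S \<Longrightarrow> jets2 k S' v"
  unfolding jets2_def by (blast intro: continuous_on_subset)

lemma jets2_dx: "jets2 (Suc k) S v \<Longrightarrow> jets2 k S (\<lambda>\<alpha> q. jet_dx (\<lambda>\<beta>. v \<beta> q) \<alpha>)"
  and jets2_dy: "jets2 (Suc k) S v \<Longrightarrow> jets2 k S (\<lambda>\<alpha> q. jet_dy (\<lambda>\<beta>. v \<beta> q) \<alpha>)"
  by (auto simp: jets2_def jet_dx_apply jet_dy_apply)

lemma jets2_comb:
  assumes "jets2 k S v" "jets2 k S w"
  shows "jets2 k S (\<lambda>\<alpha> q. a * v \<alpha> q + b * w \<alpha> q)"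
  unfolding jets2_def
proof (intro conjI allI impI)
  fix i j q assume *: "i + j < k" "q \<in> S"
  have "((\<lambda>q. a * v (i, j) q + b * w (i, j) q) has_derivative
      (\<lambda>h. a * (fst h * v (Suc i, j) q + snd h * v (i, Suc j) q) +
           b * (fst h * w (Suc i, j) q + snd h * w (i, Suc j) q))) (at q)"
    by (intro has_derivative_add has_derivative_mult_right jets2D[OF assms(1) *] jets2D[OF assms(2) *])
  then show "((\<lambda>q. a * v (i, j) q + b * w (i, j) q) has_derivative
      (\<lambda>h. fst h * (a * v (Suc i, j) q + b * w (Suc i, j) q) +
           snd h * (a * v (i, Suc j) q + b * w (i, Suc j) q))) (at q)"
    by (simp add: algebra_simps)
next
  fix i j assume "i + j = k"
  then show "continuous_on S (\<lambda>q. a * v (i, j) q + b * w (i, j) q)"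
    using assms by (auto simp: jets2_def intro!: continuous_intros)
qed

lemma leib2_Suc_fst: "leib2 A U (Suc i, j) = leib2 (jet_dx A) U (i, j) + leib2 A (jet_dx U) (i, j)"
  unfolding leib2_def prod.case
  using sum_choose_Suc[of i "\<lambda>k m. \<Sum>l\<le>j. real (j choose l) * (A (k, l) * U (m, j - l))"]
  by (simp add: jet_dx_apply sum.distrib distrib_left del: sum.atMost_Suc)

lemma leib2_Suc_snd: "leib2 A U (i, Suc j) = leib2 (jet_dy A) U (i, j) + leib2 A (jet_dy U) (i, j)"
proof -
  have "(\<Sum>l\<le>Suc j. real (Suc j choose l) * (A (k, l) * U (i - k, Suc j - l))) =
      (\<Sum>l\<le>j. real (j choose l) * (A (k, Suc l) * U (i - k, j - l))) +
      (\<Sum>l\<le>j. real (j choose l) * (A (k, l) * U (i - k, Suc (j - l))))" for k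
    using sum_choose_Suc[of j "\<lambda>l m. A (k, l) * U (i - k, m)"]
    by (simp add: sum.distrib distrib_left del: sum.atMost_Suc)
  then show ?thesis
    by (simp add: leib2_def jet_dy_apply sum.distrib distrib_left del: sum.atMost_Suc)
qed

lemma jets2_leib2:
  assumes "jets2 k S v" "jets2 k S w"
  shows "jets2 k S (\<lambda>\<alpha> q. leib2 (\<lambda>\<beta>. v \<beta> q) (\<lambda>\<beta>. w \<beta> q) \<alpha>)"
  unfolding jets2_def
proof (intro conjI allI impI)
  fix i j q assume *: "i + j < k" "q \<in> S"
  have "((\<lambda>q. \<Sum>m\<le>i. real (i choose m) * (\<Sum>l\<le>j. real (j choose l) * (v (m, l) q * w (i - m, j - l) q)))
    has_derivative (\<lambda>h. \<Sum>m\<le>i. real (i choose m) * (\<Sum>l\<le>j. real (j choose l) *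
      (v (m, l) q * (fst h * w (Suc (i - m), j - l) q + snd h * w (i - m, Suc (j - l)) q) +
       (fst h * v (Suc m, l) q + snd h * v (m, Suc l) q) * w (i - m, j - l) q)))) (at q)"
    using * by (intro has_derivative_sum has_derivative_mult_right has_derivative_mult
        jets2D[OF assms(1)] jets2D[OF assms(2)]) auto
  then show "((\<lambda>q. leib2 (\<lambda>\<beta>. v \<beta> q) (\<lambda>\<beta>. w \<beta> q) (i, j)) has_derivative
     (\<lambda>h. fst h * leib2 (\<lambda>\<beta>. v \<beta> q) (\<lambda>\<beta>. w \<beta> q) (Suc i, j) +
          snd h * leib2 (\<lambda>\<beta>. v \<beta> q) (\<lambda>\<beta>. w \<beta> q) (i, Suc j))) (at q)"
    unfolding leib2_Suc_fst leib2_Suc_snd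
    by (simp add: leib2_def jet_dx_apply jet_dy_apply sum_distrib_left sum.distrib[symmetric] algebra_simps)
next
  fix i j assume *: "i + j = k"
  show "continuous_on S (\<lambda>q. leib2 (\<lambda>\<beta>. v \<beta> q) (\<lambda>\<beta>. w \<beta> q) (i, j))"
    unfolding leib2_def prod.case
    using * by (intro continuous_intros jets2_continuous[OF assms(1)] jets2_continuous[OF assms(2)]) auto
qed

lemma partial_derivatives:
  assumes "(g has_derivative (\<lambda>h. fst h * a + snd h * b)) (at (x, y))"
  shows "((\<lambda>t. g (t, y)) has_real_derivative a) (at x)" "((\<lambda>t. g (x, t)) has_real_derivative b) (at y)"
proof -
  have "((\<lambda>t. (t, y)) has_derivative (\<lambda>h. (h, 0))) (at x)" "((\<lambda>t. (x, t)) has_derivative (\<lambda>h. (0, h))) (at y)"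
    by (auto intro!: derivative_eq_intros)
  from has_derivative_compose[OF this(1) assms] has_derivative_compose[OF this(2) assms]
  show "((\<lambda>t. g (t, y)) has_real_derivative a) (at x)" "((\<lambda>t. g (x, t)) has_real_derivative b) (at y)"
    by (simp_all add: has_field_derivative_def mult_commute_abs)
qed

lemma px_py_eqI:
  assumes "(g has_derivative (\<lambda>h. fst h * a + snd h * b)) (at q)"
  shows "px g q = a" "py g q = b"
  using partial_derivatives[of g a b "fst q" "snd q"] assms
  by (auto simp: px_def py_def case_prod_unfold intro!: DERIV_imp_deriv)

lemma eventually_sections:
  assumes "open S" "(x, y) \<in> S"
  shows "\<forall>\<^sub>F t in nhds x. (t, y) \<in> S" "\<forall>\<^sub>F t in nhds y. (x, t) \<in> S"
proof -
  have "open ((\<lambda>t. (t, y)) -` S)" "open ((\<lambda>t. (x, t)) -` S)"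
    using assms(1) by (auto intro!: open_vimage continuous_intros)
  then show "\<forall>\<^sub>F t in nhds x. (t, y) \<in> S" "\<forall>\<^sub>F t in nhds y. (x, t) \<in> S"
    using assms(2) by (auto simp: eventually_nhds intro!: exI[of _ "(\<lambda>t. (t, y)) -` S"] exI[of _ "(\<lambda>t. (x, t)) -` S"])
qed

lemma px_py_cong:
  assumes "open S" "q \<in> S" "\<And>z. z \<in> S \<Longrightarrow> f z = g z"
  shows "px f q = px g q" "py f q = py g q"
proof -
  obtain x y where q: "q = (x, y)" by force
  show "px f q = px g q" "py f q = py g q"
    using eventually_sections[of S x y] assms q
    by (auto simp: px_def py_def intro!: deriv_cong_ev elim!: eventually_mono)
qed

lemma has_derivative_px_py:
  assumes "open S" "g differentiable_on S" "q \<in> S"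
  shows "(g has_derivative (\<lambda>h. fst h * px g q + snd h * py g q)) (at q)"
proof -
  obtain g' where g': "(g has_derivative g') (at q)"
    using assms unfolding differentiable_on_def differentiable_def by (metis at_within_open)
  have lin: "linear g'" using g' has_derivative_linear by blast
  have "g' h = fst h * g' (1, 0) + snd h * g' (0, 1)" for h :: plane
  proof -
    have "h = fst h *\<^sub>R (1, 0) + snd h *\<^sub>R (0, 1)" by (simp add: prod_eq_iff)
    then have "g' h = g' (fst h *\<^sub>R (1, 0) + snd h *\<^sub>R (0, 1))" by (rule arg_cong)
    also have "\<dots> = fst h * g' (1, 0) + snd h * g' (0, 1)"
      by (simp only: linear_add[OF lin] linear_scale[OF lin] real_scaleR_def)
    finally show ?thesis .
  qed
  then have "g' = (\<lambda>h. fst h * g' (1, 0) + snd h * g' (0, 1))" by blast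
  with g' have *: "(g has_derivative (\<lambda>h. fst h * g' (1, 0) + snd h * g' (0, 1))) (at q)" by simp
  then show ?thesis using px_py_eqI[OF *] by simp
qed

lemma differentiable_eqI: "f differentiable_on S \<Longrightarrow> (\<And>z. z \<in> S \<Longrightarrow> f z = g z) \<Longrightarrow> g differentiable_on S"
  unfolding differentiable_on_def differentiable_def by (metis has_derivative_transform)

lemma Ck_on_cong:
  assumes "open S" "\<And>z. z \<in> S \<Longrightarrow> f z = g z" "Ck_on k S f"
  shows "Ck_on k S g"
  using assms(2,3)
proof (induction k arbitrary: f g)
  case 0
  then show ?case by (auto cong: continuous_on_cong)
next
  case (Suc k)
  have "Ck_on k S (px g)" "Ck_on k S (py g)"
    using Suc.IH[of "px f" "px g"] Suc.IH[of "py f" "py g"] Suc.prems px_py_cong[OF assms(1) _ Suc.prems(1)]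
    by auto
  moreover have "g differentiable_on S"
    using Suc.prems(2) differentiable_eqI[of f S g] Suc.prems(1) by simp
  ultimately show ?case by simp
qed

lemma Ck_on_Suc_imp: "Ck_on (Suc k) S g \<Longrightarrow> Ck_on k S g"
proof (induction k arbitrary: g)
  case 0
  then show ?case by (simp add: differentiable_imp_continuous_on)
next
  case (Suc k)
  have *: "g differentiable_on S" "Ck_on (Suc k) S (px g)" "Ck_on (Suc k) S (py g)"
    using Suc.prems unfolding Ck_on.simps(2)[of "Suc k"] by blast+
  show ?case unfolding Ck_on.simps(2)[of k] using * Suc.IH by blast
qed

lemma Ck_on_mono: "Ck_on k S g \<Longrightarrow> j \<le> k \<Longrightarrow> Ck_on j S g"
  by (induction k) (metis le_zero_eq, metis le_Suc_eq Ck_on_Suc_imp)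

text \<open>The mean value theorem, used once in each variable.\<close>

lemma mixed_difference:
  fixes g gx gxy :: "real \<Rightarrow> real \<Rightarrow> real"
  assumes "h > 0"
    and gx: "\<And>s t. x \<le> s \<Longrightarrow> s \<le> x + h \<Longrightarrow> y \<le> t \<Longrightarrow> t \<le> y + h \<Longrightarrow>
      ((\<lambda>s. g s t) has_real_derivative gx s t) (at s)"
    and gxy: "\<And>s t. x \<le> s \<Longrightarrow> s \<le> x + h \<Longrightarrow> y \<le> t \<Longrightarrow> t \<le> y + h \<Longrightarrow>
      (gx s has_real_derivative gxy s t) (at t)"
  shows "\<exists>s t. x < s \<and> s < x + h \<and> y < t \<and> t < y + h \<and>
    g (x + h) (y + h) - g (x + h) y - g x (y + h) + g x y = h * h * gxy s t"
proof -
  have "\<exists>s>x. s < x + h \<and> (\<lambda>s. g s (y + h) - g s y) (x + h) - (\<lambda>s. g s (y + h) - g s y) x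
      = (x + h - x) * (gx s (y + h) - gx s y)"
    using assms(1) by (intro MVT2) (auto intro!: gx DERIV_diff)
  then obtain s where s: "x < s" "s < x + h"
    "g (x + h) (y + h) - g (x + h) y - (g x (y + h) - g x y) = h * (gx s (y + h) - gx s y)"
    by auto
  have "\<exists>t>y. t < y + h \<and> gx s (y + h) - gx s y = (y + h - y) * gxy s t"
    using assms(1) s by (intro MVT2) (auto intro!: gxy)
  then obtain t where t: "y < t" "t < y + h" "gx s (y + h) - gx s y = h * gxy s t" by auto
  show ?thesis using s t by (intro exI[of _ s] exI[of _ t]) auto
qed

text \<open>Schwarz's theorem. On a small square both mixed derivatives take the value of the same second difference quotient, each
at some point of the square, so by continuity they cannot differ at \<open>q\<close>.\<close>

lemma mixed_partials_commute:
  assumes "open S" "Ck_on 2 S g" "q \<in> S"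
  shows "py (px g) q = px (py g) q"
proof (rule ccontr)
  assume neq: "py (px g) q \<noteq> px (py g) q"
  obtain x y where q: "q = (x, y)" by force
  define e where "e = \<bar>py (px g) q - px (py g) q\<bar> / 2"
  have e: "e > 0" using neq by (simp add: e_def)
  have C: "g differentiable_on S" "px g differentiable_on S" "py g differentiable_on S"
    "continuous_on S (py (px g))" "continuous_on S (px (py g))"
    using assms(2) by (auto simp: numeral_2_eq_2)
  obtain d1 where d1: "d1 > 0" "\<And>z. z \<in> S \<Longrightarrow> dist z q < d1 \<Longrightarrow> dist (py (px g) z) (py (px g) q) < e"
    using C(4) assms(3) e unfolding continuous_on_iff by metis
  obtain d2 where d2: "d2 > 0" "\<And>z. z \<in> S \<Longrightarrow> dist z q < d2 \<Longrightarrow> dist (px (py g) z) (px (py g) q) < e"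
    using C(5) assms(3) e unfolding continuous_on_iff by metis
  obtain d3 where d3: "d3 > 0" "ball q d3 \<subseteq> S" using assms(1,3) openE by blast
  define d where "d = min d1 (min d2 d3)"
  \<comment> \<open>The square of side \<open>h\<close> with corner \<open>q\<close> has to lie in the ball of radius \<open>d\<close>, and \<open>2 * h < d\<close> ensures this.\<close>
  define h where "h = d / 3"
  have h: "h > 0" using d1 d2 d3 by (simp add: h_def d_def)
  have near: "dist (s, t) q < d" if "x \<le> s" "s \<le> x + h" "y \<le> t" "t \<le> y + h" for s t
  proof -
    have "dist (s, t) q \<le> \<bar>s - x\<bar> + \<bar>t - y\<bar>"
      unfolding q dist_Pair_Pair dist_real_def by (rule sqrt_sum_squares_le_sum) auto
    also have "\<dots> \<le> h + h" using that by auto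
    also have "\<dots> < d" using h by (simp add: h_def)
    finally show ?thesis .
  qed
  have inS: "(s, t) \<in> S" if "x \<le> s" "s \<le> x + h" "y \<le> t" "t \<le> y + h" for s t
    using near[OF that] d3(2) by (auto simp: d_def dist_commute)
  note D = has_derivative_px_py[OF assms(1)]
  obtain s t where st: "x < s" "s < x + h" "y < t" "t < y + h"
    "g (x + h, y + h) - g (x + h, y) - g (x, y + h) + g (x, y) = h * h * py (px g) (s, t)"
    using mixed_difference[of h x y "\<lambda>s t. g (s, t)" "\<lambda>s t. px g (s, t)" "\<lambda>s t. py (px g) (s, t)",
      OF h partial_derivatives(1)[OF D[OF C(1) inS]] partial_derivatives(2)[OF D[OF C(2) inS]]] by blast
  obtain t' s' where st': "y < t'" "t' < y + h" "x < s'" "s' < x + h"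
    "g (x + h, y + h) - g (x, y + h) - g (x + h, y) + g (x, y) = h * h * px (py g) (s', t')"
    using mixed_difference[of h y x "\<lambda>t s. g (s, t)" "\<lambda>t s. py g (s, t)" "\<lambda>t s. px (py g) (s, t)",
      OF h partial_derivatives(2)[OF D[OF C(1) inS]] partial_derivatives(1)[OF D[OF C(3) inS]]] by blast
  have eq: "py (px g) (s, t) = px (py g) (s', t')"
    using st(5) st'(5) h by (simp add: algebra_simps)
  have "dist (py (px g) (s, t)) (py (px g) q) < e" "dist (px (py g) (s', t')) (px (py g) q) < e"
    using d1(2)[OF inS] d2(2)[OF inS] near[of s t] near[of s' t'] st st' by (auto simp: d_def)
  then show False unfolding eq e_def dist_real_def by (simp add: abs_if split: if_splits)
qed

lemma Ck_on_px_iterate: "Ck_on (i + l) S g \<Longrightarrow> Ck_on l S ((px ^^ i) g)"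
  and Ck_on_py_iterate: "Ck_on (i + l) S g \<Longrightarrow> Ck_on l S ((py ^^ i) g)"
  by (induction i arbitrary: l g) (simp_all add: funpow_Suc_right del: funpow.simps(2))

lemma py_px_iterate:
  assumes "open S" "Ck_on (Suc i) S g" "q \<in> S"
  shows "py ((px ^^ i) g) q = (px ^^ i) (py g) q"
  using assms(2,3)
proof (induction i arbitrary: q)
  case (Suc i)
  have "Ck_on 2 S ((px ^^ i) g)" using Suc.prems(1) by (intro Ck_on_px_iterate) simp
  then have "py ((px ^^ Suc i) g) q = px (py ((px ^^ i) g)) q"
    using mixed_partials_commute[OF assms(1) _ Suc.prems(2)] by simp
  also have "\<dots> = px ((px ^^ i) (py g)) q"
    using Suc.IH Ck_on_Suc_imp[OF Suc.prems(1)] by (intro px_py_cong[OF assms(1) Suc.prems(2)])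
  finally show ?case by simp
qed simp

lemma jets2_pd:
  assumes "open S" "Ck_on k S g"
  shows "jets2 k S (\<lambda>\<alpha>. pd \<alpha> g)"
  unfolding jets2_def
proof (intro conjI allI impI)
  fix i j q assume ij: "i + j < k" and q: "q \<in> S"
  have gj: "Ck_on (Suc i) S ((py ^^ j) g)"
    using Ck_on_mono[OF assms(2), of "j + Suc i"] ij by (intro Ck_on_py_iterate) simp
  have "Ck_on (i + 1) S ((py ^^ j) g)" using gj by simp
  then have "pd (i, j) g differentiable_on S"
    using Ck_on_px_iterate[of i 1 S "(py ^^ j) g"] by (simp add: pd_def)
  from has_derivative_px_py[OF assms(1) this q]
  show "(pd (i, j) g has_derivative (\<lambda>h. fst h * pd (Suc i, j) g q + snd h * pd (i, Suc j) g q)) (at q)"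
    using py_px_iterate[OF assms(1) gj q] by (simp add: pd_def)
next
  fix i j assume ij: "i + j = k"
  have "Ck_on 0 S (pd (i, j) g)"
    unfolding pd_def prod.case using assms(2) ij by (intro Ck_on_px_iterate Ck_on_py_iterate) (simp add: add.commute)
  then show "continuous_on S (pd (i, j) g)" by simp
qed

lemma jets2_imp_pd:
  assumes "open S" "jets2 k S v" "\<And>q. q \<in> S \<Longrightarrow> g q = v (0, 0) q" "i + j \<le> k" "q \<in> S"
  shows "pd (i, j) g q = v (i, j) q"
proof -
  have y: "(py ^^ j) g q = v (0, j) q" if "j \<le> k" "q \<in> S" for j q
    using that
  proof (induction j arbitrary: q)
    case (Suc j)
    have "py ((py ^^ j) g) q = py (v (0, j)) q"
      using Suc by (intro px_py_cong[OF assms(1)]) auto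
    also have "\<dots> = v (0, Suc j) q"
      using px_py_eqI(2)[OF jets2D[OF assms(2), of 0 j q]] Suc.prems by simp
    finally show ?case by simp
  qed (use assms(3) in auto)
  have "(px ^^ i) ((py ^^ j) g) q = v (i, j) q" if "i + j \<le> k" "q \<in> S" for i q
    using that
  proof (induction i arbitrary: q)
    case (Suc i)
    have "px ((px ^^ i) ((py ^^ j) g)) q = px (v (i, j)) q"
      using Suc by (intro px_py_cong[OF assms(1)]) auto
    also have "\<dots> = v (Suc i, j) q"
      using px_py_eqI(1)[OF jets2D[OF assms(2), of i j q]] Suc.prems by simp
    finally show ?case by simp
  qed (use y in auto)
  then show ?thesis using assms(4,5) by (simp add: pd_def)
qed

lemma jets2_imp_Ck_on:
  assumes "open S" "jets2 k S v" "\<And>q. q \<in> S \<Longrightarrow> g q = v (0, 0) q"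
  shows "Ck_on k S g"
  using assms(2,3)
proof (induction k arbitrary: g v)
  case 0
  then have "continuous_on S (v (0, 0))" by (simp add: jets2_def)
  then show ?case using 0 by (simp cong: continuous_on_cong)
next
  case (Suc k)
  have d: "(v (0, 0) has_derivative (\<lambda>h. fst h * v (Suc 0, 0) q + snd h * v (0, Suc 0) q)) (at q)"
    if "q \<in> S" for q using jets2D[OF Suc.prems(1), of 0 0] that by simp
  then have "v (0, 0) differentiable_on S"
    unfolding differentiable_on_def differentiable_def using has_derivative_at_withinI by blast
  then have "g differentiable_on S"
    using Suc.prems(2) differentiable_eqI by metis
  moreover have "px g q = v (Suc 0, 0) q" "py g q = v (0, Suc 0) q" if "q \<in> S" for q
    using px_py_eqI[OF d[OF that]] px_py_cong[OF assms(1) that Suc.prems(2)] by auto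
  then have "Ck_on k S (px g)" "Ck_on k S (py g)"
    using Suc.IH[OF jets2_dx[OF Suc.prems(1)], of "px g"] Suc.IH[OF jets2_dy[OF Suc.prems(1)], of "py g"]
    by (auto simp: jet_dx_apply jet_dy_apply)
  ultimately show ?case by simp
qed

lemma leib2_tendsto:
  assumes "\<And>\<beta>. deg \<beta> \<le> deg \<alpha> \<Longrightarrow> (v \<beta> \<longlongrightarrow> V \<beta>) F" "\<And>\<beta>. deg \<beta> \<le> deg \<alpha> \<Longrightarrow> (w \<beta> \<longlongrightarrow> W \<beta>) F"
  shows "((\<lambda>q. leib2 (\<lambda>\<beta>. v \<beta> q) (\<lambda>\<beta>. w \<beta> q) \<alpha>) \<longlongrightarrow> leib2 V W \<alpha>) F"
  using assms by (cases \<alpha>) (auto simp: leib2_def intro!: tendsto_intros)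

section \<open>One-sided limits along a curve\<close>

lemma at_within_elim:
  fixes q :: plane
  assumes "(w \<longlongrightarrow> (l::real)) (at q within S)" "e > 0"
  obtains d where "d > 0" "\<And>z. z \<in> S \<Longrightarrow> z \<noteq> q \<Longrightarrow> dist z q < d \<Longrightarrow> \<bar>w z - l\<bar> < e"
proof -
  have "\<forall>\<^sub>F z in at q within S. dist (w z) l < e" using assms by (rule tendstoD)
  then show ?thesis using that unfolding eventually_at dist_real_def by blast
qed

text \<open>A curve \<open>\<gamma>\<close> on the boundary of \<open>S\<close> together with a fixed direction \<open>\<nu>\<close> that leads from each of its points into
\<open>S\<close>. The translates \<open>\<gamma> + \<sigma> \<nu>\<close> lie inside \<open>S\<close>, where functions can be differentiated.\<close>

locale transversal_curve =
  fixes S :: "plane set" and J :: "real set" and rr ss :: "nat \<Rightarrow> real \<Rightarrow> real"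
    and p \<nu> :: plane and \<eta> :: real
  assumes open_J: "open J" and eta: "\<eta> > 0"
    and rr_deriv: "\<And>t. t \<in> J \<Longrightarrow> (rr 0 has_real_derivative rr 1 t) (at t)"
    and ss_deriv: "\<And>t. t \<in> J \<Longrightarrow> (ss 0 has_real_derivative ss 1 t) (at t)"
    and rr1: "continuous_on J (rr 1)" and ss1: "continuous_on J (ss 1)"
    and side: "\<And>t \<sigma>. t \<in> J \<Longrightarrow> 0 < \<sigma> \<Longrightarrow> \<sigma> < \<eta> \<Longrightarrow> p + (rr 0 t, ss 0 t) + \<sigma> *\<^sub>R \<nu> \<in> S"
    and outside: "\<And>t. t \<in> J \<Longrightarrow> p + (rr 0 t, ss 0 t) \<notin> S"
begin

definition \<gamma> :: "real \<Rightarrow> plane" where "\<gamma> t = p + (rr 0 t, ss 0 t)"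

lemma transversal_limit:
  assumes "(w \<longlongrightarrow> (l::real)) (at (\<gamma> t) within S)" "t \<in> J"
  shows "((\<lambda>\<sigma>. w (\<gamma> t + \<sigma> *\<^sub>R \<nu>)) \<longlongrightarrow> l) (at_right 0)"
proof (rule filterlim_compose[OF assms(1)])
  have "((\<lambda>\<sigma>. \<gamma> t + \<sigma> *\<^sub>R \<nu>) \<longlongrightarrow> \<gamma> t + 0 *\<^sub>R \<nu>) (at_right 0)"
    by (intro tendsto_intros)
  moreover have "\<forall>\<^sub>F \<sigma> in at_right 0. \<gamma> t + \<sigma> *\<^sub>R \<nu> \<in> S - {\<gamma> t}"
  proof -
    have "\<forall>\<^sub>F \<sigma> in at_right 0. \<sigma> \<in> {0<..<\<eta>}" using eta eventually_at_right_real by blast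
    then show ?thesis
      by eventually_elim (use side[OF assms(2)] outside[OF assms(2)] in \<open>auto simp: \<gamma>_def\<close>)
  qed
  ultimately show "filterlim (\<lambda>\<sigma>. \<gamma> t + \<sigma> *\<^sub>R \<nu>) (at (\<gamma> t) within S) (at_right 0)"
    by (auto simp: filterlim_at elim: eventually_mono)
qed

lemma continuous_gamma: "continuous_on J \<gamma>"
proof -
  have "continuous_on J (rr 0)" "continuous_on J (ss 0)"
    using rr_deriv ss_deriv has_field_derivative_at_within by (blast intro: DERIV_continuous_on)+
  then show ?thesis unfolding \<gamma>_def by (intro continuous_intros)
qed

lemma near_curve:
  assumes "t0 \<in> J" "d > 0"
  obtains e where "e > 0" "e < \<eta>" "ball t0 e \<subseteq> J"
    "\<And>t \<sigma>. \<bar>t - t0\<bar> < e \<Longrightarrow> 0 < \<sigma> \<Longrightarrow> \<sigma> < e \<Longrightarrow> dist (\<gamma> t + \<sigma> *\<^sub>R \<nu>) (\<gamma> t0) < d"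
proof -
  obtain e1 where e1: "e1 > 0" "ball t0 e1 \<subseteq> J" using open_J assms(1) openE by blast
  obtain e2 where e2: "e2 > 0" "\<And>t. t \<in> J \<Longrightarrow> dist t t0 < e2 \<Longrightarrow> dist (\<gamma> t) (\<gamma> t0) < d / 2"
    using continuous_gamma assms unfolding continuous_on_iff by (metis half_gt_zero)
  define e3 where "e3 = d / (2 * (norm \<nu> + 1))"
  have n: "norm \<nu> + 1 > 0" by (simp add: add_nonneg_pos)
  have e3: "e3 > 0" using assms(2) n by (simp add: e3_def)
  define e where "e = min (min e1 e2) (min e3 (\<eta> / 2))"
  show ?thesis
  proof
    show "e > 0" "e < \<eta>" using e1 e2 e3 eta by (auto simp: e_def)
    show "ball t0 e \<subseteq> J" using e1 by (auto simp: e_def)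
    fix t \<sigma> assume *: "\<bar>t - t0\<bar> < e" "0 < \<sigma>" "\<sigma> < e"
    have "dist (\<gamma> t + \<sigma> *\<^sub>R \<nu>) (\<gamma> t0) \<le> dist (\<gamma> t) (\<gamma> t0) + norm (\<sigma> *\<^sub>R \<nu>)"
      unfolding dist_norm using norm_triangle_ineq[of "\<gamma> t - \<gamma> t0" "\<sigma> *\<^sub>R \<nu>"] by (simp add: algebra_simps)
    also have "dist (\<gamma> t) (\<gamma> t0) < d / 2"
      using * e1(2) by (intro e2(2)) (auto simp: e_def dist_real_def abs_minus_commute)
    also have "norm (\<sigma> *\<^sub>R \<nu>) \<le> d / 2"
    proof -
      have "\<sigma> * norm \<nu> \<le> e3 * (norm \<nu> + 1)"
        using * e3 by (intro mult_mono) (auto simp: e_def)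
      also have "\<dots> = d / 2" using n by (simp add: e3_def field_simps)
      finally show ?thesis using * by simp
    qed
    finally show "dist (\<gamma> t + \<sigma> *\<^sub>R \<nu>) (\<gamma> t0) < d" by simp
  qed
qed

lemma trace_continuous:
  fixes w :: "plane \<Rightarrow> real"
  assumes "\<And>t. t \<in> J \<Longrightarrow> (w \<longlongrightarrow> W t) (at (\<gamma> t) within S)"
  shows "continuous_on J W"
  unfolding continuous_on_iff
proof (intro ballI allI impI)
  fix t0 e :: real assume t0: "t0 \<in> J" and e: "0 < e"
  obtain d where d: "d > 0" "\<And>z. z \<in> S \<Longrightarrow> z \<noteq> \<gamma> t0 \<Longrightarrow> dist z (\<gamma> t0) < d \<Longrightarrow> \<bar>w z - W t0\<bar> < e / 2"
    using at_within_elim[OF assms[OF t0], of "e / 2"] e by auto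
  obtain c where c: "c > 0" "c < \<eta>" "ball t0 c \<subseteq> J"
    "\<And>t \<sigma>. \<bar>t - t0\<bar> < c \<Longrightarrow> 0 < \<sigma> \<Longrightarrow> \<sigma> < c \<Longrightarrow> dist (\<gamma> t + \<sigma> *\<^sub>R \<nu>) (\<gamma> t0) < d"
    using near_curve[OF t0 d(1)] by blast
  have "dist (W t) (W t0) < e" if t: "t \<in> J" "dist t t0 < c" for t
  proof -
    have "((\<lambda>\<sigma>. \<bar>w (\<gamma> t + \<sigma> *\<^sub>R \<nu>) - W t0\<bar>) \<longlongrightarrow> \<bar>W t - W t0\<bar>) (at_right 0)"
      by (intro tendsto_intros transversal_limit assms t)
    moreover have "\<forall>\<^sub>F \<sigma> in at_right 0. \<bar>w (\<gamma> t + \<sigma> *\<^sub>R \<nu>) - W t0\<bar> \<le> e / 2"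
    proof -
      have "\<forall>\<^sub>F \<sigma> in at_right 0. \<sigma> \<in> {0<..<c}" using c(1) eventually_at_right_real by blast
      then show ?thesis
      proof eventually_elim
        case (elim \<sigma>)
        then have "\<gamma> t + \<sigma> *\<^sub>R \<nu> \<in> S" using side[OF t(1), of \<sigma>] c(2) by (simp add: \<gamma>_def)
        moreover have "\<gamma> t0 \<notin> S" using outside[OF t0] by (simp add: \<gamma>_def)
        moreover have "dist (\<gamma> t + \<sigma> *\<^sub>R \<nu>) (\<gamma> t0) < d"
          using elim t(2) by (intro c(4)) (auto simp: dist_real_def)
        ultimately show ?case using d(2)[of "\<gamma> t + \<sigma> *\<^sub>R \<nu>"] by fastforce
      qed
    qed
    ultimately have "\<bar>W t - W t0\<bar> \<le> e / 2"
      by (intro tendsto_upperbound) auto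
    then show ?thesis using e by (simp add: dist_real_def)
  qed
  then show "\<exists>d>0. \<forall>t\<in>J. dist t t0 < d \<longrightarrow> dist (W t) (W t0) < e"
    using c(1) by blast
qed

text \<open>The chain rule for one-sided limits. The mean value theorem on the translated curve \<open>\<gamma> + \<sigma> \<nu>\<close> expresses the increment
of \<open>w\<close> by a derivative \<open>H\<close> at an intermediate point. Near \<open>\<gamma> t0\<close> the latter is uniformly close to the claimed
derivative \<open>H0\<close>, and this estimate survives the limit \<open>\<sigma> \<rightarrow> 0\<close>.\<close>

lemma trace_derivative:
  assumes deriv: "\<And>q. q \<in> S \<Longrightarrow> (w has_derivative (\<lambda>h. fst h * wx q + snd h * wy q)) (at q)"
    and W: "\<And>t. t \<in> J \<Longrightarrow> (w \<longlongrightarrow> W t) (at (\<gamma> t) within S)"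
    and t0: "t0 \<in> J"
    and Wx: "(wx \<longlongrightarrow> Wx) (at (\<gamma> t0) within S)" and Wy: "(wy \<longlongrightarrow> Wy) (at (\<gamma> t0) within S)"
  shows "(W has_real_derivative rr 1 t0 * Wx + ss 1 t0 * Wy) (at t0)"
proof -
  define H0 where "H0 = rr 1 t0 * Wx + ss 1 t0 * Wy"
  define H where "H = (\<lambda>t q. rr 1 t * wx q + ss 1 t * wy q)"
  have mvt: "\<exists>\<xi>. \<bar>\<xi> - t0\<bar> \<le> \<bar>t1 - t0\<bar> \<and>
      w (\<gamma> t1 + \<sigma> *\<^sub>R \<nu>) - w (\<gamma> t0 + \<sigma> *\<^sub>R \<nu>) = (t1 - t0) * H \<xi> (\<gamma> \<xi> + \<sigma> *\<^sub>R \<nu>)"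
    if c: "ball t0 c \<subseteq> J" "\<bar>t1 - t0\<bar> < c" "0 < \<sigma>" "\<sigma> < \<eta>" for c t1 \<sigma>
  proof -
    have D: "((\<lambda>t. w (\<gamma> t + \<sigma> *\<^sub>R \<nu>)) has_real_derivative H t (\<gamma> t + \<sigma> *\<^sub>R \<nu>)) (at t)"
      if t: "t \<in> J" for t
    proof -
      have "((\<lambda>t. \<gamma> t + \<sigma> *\<^sub>R \<nu>) has_derivative (\<lambda>h. (h * rr 1 t, h * ss 1 t))) (at t)"
        using rr_deriv[OF t] ss_deriv[OF t] unfolding \<gamma>_def has_field_derivative_def
        by (auto intro!: derivative_eq_intros simp: mult.commute zero_prod_def)
      moreover have "\<gamma> t + \<sigma> *\<^sub>R \<nu> \<in> S" using side[OF t] c by (simp add: \<gamma>_def)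
      ultimately have "((\<lambda>t. w (\<gamma> t + \<sigma> *\<^sub>R \<nu>)) has_derivative
        (\<lambda>h. fst (h * rr 1 t, h * ss 1 t) * wx (\<gamma> t + \<sigma> *\<^sub>R \<nu>) +
             snd (h * rr 1 t, h * ss 1 t) * wy (\<gamma> t + \<sigma> *\<^sub>R \<nu>))) (at t)"
        by (rule has_derivative_compose[OF _ deriv])
      then show ?thesis
        by (rule has_derivative_imp_has_field_derivative) (simp add: H_def algebra_simps)
    qed
    have "{min t0 t1..max t0 t1} \<subseteq> J" using c(1,2) by (force simp: dist_real_def)
    then have D': "((\<lambda>t. w (\<gamma> t + \<sigma> *\<^sub>R \<nu>)) has_real_derivative H t (\<gamma> t + \<sigma> *\<^sub>R \<nu>)) (at t)"
      if "min t0 t1 \<le> t" "t \<le> max t0 t1" for t using D that by auto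
    consider "t0 = t1" | "t0 < t1" | "t1 < t0" by linarith
    then show ?thesis
    proof cases
      case 2
      then have "\<exists>z>t0. z < t1 \<and> w (\<gamma> t1 + \<sigma> *\<^sub>R \<nu>) - w (\<gamma> t0 + \<sigma> *\<^sub>R \<nu>) = (t1 - t0) * H z (\<gamma> z + \<sigma> *\<^sub>R \<nu>)"
        by (intro MVT2[of t0 t1] D') auto
      then show ?thesis using 2 by (elim exE) (auto intro!: exI)
    next
      case 3
      then have "\<exists>z>t1. z < t0 \<and> w (\<gamma> t0 + \<sigma> *\<^sub>R \<nu>) - w (\<gamma> t1 + \<sigma> *\<^sub>R \<nu>) = (t0 - t1) * H z (\<gamma> z + \<sigma> *\<^sub>R \<nu>)"
        by (intro MVT2[of t1 t0] D') auto
      then obtain z where "t1 < z" "z < t0"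
        "w (\<gamma> t0 + \<sigma> *\<^sub>R \<nu>) - w (\<gamma> t1 + \<sigma> *\<^sub>R \<nu>) = (t0 - t1) * H z (\<gamma> z + \<sigma> *\<^sub>R \<nu>)" by blast
      then show ?thesis by (intro exI[of _ z]) (auto simp: algebra_simps)
    qed auto
  qed
  \<comment> \<open>The limits of the derivatives at \<open>\<gamma> t0\<close> control all points of the translated curves that are close to it.\<close>
  have close: "\<exists>c>0. c < \<eta> \<and> ball t0 c \<subseteq> J \<and>
      (\<forall>t \<sigma>. \<bar>t - t0\<bar> < c \<longrightarrow> 0 < \<sigma> \<longrightarrow> \<sigma> < c \<longrightarrow> \<bar>H t (\<gamma> t + \<sigma> *\<^sub>R \<nu>) - H0\<bar> < e)" if e: "e > 0" for e
  proof -
    have "((\<lambda>x. rr 1 (fst x) * wx (snd x) + ss 1 (fst x) * wy (snd x)) \<longlongrightarrow> H0)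
        (nhds t0 \<times>\<^sub>F (at (\<gamma> t0) within S))"
      unfolding H0_def
    proof (intro tendsto_intros)
      have "isCont (rr 1) t0" "isCont (ss 1) t0"
        using rr1 ss1 open_J t0 continuous_on_eq_continuous_at by blast+
      then have *: "(rr 1 \<longlongrightarrow> rr 1 t0) (nhds t0)" "(ss 1 \<longlongrightarrow> ss 1 t0) (nhds t0)"
        using tendsto_at_iff_tendsto_nhds unfolding isCont_def by blast+
      show "((\<lambda>x. rr 1 (fst x)) \<longlongrightarrow> rr 1 t0) (nhds t0 \<times>\<^sub>F (at (\<gamma> t0) within S))"
        "((\<lambda>x. ss 1 (fst x)) \<longlongrightarrow> ss 1 t0) (nhds t0 \<times>\<^sub>F (at (\<gamma> t0) within S))"
        by (rule filterlim_compose[OF *(1) filterlim_fst], rule filterlim_compose[OF *(2) filterlim_fst])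
      show "((\<lambda>x. wx (snd x)) \<longlongrightarrow> Wx) (nhds t0 \<times>\<^sub>F (at (\<gamma> t0) within S))"
        "((\<lambda>x. wy (snd x)) \<longlongrightarrow> Wy) (nhds t0 \<times>\<^sub>F (at (\<gamma> t0) within S))"
        by (rule filterlim_compose[OF Wx filterlim_snd], rule filterlim_compose[OF Wy filterlim_snd])
    qed
    then have "\<forall>\<^sub>F x in nhds t0 \<times>\<^sub>F (at (\<gamma> t0) within S). dist (rr 1 (fst x) * wx (snd x) + ss 1 (fst x) * wy (snd x)) H0 < e"
      using e by (rule tendstoD)
    then obtain P Q where PQ: "eventually P (nhds t0)" "eventually Q (at (\<gamma> t0) within S)"
      "\<And>t q. P t \<Longrightarrow> Q q \<Longrightarrow> \<bar>H t q - H0\<bar> < e"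
      unfolding eventually_prod_filter H_def dist_real_def by auto
    obtain d1 where d1: "d1 > 0" "\<And>t. dist t t0 < d1 \<Longrightarrow> P t"
      using PQ(1) unfolding eventually_nhds_metric by blast
    obtain d2 where d2: "d2 > 0" "\<And>q. q \<in> S \<Longrightarrow> q \<noteq> \<gamma> t0 \<Longrightarrow> dist q (\<gamma> t0) < d2 \<Longrightarrow> Q q"
      using PQ(2) unfolding eventually_at by blast
    obtain c where c: "c > 0" "c < \<eta>" "ball t0 c \<subseteq> J"
      "\<And>t \<sigma>. \<bar>t - t0\<bar> < c \<Longrightarrow> 0 < \<sigma> \<Longrightarrow> \<sigma> < c \<Longrightarrow> dist (\<gamma> t + \<sigma> *\<^sub>R \<nu>) (\<gamma> t0) < d2"
      using near_curve[OF t0 d2(1)] by blast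
    have "\<bar>H t (\<gamma> t + \<sigma> *\<^sub>R \<nu>) - H0\<bar> < e" if *: "\<bar>t - t0\<bar> < min c d1" "0 < \<sigma>" "\<sigma> < min c d1" for t \<sigma>
    proof (rule PQ(3)[OF d1(2) d2(2)])
      show "dist t t0 < d1" using * by (simp add: dist_real_def)
      have "t \<in> J" using * c(3) by (auto simp: dist_real_def abs_minus_commute)
      then show S: "\<gamma> t + \<sigma> *\<^sub>R \<nu> \<in> S" using side[of t \<sigma>] * c(2) by (simp add: \<gamma>_def)
      show "\<gamma> t + \<sigma> *\<^sub>R \<nu> \<noteq> \<gamma> t0" using S outside[OF t0] unfolding \<gamma>_def by metis
      show "dist (\<gamma> t + \<sigma> *\<^sub>R \<nu>) (\<gamma> t0) < d2" using * by (intro c(4)) auto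
    qed
    moreover have "ball t0 (min c d1) \<subseteq> J" using c(3) by auto
    ultimately show ?thesis using c d1(1) by (intro exI[of _ "min c d1"]) auto
  qed
  have "(W has_derivative (\<lambda>h. h * H0)) (at t0)"
    unfolding has_derivative_within_alt
  proof (intro conjI allI impI)
    show "bounded_linear (\<lambda>h. h * H0)" by (rule bounded_linear_mult_left)
    fix e :: real assume e: "e > 0"
    obtain c where c: "c > 0" "c < \<eta>" "ball t0 c \<subseteq> J"
      "\<And>t \<sigma>. \<bar>t - t0\<bar> < c \<Longrightarrow> 0 < \<sigma> \<Longrightarrow> \<sigma> < c \<Longrightarrow> \<bar>H t (\<gamma> t + \<sigma> *\<^sub>R \<nu>) - H0\<bar> < e"
      using close[OF e] by blast
    have "\<bar>W t - W t0 - (t - t0) * H0\<bar> \<le> e * \<bar>t - t0\<bar>" if t: "\<bar>t - t0\<bar> < c" for t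
    proof -
      have tJ: "t \<in> J" using t c(3) by (auto simp: dist_real_def abs_minus_commute)
      have "((\<lambda>\<sigma>. \<bar>w (\<gamma> t + \<sigma> *\<^sub>R \<nu>) - w (\<gamma> t0 + \<sigma> *\<^sub>R \<nu>) - (t - t0) * H0\<bar>) \<longlongrightarrow>
          \<bar>W t - W t0 - (t - t0) * H0\<bar>) (at_right 0)"
        by (intro tendsto_intros transversal_limit W tJ t0)
      moreover have "\<forall>\<^sub>F \<sigma> in at_right 0. \<bar>w (\<gamma> t + \<sigma> *\<^sub>R \<nu>) - w (\<gamma> t0 + \<sigma> *\<^sub>R \<nu>) - (t - t0) * H0\<bar> \<le> e * \<bar>t - t0\<bar>"
      proof -
        have "\<forall>\<^sub>F \<sigma> in at_right 0. \<sigma> \<in> {0<..<c}" using c(1) eventually_at_right_real by blast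
        then show ?thesis
        proof eventually_elim
          case (elim \<sigma>)
          then obtain \<xi> where \<xi>: "\<bar>\<xi> - t0\<bar> \<le> \<bar>t - t0\<bar>"
            "w (\<gamma> t + \<sigma> *\<^sub>R \<nu>) - w (\<gamma> t0 + \<sigma> *\<^sub>R \<nu>) = (t - t0) * H \<xi> (\<gamma> \<xi> + \<sigma> *\<^sub>R \<nu>)"
            using mvt[OF c(3) t, of \<sigma>] c(2) by auto
          have "\<bar>H \<xi> (\<gamma> \<xi> + \<sigma> *\<^sub>R \<nu>) - H0\<bar> \<le> e"
            using c(4)[of \<xi> \<sigma>] \<xi>(1) t elim by fastforce
          then have "\<bar>t - t0\<bar> * \<bar>H \<xi> (\<gamma> \<xi> + \<sigma> *\<^sub>R \<nu>) - H0\<bar> \<le> \<bar>t - t0\<bar> * e"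
            by (rule mult_left_mono) simp
          then show ?case unfolding \<xi>(2) by (simp add: abs_mult[symmetric] algebra_simps)
        qed
      qed
      ultimately show ?thesis by (intro tendsto_upperbound) auto
    qed
    then show "\<exists>d>0. \<forall>y\<in>UNIV. norm (y - t0) < d \<longrightarrow> norm (W y - W t0 - (y - t0) * H0) \<le> e * norm (y - t0)"
      using c(1) by (intro exI[of _ c]) simp
  qed
  then show ?thesis
    by (rule has_derivative_imp_has_field_derivative) (simp add: H0_def)
qed

end

text \<open>A family of functions of the curve parameter that behaves like the restrictions to the curve of the derivatives of one function.\<close>

definition chain_jets :: "nat \<Rightarrow> real set \<Rightarrow> (nat \<Rightarrow> real \<Rightarrow> real) \<Rightarrow> (nat \<Rightarrow> real \<Rightarrow> real) \<Rightarrow>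
    (nat \<times> nat \<Rightarrow> real \<Rightarrow> real) \<Rightarrow> bool" where
  "chain_jets k J rr ss V \<longleftrightarrow>
     (\<forall>i j t. i + j < k \<longrightarrow> t \<in> J \<longrightarrow>
        (V (i, j) has_real_derivative rr 1 t * V (Suc i, j) t + ss 1 t * V (i, Suc j) t) (at t)) \<and>
     (\<forall>\<alpha>. deg \<alpha> \<le> k \<longrightarrow> continuous_on J (V \<alpha>))"

lemma (in transversal_curve) chain_jets_trace:
  assumes "jets2 k S v" "\<And>\<alpha> t. deg \<alpha> \<le> k \<Longrightarrow> t \<in> J \<Longrightarrow> (v \<alpha> \<longlongrightarrow> V \<alpha> t) (at (\<gamma> t) within S)"
  shows "chain_jets k J rr ss V"
  unfolding chain_jets_def
proof (intro conjI allI impI)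
  fix i j t assume ij: "i + j < k" and t: "t \<in> J"
  show "(V (i, j) has_real_derivative rr 1 t * V (Suc i, j) t + ss 1 t * V (i, Suc j) t) (at t)"
    by (rule trace_derivative[OF jets2D[OF assms(1) ij] assms(2) t assms(2) assms(2)]) (use ij t in auto)
next
  fix \<alpha> :: "nat \<times> nat" assume "deg \<alpha> \<le> k"
  then show "continuous_on J (V \<alpha>)" by (intro trace_continuous[where w = "v \<alpha>"] assms(2))
qed

lemma chain_jets_compose:
  assumes "jets2 k U v" "\<And>t. t \<in> J \<Longrightarrow> p + (rr 0 t, ss 0 t) \<in> U"
    and "\<And>t. t \<in> J \<Longrightarrow> (rr 0 has_real_derivative rr 1 t) (at t)"
    and "\<And>t. t \<in> J \<Longrightarrow> (ss 0 has_real_derivative ss 1 t) (at t)"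
  shows "chain_jets k J rr ss (\<lambda>\<alpha> t. v \<alpha> (p + (rr 0 t, ss 0 t)))"
  unfolding chain_jets_def
proof (intro conjI allI impI)
  fix i j t assume *: "i + j < k" "t \<in> J"
  have "((\<lambda>t. p + (rr 0 t, ss 0 t)) has_derivative (\<lambda>h. (h * rr 1 t, h * ss 1 t))) (at t)"
    using assms(3,4)[OF *(2)] unfolding has_field_derivative_def
    by (auto intro!: derivative_eq_intros simp: mult.commute zero_prod_def)
  from has_derivative_compose[OF this jets2D[OF assms(1) *(1) assms(2)[OF *(2)]]]
  show "((\<lambda>t. v (i, j) (p + (rr 0 t, ss 0 t))) has_real_derivative
    rr 1 t * v (Suc i, j) (p + (rr 0 t, ss 0 t)) + ss 1 t * v (i, Suc j) (p + (rr 0 t, ss 0 t))) (at t)"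
    by (rule has_derivative_imp_has_field_derivative) (simp add: algebra_simps)
next
  fix \<alpha> :: "nat \<times> nat" assume "deg \<alpha> \<le> k"
  have "continuous_on J (rr 0)" "continuous_on J (ss 0)"
    using assms(3,4) has_field_derivative_at_within by (blast intro: DERIV_continuous_on)+
  then have "continuous_on J (\<lambda>t. p + (rr 0 t, ss 0 t))" by (intro continuous_intros)
  then show "continuous_on J (\<lambda>t. v \<alpha> (p + (rr 0 t, ss 0 t)))"
    using jets2_continuous[OF assms(1) \<open>deg \<alpha> \<le> k\<close>] assms(2)
    by (intro continuous_on_compose2[of U "v \<alpha>" J]) auto
qed

lemma curve_jets_Suc_leib:
  "curve_jets R S U (Suc k) (i, j) =
     leib (\<lambda>l. curve_jets R S U l (Suc i, j)) (\<lambda>l. R (Suc l)) k +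
     leib (\<lambda>l. curve_jets R S U l (i, Suc j)) (\<lambda>l. S (Suc l)) k"
  by (simp add: leib_def sum.distrib[symmetric] algebra_simps)

text \<open>By induction on the number of derivatives: the chain rule gives the first one as a sum of two products, and the
sequences of derivatives of their factors are known from the induction hypothesis.\<close>

theorem chain_jets_curve_jets:
  assumes V: "chain_jets n J rr ss V" and rs: "jets1 n J rr" "jets1 n J ss"
    and "deg \<alpha> + k \<le> n"
  shows "jets1 k J (\<lambda>l t. curve_jets (\<lambda>j. rr j t) (\<lambda>j. ss j t) (\<lambda>\<beta>. V \<beta> t) l \<alpha>)"
  using assms(4)
proof (induction k arbitrary: \<alpha>)
  case 0
  then have "deg \<alpha> \<le> n" by simp
  then have "continuous_on J (V \<alpha>)" using V unfolding chain_jets_def by blast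
  then show ?case by (simp add: jets1_0)
next
  case (Suc k)
  obtain i j where \<alpha>: "\<alpha> = (i, j)" by force
  have ij: "i + j < n" "Suc k \<le> n" using Suc.prems \<alpha> by auto
  have "jets1 k J (\<lambda>l t. 1 * leib (\<lambda>m. curve_jets (\<lambda>j. rr j t) (\<lambda>j. ss j t) (\<lambda>\<beta>. V \<beta> t) m (Suc i, j)) (\<lambda>m. rr (Suc m) t) l +
     1 * leib (\<lambda>m. curve_jets (\<lambda>j. rr j t) (\<lambda>j. ss j t) (\<lambda>\<beta>. V \<beta> t) m (i, Suc j)) (\<lambda>m. ss (Suc m) t) l)"
    using jets1_mono[OF rs(1) ij(2)] jets1_mono[OF rs(2) ij(2)] Suc.prems \<alpha>
    by (intro jets1_comb jets1_leib Suc.IH) (auto simp: jets1_Suc)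
  moreover have "(V (i, j) has_real_derivative rr 1 t * V (Suc i, j) t + ss 1 t * V (i, Suc j) t) (at t)" if "t \<in> J" for t
    using V ij(1) that unfolding chain_jets_def by blast
  ultimately show ?case
    unfolding jets1_Suc \<alpha> by (simp add: curve_jets_Suc_leib del: curve_jets.simps(2)) (simp add: leib_def mult.commute)
qed

section \<open>The interface near a point\<close>

definition normal0 :: "(real \<Rightarrow> real) \<Rightarrow> (real \<Rightarrow> real) \<Rightarrow> plane" where
  "normal0 r s = (deriv s 0, - deriv r 0)"

text \<open>Translating the curve along one fixed normal, instead of using the normal at each point, gives a chart that loses no
derivative.\<close>

definition chart_map :: "plane \<Rightarrow> (real \<Rightarrow> real) \<Rightarrow> (real \<Rightarrow> real) \<Rightarrow> real \<Rightarrow> real \<Rightarrow> plane" where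
  "chart_map p r s t \<sigma> = p + (r t, s t) + \<sigma> *\<^sub>R normal0 r s"

text \<open>The component of the curve along its tangent at \<open>0\<close>. It increases near \<open>0\<close> and therefore recovers the parameter from
a point; translations along \<^const>\<open>normal0\<close> do not change it.\<close>

definition tangential :: "(real \<Rightarrow> real) \<Rightarrow> (real \<Rightarrow> real) \<Rightarrow> real \<Rightarrow> real" where
  "tangential r s t = r t * deriv r 0 + s t * deriv s 0"

definition tangential' :: "(real \<Rightarrow> real) \<Rightarrow> (real \<Rightarrow> real) \<Rightarrow> real \<Rightarrow> real" where
  "tangential' r s t = deriv r t * deriv r 0 + deriv s t * deriv s 0"

lemma tangential_mono:
  assumes "\<And>t. t \<in> {-\<delta><..<\<delta>} \<Longrightarrow> (r has_real_derivative deriv r t) (at t)"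
    "\<And>t. t \<in> {-\<delta><..<\<delta>} \<Longrightarrow> (s has_real_derivative deriv s t) (at t)"
    "\<And>t. t \<in> {-\<delta><..<\<delta>} \<Longrightarrow> tangential' r s t > 0"
    "t \<in> {-\<delta><..<\<delta>}" "t' \<in> {-\<delta><..<\<delta>}" "t < t'"
  shows "tangential r s t < tangential r s t'"
proof (rule DERIV_pos_imp_increasing[OF assms(6)])
  fix x assume "t \<le> x" "x \<le> t'"
  then have x: "x \<in> {-\<delta><..<\<delta>}" using assms(4,5) by auto
  have "(tangential r s has_real_derivative tangential' r s x) (at x)"
    unfolding tangential_def tangential'_def
    by (auto intro!: derivative_eq_intros assms(1,2)[OF x])
  then show "\<exists>y. (tangential r s has_real_derivative y) (at x) \<and> 0 < y"
    using assms(3)[OF x] by blast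
qed

lemma chart_map_inj:
  assumes mono: "\<And>t t'. t \<in> J \<Longrightarrow> t' \<in> J \<Longrightarrow> t < t' \<Longrightarrow> tangential r s t < tangential r s t'"
    and nz: "(deriv r 0)\<^sup>2 + (deriv s 0)\<^sup>2 > 0"
    and tt: "t \<in> J" "t' \<in> J" and eq: "chart_map p r s t \<sigma> = chart_map p r s t' \<sigma>'"
  shows "t = t' \<and> \<sigma> = \<sigma>'"
proof -
  have e: "r t + \<sigma> * deriv s 0 = r t' + \<sigma>' * deriv s 0" "s t - \<sigma> * deriv r 0 = s t' - \<sigma>' * deriv r 0"
    using eq by (auto simp: chart_map_def normal0_def prod_eq_iff)
  have "tangential r s t = (r t + \<sigma> * deriv s 0) * deriv r 0 + (s t - \<sigma> * deriv r 0) * deriv s 0"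
    by (simp add: tangential_def algebra_simps)
  also have "\<dots> = tangential r s t'"
    unfolding e by (simp add: tangential_def algebra_simps)
  finally have "t = t'" using mono[OF tt] mono[OF tt(2,1)] by (cases t t' rule: linorder_cases) auto
  moreover from this have "\<sigma> = \<sigma>'" using e nz by (auto simp: sum_power2_gt_zero_iff)
  ultimately show ?thesis by simp
qed

lemma constant_sign:
  fixes f :: "'a::topological_space \<Rightarrow> real"
  assumes "connected S" "continuous_on S f" "\<And>x. x \<in> S \<Longrightarrow> f x \<noteq> 0"
  shows "(\<forall>x\<in>S. f x > 0) \<or> (\<forall>x\<in>S. f x < 0)"
proof (rule ccontr)
  assume "\<not> ?thesis"
  then obtain x y where xy: "x \<in> S" "y \<in> S" "f x \<le> 0" "f y \<ge> 0" by (meson not_less)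
  have "connected (f ` S)" using assms by (intro connected_continuous_image)
  then have "0 \<in> f ` S" using xy connectedD_interval[of "f ` S" "f x" "f y" 0] by auto
  then show False using assms(3) by auto
qed

text \<open>A neighbourhood of \<open>p\<close> with coordinates \<open>(t, \<sigma>)\<close> in which the interface is \<open>\<sigma> = 0\<close> and the sign of \<open>\<psi>\<close>
is that of \<open>\<kappa> \<sigma>\<close>.\<close>

locale interface_chart =
  fixes k :: nat and \<Omega> :: "plane set" and \<psi> :: "plane \<Rightarrow> real" and p :: plane
    and r s :: "real \<Rightarrow> real" and \<delta> \<eta> \<kappa> :: real
  assumes open_Omega: "open \<Omega>" and smooth: "smooth_interface k \<Omega> \<psi>" and k: "1 \<le> k"
    and delta: "\<delta> > 0" and eta: "\<eta> > 0" and kappa: "\<kappa> = 1 \<or> \<kappa> = - 1"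
    and r_jets: "jets1 k {-\<delta><..<\<delta>} (\<lambda>j. (deriv ^^ j) r)"
    and s_jets: "jets1 k {-\<delta><..<\<delta>} (\<lambda>j. (deriv ^^ j) s)"
    and r0: "r 0 = 0" and s0: "s 0 = 0"
    and tangential_pos: "\<And>t. t \<in> {-\<delta><..<\<delta>} \<Longrightarrow> tangential' r s t > 0"
    and in_Omega: "\<And>t \<sigma>. t \<in> {-\<delta><..<\<delta>} \<Longrightarrow> \<bar>\<sigma>\<bar> < \<eta> \<Longrightarrow> chart_map p r s t \<sigma> \<in> \<Omega>"
    and sign: "\<And>t \<sigma>. t \<in> {-\<delta><..<\<delta>} \<Longrightarrow> \<bar>\<sigma>\<bar> < \<eta> \<Longrightarrow> sgn (\<psi> (chart_map p r s t \<sigma>)) = \<kappa> * sgn \<sigma>"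

lemma Ck_real_on_subset_jets1:
  assumes "Ck_real_on k {-\<epsilon><..<\<epsilon>} r" "\<delta> \<le> \<epsilon>"
  shows "jets1 k {-\<delta><..<\<delta>} (\<lambda>j. (deriv ^^ j) r)"
  by (rule jets1_subset[OF jets1_deriv[OF _ assms(1)]]) (use assms(2) in auto)

lemma continuous_nhds_pos:
  fixes f :: "real \<Rightarrow> real"
  assumes "continuous_on {-\<epsilon><..<\<epsilon>} f" "\<epsilon> > 0" "f 0 > 0"
  shows "\<exists>\<delta>>0. \<delta> \<le> \<epsilon> \<and> (\<forall>t\<in>{-\<delta><..<\<delta>}. f t > 0)"
proof -
  obtain d where d: "d > 0" "\<And>t. t \<in> {-\<epsilon><..<\<epsilon>} \<Longrightarrow> dist t 0 < d \<Longrightarrow> dist (f t) (f 0) < f 0"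
    using assms unfolding continuous_on_iff by (metis greaterThanLessThan_iff neg_less_0_iff_less)
  have "f t > 0" if t: "t \<in> {-min d \<epsilon><..<min d \<epsilon>}" for t
  proof -
    have "t \<in> {-\<epsilon><..<\<epsilon>}" "dist t 0 < d" using t by (auto simp: dist_real_def)
    from d(2)[OF this] show ?thesis by (simp add: dist_real_def)
  qed
  then show ?thesis using d(1) assms(2) by (intro exI[of _ "min d \<epsilon>"]) auto
qed

lemma continuous_curve:
  assumes "jets1 k J (\<lambda>j. (deriv ^^ j) r)" "jets1 k J (\<lambda>j. (deriv ^^ j) s)"
  shows "continuous_on (J \<times> UNIV) (\<lambda>(t, \<sigma>). chart_map p r s t \<sigma>)"
proof -
  have "continuous_on J r" "continuous_on J s"
    using jets1_continuous[OF assms(1), of 0] jets1_continuous[OF assms(2), of 0] by auto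
  then have "continuous_on (J \<times> UNIV) (\<lambda>x. r (fst x))" "continuous_on (J \<times> UNIV) (\<lambda>x. s (fst x))"
    by (auto intro!: continuous_on_compose2[of J _ _ fst] continuous_intros)
  then show ?thesis
    unfolding chart_map_def case_prod_unfold by (intro continuous_intros)
qed

lemma open_chart_box:
  assumes jets: "jets1 k J (\<lambda>j. (deriv ^^ j) r)" "jets1 k J (\<lambda>j. (deriv ^^ j) s)" and "open J"
    and inj: "\<And>t t' \<sigma> \<sigma>'. t \<in> J \<Longrightarrow> t' \<in> J \<Longrightarrow>
      chart_map p r s t \<sigma> = chart_map p r s t' \<sigma>' \<Longrightarrow> t = t' \<and> \<sigma> = \<sigma>'"
  shows "open ((\<lambda>x. chart_map p r s (fst x) (snd x)) ` (J \<times> {-\<eta><..<\<eta>}))"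
proof (rule invariance_of_domain)
  show "continuous_on (J \<times> {-\<eta><..<\<eta>}) (\<lambda>x. chart_map p r s (fst x) (snd x))"
    using continuous_on_subset[OF continuous_curve[OF jets, of p], of "J \<times> {-\<eta><..<\<eta>}"]
    by (auto simp: case_prod_unfold)
  show "inj_on (\<lambda>x. chart_map p r s (fst x) (snd x)) (J \<times> {-\<eta><..<\<eta>})"
  proof (rule inj_onI)
    fix x y assume "x \<in> J \<times> {-\<eta><..<\<eta>}" "y \<in> J \<times> {-\<eta><..<\<eta>}"
      "chart_map p r s (fst x) (snd x) = chart_map p r s (fst y) (snd y)"
    then show "x = y" using inj[of "fst x" "fst y" "snd x" "snd y"] by (auto simp: prod_eq_iff)
  qed
qed (use \<open>open J\<close> in \<open>auto intro: open_Times\<close>)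

text \<open>In the chart \<open>\<psi>\<close> vanishes only for \<open>\<sigma> = 0\<close>, so it has a constant sign on each of the two connected halves. If the
signs agreed, \<open>p\<close> would not be in the closure of both regions.\<close>

lemma interface_chart_exists:
  assumes "open \<Omega>" and smooth: "smooth_interface k \<Omega> \<psi>" and k: "1 \<le> k"
    and p: "p \<in> Gamma \<Omega> \<psi>" and param: "local_param k (Gamma \<Omega> \<psi>) p r s \<epsilon>"
  obtains \<delta> \<eta> \<kappa> where "interface_chart k \<Omega> \<psi> p r s \<delta> \<eta> \<kappa>" "\<delta> \<le> \<epsilon>"
proof -
  let ?I = "\<lambda>d. {-d<..<d} :: real set"
  have \<epsilon>: "\<epsilon> > 0" and Ck: "Ck_real_on k (?I \<epsilon>) r" "Ck_real_on k (?I \<epsilon>) s"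
    and rs0: "r 0 = 0" "s 0 = 0"
    and reg: "\<And>t. t \<in> ?I \<epsilon> \<Longrightarrow> (deriv r t)\<^sup>2 + (deriv s t)\<^sup>2 > 0"
    using param unfolding local_param_def by blast+
  obtain U h where U: "open U" "p \<in> U"
    and hom: "homeomorphism (?I \<epsilon>) (Gamma \<Omega> \<psi> \<inter> U) (\<lambda>t. (r t + fst p, s t + snd p)) h"
    using param unfolding local_param_def by blast
  have nz: "(deriv r 0)\<^sup>2 + (deriv s 0)\<^sup>2 > 0" using reg[of 0] \<epsilon> by simp
  note jets = Ck_real_on_subset_jets1[OF Ck(1) order_refl] Ck_real_on_subset_jets1[OF Ck(2) order_refl]
  have "continuous_on (?I \<epsilon>) (tangential' r s)"
  proof -
    have "continuous_on (?I \<epsilon>) (deriv r)" "continuous_on (?I \<epsilon>) (deriv s)"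
      using jets1_continuous[OF jets(1) k] jets1_continuous[OF jets(2) k] by simp_all
    then show ?thesis unfolding tangential'_def by (intro continuous_intros)
  qed
  moreover have "tangential' r s 0 > 0" using nz by (simp add: tangential'_def power2_eq_square)
  ultimately obtain \<delta>0 where \<delta>0: "\<delta>0 > 0" "\<delta>0 \<le> \<epsilon>" "\<And>t. t \<in> ?I \<delta>0 \<Longrightarrow> tangential' r s t > 0"
    using continuous_nhds_pos[OF _ \<epsilon>] by blast
  note jets0 = Ck_real_on_subset_jets1[OF Ck(1) \<delta>0(2)] Ck_real_on_subset_jets1[OF Ck(2) \<delta>0(2)]
  have dr: "(r has_real_derivative deriv r t) (at t)" "(s has_real_derivative deriv s t) (at t)"
    if "t \<in> ?I \<delta>0" for t
    using jets1D[OF jets0(1), of 0 t] jets1D[OF jets0(2), of 0 t] k that by auto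
  have mono: "tangential r s t < tangential r s t'" if "t \<in> ?I \<delta>0" "t' \<in> ?I \<delta>0" "t < t'" for t t'
    using tangential_mono[of \<delta>0 r s t t'] dr \<delta>0(3) that by blast
  have inj: "t = t' \<and> \<sigma> = \<sigma>'"
    if "t \<in> ?I \<delta>0" "t' \<in> ?I \<delta>0" "chart_map p r s t \<sigma> = chart_map p r s t' \<sigma>'" for t t' \<sigma> \<sigma>'
    using chart_map_inj[OF mono nz] that by blast
  have curve: "chart_map p r s t 0 = (r t + fst p, s t + snd p)" for t
    by (simp add: chart_map_def prod_eq_iff)
  \<comment> \<open>As the parametrization is a homeomorphism, the interface near \<open>p\<close> is traced by small parameters only.\<close>
  have "continuous_on (Gamma \<Omega> \<psi> \<inter> U) h" using hom by (simp add: homeomorphism_def)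
  then obtain A where A: "open A" "A \<inter> (Gamma \<Omega> \<psi> \<inter> U) = h -` ?I \<delta>0 \<inter> (Gamma \<Omega> \<psi> \<inter> U)"
    unfolding continuous_on_open_invariant by (metis open_greaterThanLessThan)
  have hp: "h (r t + fst p, s t + snd p) = t" if "t \<in> ?I \<epsilon>" for t
    using hom that by (simp add: homeomorphism_def)
  have hq: "h q \<in> ?I \<epsilon> \<and> (r (h q) + fst p, s (h q) + snd p) = q" if "q \<in> Gamma \<Omega> \<psi> \<inter> U" for q
    using hom that unfolding homeomorphism_def by blast
  have "h p = 0" using hp[of 0] \<epsilon> rs0 by simp
  then have "p \<in> h -` ?I \<delta>0 \<inter> (Gamma \<Omega> \<psi> \<inter> U)" using p U(2) \<delta>0(1) by simp
  then have pA: "p \<in> A" using A(2) by blast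
  have "open ((\<lambda>(t, \<sigma>). chart_map p r s t \<sigma>) -` (U \<inter> A \<inter> \<Omega>) \<inter> (?I \<delta>0 \<times> UNIV))"
  proof -
    have "open (?I \<delta>0 \<times> (UNIV :: real set))" "open (U \<inter> A \<inter> \<Omega>)"
      using U(1) A(1) assms(1) by (simp_all add: open_Times open_Int)
    then show ?thesis
      using continuous_on_open_vimage[THEN iffD1, OF _ continuous_curve[OF jets0, of p]] by blast
  qed
  moreover have "(0, 0) \<in> (\<lambda>(t, \<sigma>). chart_map p r s t \<sigma>) -` (U \<inter> A \<inter> \<Omega>) \<inter> (?I \<delta>0 \<times> UNIV)"
  proof -
    have "chart_map p r s 0 0 = p" using rs0 by (simp add: chart_map_def zero_prod_def[symmetric])
    then show ?thesis using p U(2) pA \<delta>0(1) by (auto simp: Gamma_def)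
  qed
  ultimately obtain B C where BC: "open B" "open C" "(0::real) \<in> B" "(0::real) \<in> C"
    "B \<times> C \<subseteq> (\<lambda>(t, \<sigma>). chart_map p r s t \<sigma>) -` (U \<inter> A \<inter> \<Omega>) \<inter> (?I \<delta>0 \<times> UNIV)"
    by (rule open_prod_elim) auto
  obtain b where b: "b > 0" "ball 0 b \<subseteq> B" using BC(1,3) openE by blast
  obtain \<eta> where \<eta>: "\<eta> > 0" "ball 0 \<eta> \<subseteq> C" using BC(2,4) openE by blast
  define \<delta> where "\<delta> = min b \<delta>0"
  have \<delta>: "\<delta> > 0" "\<delta> \<le> \<delta>0" "\<delta> \<le> b" using b \<delta>0 by (auto simp: \<delta>_def)
  have I\<delta>: "t \<in> ?I \<delta>0" "t \<in> ?I \<epsilon>" if "t \<in> ?I \<delta>" for t using that \<delta> \<delta>0 by auto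
  have box: "chart_map p r s t \<sigma> \<in> U \<inter> A \<inter> \<Omega>" if "t \<in> ?I \<delta>" "\<bar>\<sigma>\<bar> < \<eta>" for t \<sigma>
  proof -
    have "t \<in> ball 0 b" "\<sigma> \<in> ball 0 \<eta>" using that \<delta> by (auto simp: dist_real_def)
    then have "(t, \<sigma>) \<in> B \<times> C" using b(2) \<eta>(2) by blast
    then show ?thesis using subsetD[OF BC(5)] by auto
  qed
  have zero: "\<psi> (chart_map p r s t \<sigma>) = 0 \<longleftrightarrow> \<sigma> = 0" if *: "t \<in> ?I \<delta>" "\<bar>\<sigma>\<bar> < \<eta>" for t \<sigma>
  proof
    assume "\<psi> (chart_map p r s t \<sigma>) = 0"
    then have G: "chart_map p r s t \<sigma> \<in> Gamma \<Omega> \<psi> \<inter> U" using box[OF *] by (simp add: Gamma_def)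
    then have "h (chart_map p r s t \<sigma>) \<in> ?I \<delta>0" using A(2) box[OF *] by blast
    moreover have "chart_map p r s t \<sigma> = chart_map p r s (h (chart_map p r s t \<sigma>)) 0"
      unfolding curve using hq[OF G] by simp
    ultimately show "\<sigma> = 0" using inj I\<delta>(1)[OF *(1)] by blast
  next
    assume "\<sigma> = 0"
    have "(r t + fst p, s t + snd p) \<in> Gamma \<Omega> \<psi> \<inter> U"
      using hom I\<delta>(2)[OF *(1)] by (auto simp: homeomorphism_def)
    then show "\<psi> (chart_map p r s t \<sigma>) = 0" using \<open>\<sigma> = 0\<close> curve by (simp add: Gamma_def)
  qed
  have "continuous_on \<Omega> \<psi>"
    using smooth Ck_on_mono[of k \<Omega> \<psi> 0] by (simp add: smooth_interface_def)
  moreover have cont0: "continuous_on (?I \<delta> \<times> ?I \<eta>) (\<lambda>x. chart_map p r s (fst x) (snd x))"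
  proof -
    have "?I \<delta> \<times> ?I \<eta> \<subseteq> ?I \<delta>0 \<times> UNIV" using I\<delta>(1) by blast
    from continuous_on_subset[OF continuous_curve[OF jets0, of p] this]
    show ?thesis by (simp add: case_prod_unfold)
  qed
  moreover have "(\<lambda>x. chart_map p r s (fst x) (snd x)) ` (?I \<delta> \<times> ?I \<eta>) \<subseteq> \<Omega>"
  proof (rule image_subsetI)
    fix x assume "x \<in> ?I \<delta> \<times> ?I \<eta>"
    then show "chart_map p r s (fst x) (snd x) \<in> \<Omega>" using box[of "fst x" "snd x"] by auto
  qed
  ultimately have cont: "continuous_on (?I \<delta> \<times> ?I \<eta>) (\<lambda>x. \<psi> (chart_map p r s (fst x) (snd x)))"
    by (rule continuous_on_compose2)
  have half: "(\<forall>x\<in>?I \<delta> \<times> K. \<psi> (chart_map p r s (fst x) (snd x)) > 0) \<or>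
              (\<forall>x\<in>?I \<delta> \<times> K. \<psi> (chart_map p r s (fst x) (snd x)) < 0)"
    if K: "connected K" "K \<subseteq> ?I \<eta>" "0 \<notin> K" for K
  proof (rule constant_sign)
    show "connected (?I \<delta> \<times> K)" using K(1) by (intro connected_Times) auto
    show "continuous_on (?I \<delta> \<times> K) (\<lambda>x. \<psi> (chart_map p r s (fst x) (snd x)))"
      by (rule continuous_on_subset[OF cont]) (use K(2) in auto)
    fix x assume x: "x \<in> ?I \<delta> \<times> K"
    then have "snd x \<in> ?I \<eta>" "snd x \<noteq> 0" using K by auto
    then show "\<psi> (chart_map p r s (fst x) (snd x)) \<noteq> 0" using zero[of "fst x" "snd x"] x by auto
  qed
  define W where "W = (\<lambda>x. chart_map p r s (fst x) (snd x)) ` (?I \<delta> \<times> ?I \<eta>)"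
  have "open W"
    unfolding W_def
    by (rule open_chart_box[OF jets1_subset[OF jets0(1)] jets1_subset[OF jets0(2)]])
       (use inj I\<delta>(1) in \<open>blast | simp\<close>)+
  have pW: "p \<in> W"
  proof -
    have "chart_map p r s 0 0 = p" using rs0 by (simp add: chart_map_def zero_prod_def[symmetric])
    then show ?thesis
      unfolding W_def using \<delta>(1) \<eta>(1) by (intro image_eqI[of _ _ "(0, 0)"]) auto
  qed
  \<comment> \<open>Both signs occur arbitrarily close to \<open>p\<close>, hence inside the chart.\<close>
  have touch: "\<exists>x\<in>?I \<delta> \<times> ?I \<eta>. \<psi> (chart_map p r s (fst x) (snd x)) > 0"
    "\<exists>x\<in>?I \<delta> \<times> ?I \<eta>. \<psi> (chart_map p r s (fst x) (snd x)) < 0"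
  proof -
    have "p \<in> closure (Omega_pos \<Omega> \<psi>)" "p \<in> closure (Omega_neg \<Omega> \<psi>)"
      using smooth p by (auto simp: smooth_interface_def)
    then have "W \<inter> Omega_pos \<Omega> \<psi> \<noteq> {}" "W \<inter> Omega_neg \<Omega> \<psi> \<noteq> {}"
      using \<open>open W\<close> pW open_Int_closure_eq_empty by blast+
    then show "\<exists>x\<in>?I \<delta> \<times> ?I \<eta>. \<psi> (chart_map p r s (fst x) (snd x)) > 0"
      "\<exists>x\<in>?I \<delta> \<times> ?I \<eta>. \<psi> (chart_map p r s (fst x) (snd x)) < 0"
      by (auto simp: W_def Omega_pos_def Omega_neg_def)
  qed
  define pos where "pos = (\<lambda>K. \<forall>t\<in>?I \<delta>. \<forall>\<sigma>\<in>K. \<psi> (chart_map p r s t \<sigma>) > 0)"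
  define neg where "neg = (\<lambda>K. \<forall>t\<in>?I \<delta>. \<forall>\<sigma>\<in>K. \<psi> (chart_map p r s t \<sigma>) < 0)"
  have up: "pos {0<..<\<eta>} \<or> neg {0<..<\<eta>}" and dn: "pos {-\<eta><..<0} \<or> neg {-\<eta><..<0}"
  proof -
    have "{0<..<\<eta>} \<subseteq> ?I \<eta>" "{-\<eta><..<0} \<subseteq> ?I \<eta>" using \<eta>(1) by auto
    then show "pos {0<..<\<eta>} \<or> neg {0<..<\<eta>}" "pos {-\<eta><..<0} \<or> neg {-\<eta><..<0}"
      using half[of "{0<..<\<eta>}"] half[of "{-\<eta><..<0}"] unfolding pos_def neg_def by auto
  qed
  have cases3: "\<sigma> = 0 \<or> \<sigma> \<in> {0<..<\<eta>} \<or> \<sigma> \<in> {-\<eta><..<0}" if "\<sigma> \<in> ?I \<eta>" for \<sigma>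
    using that by auto
  have "\<not> (pos {0<..<\<eta>} \<and> pos {-\<eta><..<0})"
  proof
    assume *: "pos {0<..<\<eta>} \<and> pos {-\<eta><..<0}"
    obtain t \<sigma> where x: "t \<in> ?I \<delta>" "\<sigma> \<in> ?I \<eta>" "\<psi> (chart_map p r s t \<sigma>) < 0" using touch(2) by auto
    then have "\<sigma> \<noteq> 0" using zero[OF x(1), of \<sigma>] by auto
    then have "\<sigma> \<in> {0<..<\<eta>} \<or> \<sigma> \<in> {-\<eta><..<0}" using cases3[OF x(2)] by blast
    then have "\<psi> (chart_map p r s t \<sigma>) > 0" using * x(1) unfolding pos_def by blast
    then show False using x(3) by simp
  qed
  moreover have "\<not> (neg {0<..<\<eta>} \<and> neg {-\<eta><..<0})"
  proof
    assume *: "neg {0<..<\<eta>} \<and> neg {-\<eta><..<0}"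
    obtain t \<sigma> where x: "t \<in> ?I \<delta>" "\<sigma> \<in> ?I \<eta>" "\<psi> (chart_map p r s t \<sigma>) > 0" using touch(1) by auto
    then have "\<sigma> \<noteq> 0" using zero[OF x(1), of \<sigma>] by auto
    then have "\<sigma> \<in> {0<..<\<eta>} \<or> \<sigma> \<in> {-\<eta><..<0}" using cases3[OF x(2)] by blast
    then have "\<psi> (chart_map p r s t \<sigma>) < 0" using * x(1) unfolding neg_def by blast
    then show False using x(3) by simp
  qed
  ultimately have alt: "pos {0<..<\<eta>} \<and> neg {-\<eta><..<0} \<or> neg {0<..<\<eta>} \<and> pos {-\<eta><..<0}"
    using up dn by blast
  define \<kappa> :: real where "\<kappa> = (if pos {0<..<\<eta>} \<and> neg {-\<eta><..<0} then 1 else -1)"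
  have sign: "sgn (\<psi> (chart_map p r s t \<sigma>)) = \<kappa> * sgn \<sigma>" if *: "t \<in> ?I \<delta>" "\<bar>\<sigma>\<bar> < \<eta>" for t \<sigma>
  proof -
    consider "\<sigma> = 0" | "\<sigma> \<in> {0<..<\<eta>}" | "\<sigma> \<in> {-\<eta><..<0}" using *(2) by fastforce
    then show ?thesis
    proof cases
      case 1
      then show ?thesis using zero[OF *] by simp
    next
      case 2
      then show ?thesis using alt *(1) unfolding \<kappa>_def pos_def neg_def by (auto split: if_splits)
    next
      case 3
      then show ?thesis using alt *(1) unfolding \<kappa>_def pos_def neg_def by (auto split: if_splits)
    qed
  qed
  have "\<delta> \<le> \<epsilon>" using \<delta> \<delta>0 by simp
  have "interface_chart k \<Omega> \<psi> p r s \<delta> \<eta> \<kappa>"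
    by unfold_locales
       (use assms(1) smooth k \<delta>(1) \<eta>(1) rs0 \<delta>0(3) I\<delta>(1) box sign
         Ck_real_on_subset_jets1[OF Ck(1) \<open>\<delta> \<le> \<epsilon>\<close>] Ck_real_on_subset_jets1[OF Ck(2) \<open>\<delta> \<le> \<epsilon>\<close>]
        in \<open>auto simp: \<kappa>_def\<close>)
  then show ?thesis using that \<open>\<delta> \<le> \<epsilon>\<close> by blast
qed

context interface_chart
begin

abbreviation J :: "real set" where "J \<equiv> {-\<delta><..<\<delta>}"
abbreviation \<gamma> :: "real \<Rightarrow> plane" where "\<gamma> t \<equiv> chart_map p r s t 0"
abbreviation X :: "real \<Rightarrow> real" where "X \<equiv> tangential r s"
abbreviation X' :: "real \<Rightarrow> real" where "X' \<equiv> tangential' r s"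

definition W :: "plane set" where "W = (\<lambda>x. chart_map p r s (fst x) (snd x)) ` (J \<times> {-\<eta><..<\<eta>})"
definition T :: "real \<Rightarrow> real" where "T = inv_into J X"
definition speed :: "real \<Rightarrow> real" where "speed t = sqrt ((deriv r t)\<^sup>2 + (deriv s t)\<^sup>2)"

lemma zero_in_J: "0 \<in> J" using delta by simp

lemma r_deriv: "t \<in> J \<Longrightarrow> (r has_real_derivative deriv r t) (at t)"
  and s_deriv: "t \<in> J \<Longrightarrow> (s has_real_derivative deriv s t) (at t)"
  using jets1D[OF r_jets, of 0 t] jets1D[OF s_jets, of 0 t] k by auto

lemma X_deriv: "t \<in> J \<Longrightarrow> (X has_real_derivative X' t) (at t)"
  unfolding tangential_def tangential'_def by (auto intro!: derivative_eq_intros r_deriv s_deriv)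

lemma X_mono: "t \<in> J \<Longrightarrow> t' \<in> J \<Longrightarrow> t < t' \<Longrightarrow> X t < X t'"
  using tangential_mono[of \<delta> r s t t'] r_deriv s_deriv tangential_pos by blast

lemma X_inj: "inj_on X J"
  by (rule inj_onI) (metis X_mono less_irrefl linorder_less_linear)

lemma regular0: "(deriv r 0)\<^sup>2 + (deriv s 0)\<^sup>2 > 0"
  using tangential_pos[OF zero_in_J] by (simp add: tangential'_def power2_eq_square)

lemma regular: "t \<in> J \<Longrightarrow> (deriv r t)\<^sup>2 + (deriv s t)\<^sup>2 > 0"
  using tangential_pos[of t] by (auto simp: tangential'_def sum_power2_gt_zero_iff)

lemma speed_pos: "t \<in> J \<Longrightarrow> speed t > 0"
  using regular by (simp add: speed_def)

lemma chart_inj: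
  "t \<in> J \<Longrightarrow> t' \<in> J \<Longrightarrow> chart_map p r s t \<sigma> = chart_map p r s t' \<sigma>' \<Longrightarrow> t = t' \<and> \<sigma> = \<sigma>'"
  using chart_map_inj[OF X_mono regular0] by blast

lemma X_continuous: "continuous_on J X"
  using X_deriv has_field_derivative_at_within by (blast intro: DERIV_continuous_on)

lemma open_XJ: "open (X ` J)"
  by (rule invariance_of_domain[OF X_continuous _ X_inj]) simp

lemma T_X: "t \<in> J \<Longrightarrow> T (X t) = t"
  by (simp add: T_def inv_into_f_f X_inj)

lemma T_continuous: "continuous_on (X ` J) T"
  by (rule continuous_on_inverse_open[OF _ X_continuous _ T_X]) auto

lemma T_deriv:
  assumes "t \<in> J"
  shows "(T has_real_derivative inverse (X' t)) (at (X t))"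
proof -
  obtain e where e: "e > 0" "ball (X t) e \<subseteq> X ` J" using open_XJ assms openE by blast
  show ?thesis
  proof (rule DERIV_inverse_function[where f = X and g = T and a = "X t - e" and b = "X t + e"])
    show "(X has_real_derivative X' t) (at (T (X t)))" using X_deriv[OF assms] T_X[OF assms] by simp
    show "X' t \<noteq> 0" using tangential_pos[OF assms] by simp
    show "isCont T (X t)" using T_continuous open_XJ assms continuous_on_eq_continuous_at by blast
    fix y assume "X t - e < y" "y < X t + e"
    then have "y \<in> ball (X t) e" by (simp add: dist_real_def)
    then show "X (T y) = y" using e(2) T_X by force
  qed (use e in auto)
qed

lemma open_W: "open W"
  unfolding W_def by (rule open_chart_box[OF r_jets s_jets open_greaterThanLessThan chart_inj])

lemma chart_in_W: "t \<in> J \<Longrightarrow> \<bar>\<sigma>\<bar> < \<eta> \<Longrightarrow> chart_map p r s t \<sigma> \<in> W"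
  unfolding W_def by (rule image_eqI[of _ _ "(t, \<sigma>)"]) auto

lemma W_cases:
  assumes "q \<in> W"
  obtains t \<sigma> where "t \<in> J" "\<bar>\<sigma>\<bar> < \<eta>" "q = chart_map p r s t \<sigma>"
  using assms unfolding W_def by force

lemma chart_Omega_pos: "t \<in> J \<Longrightarrow> \<bar>\<sigma>\<bar> < \<eta> \<Longrightarrow> chart_map p r s t \<sigma> \<in> Omega_pos \<Omega> \<psi> \<longleftrightarrow> \<kappa> * \<sigma> > 0"
  and chart_Omega_neg: "t \<in> J \<Longrightarrow> \<bar>\<sigma>\<bar> < \<eta> \<Longrightarrow> chart_map p r s t \<sigma> \<in> Omega_neg \<Omega> \<psi> \<longleftrightarrow> \<kappa> * \<sigma> < 0"
  and chart_Gamma: "t \<in> J \<Longrightarrow> \<bar>\<sigma>\<bar> < \<eta> \<Longrightarrow> chart_map p r s t \<sigma> \<in> Gamma \<Omega> \<psi> \<longleftrightarrow> \<sigma> = 0"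
  using in_Omega[of t \<sigma>] sign[of t \<sigma>] kappa
  by (auto simp: Omega_pos_def Omega_neg_def Gamma_def sgn_if split: if_splits)

lemma gamma_W: "t \<in> J \<Longrightarrow> \<gamma> t \<in> W" using chart_in_W eta by simp
lemma gamma_Gamma: "t \<in> J \<Longrightarrow> \<gamma> t \<in> Gamma \<Omega> \<psi>" using chart_Gamma eta by simp
lemma gamma_0: "\<gamma> 0 = p" by (simp add: chart_map_def r0 s0 zero_prod_def[symmetric])

lemma Gamma_W: "q \<in> Gamma \<Omega> \<psi> \<Longrightarrow> q \<in> W \<Longrightarrow> \<exists>t\<in>J. q = \<gamma> t"
  using chart_Gamma by (elim W_cases) auto

definition foot :: "plane \<Rightarrow> real" where "foot q = (q - p) \<bullet> (deriv r 0, deriv s 0)"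

lemma foot_chart: "foot (chart_map p r s t \<sigma>) = X t"
  by (simp add: foot_def chart_map_def normal0_def tangential_def algebra_simps)

text \<open>A point with the same tangential component as \<open>\<gamma> t\<close> differs from it by a multiple of the normal.\<close>

lemma decompose:
  assumes "foot q = X t"
  shows "q = chart_map p r s t (((q - \<gamma> t) \<bullet> normal0 r s) / ((deriv r 0)\<^sup>2 + (deriv s 0)\<^sup>2))"
proof -
  obtain a b where ab: "q - \<gamma> t = (a, b)" by force
  let ?c = "(deriv r 0)\<^sup>2 + (deriv s 0)\<^sup>2"
  have q: "q = \<gamma> t + (a, b)" using ab by (simp add: algebra_simps)
  have orth: "a * deriv r 0 + b * deriv s 0 = 0"
    using assms foot_chart[of t 0] unfolding q by (simp add: foot_def inner_add_left inner_diff_left)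
  have "(a * deriv s 0 - b * deriv r 0) * deriv s 0 = a * ?c"
    "(a * deriv s 0 - b * deriv r 0) * (- deriv r 0) = b * ?c"
    using orth by algebra+
  then have "(a * deriv s 0 - b * deriv r 0) * deriv s 0 / ?c = a"
    "(a * deriv s 0 - b * deriv r 0) * (- deriv r 0) / ?c = b"
    using less_imp_neq[OF regular0] by (metis nonzero_mult_div_cancel_right)+
  then have "((a * deriv s 0 - b * deriv r 0) / ?c) *\<^sub>R normal0 r s = (a, b)"
    by (simp add: normal0_def)
  then show ?thesis
    unfolding ab by (simp add: q chart_map_def normal0_def algebra_simps)
qed

text \<open>Moving from \<open>\<gamma> t0\<close> in a direction \<open>n\<close> changes the coordinate \<open>\<sigma>\<close> at a rate that is, up to a positive factor,
the expression in the last assumption. Here \<open>\<iota>\<close> selects the side of the interface.\<close>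

lemma leaves_curve:
  assumes t0: "t0 \<in> J" and \<iota>: "\<iota> = 1 \<or> \<iota> = (- 1 :: real)"
    and pos: "\<iota> * ((n \<bullet> normal0 r s) * X' t0 -
      (deriv r t0 * deriv s 0 - deriv s t0 * deriv r 0) * (n \<bullet> (deriv r 0, deriv s 0))) > 0"
  shows "\<forall>\<^sub>F d in at_right 0. \<exists>t\<in>J. \<exists>\<sigma>. \<bar>\<sigma>\<bar> < \<eta> \<and> \<iota> * \<sigma> > 0 \<and> \<gamma> t0 + d *\<^sub>R n = chart_map p r s t \<sigma>"
proof -
  let ?c = "(deriv r 0)\<^sup>2 + (deriv s 0)\<^sup>2"
  define ny where "ny = n \<bullet> normal0 r s"
  define nx where "nx = n \<bullet> (deriv r 0, deriv s 0)"
  define x where "x = (\<lambda>d. X t0 + d * nx)"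
  define Y where "Y = (\<lambda>t. r t * deriv s 0 - s t * deriv r 0)"
  \<comment> \<open>The normal coordinate of \<open>\<gamma> t0 + d n\<close>, as \<open>T (x d)\<close> is the parameter of its foot point.\<close>
  define \<sigma> where "\<sigma> = (\<lambda>d. (Y t0 + d * ny - Y (T (x d))) / ?c)"
  have x0: "x 0 = X t0" by (simp add: x_def)
  have Y_deriv: "(Y has_real_derivative (deriv r t0 * deriv s 0 - deriv s t0 * deriv r 0)) (at t0)"
    unfolding Y_def by (auto intro!: derivative_eq_intros r_deriv s_deriv t0)
  have "(T has_real_derivative inverse (X' t0)) (at (x 0))" using T_deriv[OF t0] x0 by simp
  moreover have "(x has_real_derivative nx) (at 0)" unfolding x_def by (auto intro!: derivative_eq_intros)
  ultimately have Tx: "((\<lambda>d. T (x d)) has_real_derivative inverse (X' t0) * nx) (at 0)"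
    by (rule DERIV_chain2)
  have "((\<lambda>d. Y (T (x d))) has_real_derivative
     (deriv r t0 * deriv s 0 - deriv s t0 * deriv r 0) * (inverse (X' t0) * nx)) (at 0)"
    by (rule DERIV_chain2[OF _ Tx]) (use Y_deriv T_X[OF t0] x0 in simp)
  then have \<sigma>_deriv: "(\<sigma> has_real_derivative
      (ny - (deriv r t0 * deriv s 0 - deriv s t0 * deriv r 0) * (inverse (X' t0) * nx)) / ?c) (at 0)"
    unfolding \<sigma>_def using regular0 by (auto intro!: derivative_eq_intros)
  have \<sigma>0: "\<sigma> 0 = 0" using T_X[OF t0] x0 by (simp add: \<sigma>_def)
  have X'pos: "X' t0 > 0" using tangential_pos[OF t0] .
  have "\<iota> * ((ny - (deriv r t0 * deriv s 0 - deriv s t0 * deriv r 0) * (inverse (X' t0) * nx)) / ?c) =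
     (\<iota> * (ny * X' t0 - (deriv r t0 * deriv s 0 - deriv s t0 * deriv r 0) * nx)) / (X' t0 * ?c)"
    using X'pos regular0 by (simp add: field_simps)
  also have "\<dots> > 0" using pos X'pos regular0 by (simp add: ny_def nx_def)
  finally have "\<iota> * ((ny - (deriv r t0 * deriv s 0 - deriv s t0 * deriv r 0) * (inverse (X' t0) * nx)) / ?c) > 0" .
  from has_real_derivative_pos_inc_right[OF DERIV_cmult[OF \<sigma>_deriv] this]
  obtain d1 where d1: "d1 > 0" "\<And>h. 0 < h \<Longrightarrow> h < d1 \<Longrightarrow> \<iota> * \<sigma> h > 0" using \<sigma>0 by auto
  have "isCont \<sigma> 0" using \<sigma>_deriv DERIV_isCont by blast
  then have "\<forall>\<^sub>F d in at 0. dist (\<sigma> d) 0 < \<eta>" using \<sigma>0 eta unfolding isCont_def by (metis tendstoD)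
  then have ev1: "\<forall>\<^sub>F d in at_right 0. \<bar>\<sigma> d\<bar> < \<eta>"
    by (simp add: eventually_at_split)
  have "isCont x 0" unfolding x_def by (intro continuous_intros)
  then have "(x \<longlongrightarrow> X t0) (at_right 0)"
    using x0 unfolding isCont_def by (metis filterlim_at_split)
  then have ev2: "\<forall>\<^sub>F d in at_right 0. x d \<in> X ` J"
    by (rule topological_tendstoD[OF _ open_XJ]) (use t0 in blast)
  have ev3: "\<forall>\<^sub>F d in at_right 0. d \<in> {0<..<d1}" using d1(1) eventually_at_right_real by blast
  from ev1 ev2 ev3 show ?thesis
  proof eventually_elim
    case (elim d)
    obtain t where t: "t \<in> J" "x d = X t" using elim by blast
    have foot: "foot (\<gamma> t0 + d *\<^sub>R n) = X t"
      using foot_chart[of t0 0] t(2) by (simp add: foot_def x_def nx_def inner_add_left inner_diff_left)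
    have "(\<gamma> t0 + d *\<^sub>R n - \<gamma> t) \<bullet> normal0 r s = Y t0 + d * ny - Y t"
      by (simp add: Y_def ny_def chart_map_def inner_add_left inner_diff_left normal0_def)
    then have "\<gamma> t0 + d *\<^sub>R n = chart_map p r s t (\<sigma> d)"
      using decompose[OF foot] T_X[OF t(1)] t(2) by (simp add: \<sigma>_def)
    moreover have "\<bar>\<sigma> d\<bar> < \<eta>" "\<iota> * \<sigma> d > 0" using elim d1(2) by auto
    ultimately show ?case using t(1) by blast
  qed
qed

text \<open>A second parametrization of the interface factors locally through the first one, by way of the inverse \<open>T\<close> of the
tangential component, so the two velocities are proportional.\<close>

lemma parallel_tangent:
  assumes t0: "t0 \<in> J" and q: "local_param 1 (Gamma \<Omega> \<psi>) (\<gamma> t0) r' s' \<epsilon>'"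
  shows "\<exists>c. deriv r' 0 = c * deriv r t0 \<and> deriv s' 0 = c * deriv s t0 \<and> c \<noteq> 0"
proof -
  let ?I = "{-\<epsilon>'<..<\<epsilon>'}"
  have e: "\<epsilon>' > 0" and Ck: "Ck_real_on 1 ?I r'" "Ck_real_on 1 ?I s'" and z: "r' 0 = 0" "s' 0 = 0"
    and reg: "\<And>t. t \<in> ?I \<Longrightarrow> (deriv r' t)\<^sup>2 + (deriv s' t)\<^sup>2 > 0"
    using q unfolding local_param_def by blast+
  have G: "\<gamma> t0 + (r' u, s' u) \<in> Gamma \<Omega> \<psi>" if "u \<in> ?I" for u
  proof -
    obtain U h where "homeomorphism ?I (Gamma \<Omega> \<psi> \<inter> U) (\<lambda>t. (r' t + fst (\<gamma> t0), s' t + snd (\<gamma> t0))) h"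
      using q unfolding local_param_def by blast
    then have "(r' u + fst (\<gamma> t0), s' u + snd (\<gamma> t0)) \<in> Gamma \<Omega> \<psi>"
      using that by (auto simp: homeomorphism_def)
    moreover have "\<gamma> t0 + (r' u, s' u) = (r' u + fst (\<gamma> t0), s' u + snd (\<gamma> t0))"
      by (simp add: prod_eq_iff)
    ultimately show ?thesis by simp
  qed
  note jets = jets1_deriv[OF open_greaterThanLessThan Ck(1)] jets1_deriv[OF open_greaterThanLessThan Ck(2)]
  have d: "(r' has_real_derivative deriv r' 0) (at 0)" "(s' has_real_derivative deriv s' 0) (at 0)"
    using jets1D[OF jets(1), of 0 0] jets1D[OF jets(2), of 0 0] e by auto
  define x where "x = (\<lambda>u. foot (\<gamma> t0 + (r' u, s' u)))"
  have x_eq: "x u = X t0 + (r' u * deriv r 0 + s' u * deriv s 0)" for u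
    using foot_chart[of t0 0] by (simp add: x_def foot_def inner_add_left inner_diff_left)
  have x0: "x 0 = X t0" by (simp add: x_eq z)
  have dx: "(x has_real_derivative (deriv r' 0 * deriv r 0 + deriv s' 0 * deriv s 0)) (at 0)"
    unfolding x_eq[abs_def] by (auto intro!: derivative_eq_intros d)
  define c where "c = inverse (X' t0) * (deriv r' 0 * deriv r 0 + deriv s' 0 * deriv s 0)"
  have dT: "((\<lambda>u. T (x u)) has_real_derivative c) (at 0)"
    unfolding c_def by (rule DERIV_chain2[OF _ dx]) (use T_deriv[OF t0] x0 in simp)
  have Tx0: "T (x 0) = t0" using T_X[OF t0] x0 by simp
  have dr: "((\<lambda>u. r (T (x u)) - r t0) has_real_derivative deriv r t0 * c) (at 0)"
    "((\<lambda>u. s (T (x u)) - s t0) has_real_derivative deriv s t0 * c) (at 0)"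
    using DERIV_chain2[OF _ dT, of r "deriv r t0"] DERIV_chain2[OF _ dT, of s "deriv s t0"]
      r_deriv[OF t0] s_deriv[OF t0] Tx0 by (auto intro!: derivative_eq_intros)
  define V where "V = (\<lambda>u. \<gamma> t0 + (r' u, s' u)) -` W \<inter> ?I"
  have "continuous_on ?I r'" "continuous_on ?I s'"
    using jets1_continuous[OF jets(1), of 0] jets1_continuous[OF jets(2), of 0] by auto
  then have "continuous_on ?I (\<lambda>u. \<gamma> t0 + (r' u, s' u))" by (intro continuous_intros)
  then have "open V"
    unfolding V_def using continuous_on_open_vimage[OF open_greaterThanLessThan] open_W by metis
  have V0: "0 \<in> V" using e z gamma_W[OF t0] by (simp add: V_def zero_prod_def[symmetric])
  have V: "r (T (x u)) - r t0 = r' u" "s (T (x u)) - s t0 = s' u" if u: "u \<in> V" for u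
  proof -
    obtain t where t: "t \<in> J" "\<gamma> t0 + (r' u, s' u) = \<gamma> t"
      using Gamma_W[OF G[of u]] u by (auto simp: V_def)
    then have "T (x u) = t" using T_X[OF t(1)] foot_chart[of t 0] by (simp add: x_def)
    moreover have "r' u = r t - r t0" "s' u = s t - s t0"
      using t(2) by (auto simp: chart_map_def prod_eq_iff)
    ultimately show "r (T (x u)) - r t0 = r' u" "s (T (x u)) - s t0 = s' u" by auto
  qed
  have "(r' has_real_derivative deriv r t0 * c) (at 0)" "(s' has_real_derivative deriv s t0 * c) (at 0)"
    using has_field_derivative_transform_within_open[OF dr(1) \<open>open V\<close> V0 V(1)]
      has_field_derivative_transform_within_open[OF dr(2) \<open>open V\<close> V0 V(2)] by auto
  then have "deriv r' 0 = c * deriv r t0" "deriv s' 0 = c * deriv s t0"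
    using DERIV_imp_deriv by (auto simp: mult.commute)
  moreover from this have "c \<noteq> 0" using reg[of 0] e by auto
  ultimately show ?thesis by blast
qed

lemma local_param_1: "local_param k G q r' s' \<epsilon>' \<Longrightarrow> local_param 1 G q r' s' \<epsilon>'"
proof -
  assume a: "local_param k G q r' s' \<epsilon>'"
  have "Ck_real_on 1 {-\<epsilon>'<..<\<epsilon>'} g" if "Ck_real_on k {-\<epsilon>'<..<\<epsilon>'} g" for g
    using that k jets1_continuous[OF jets1_deriv[OF open_greaterThanLessThan that] k]
    unfolding Ck_real_on_def by auto
  then show ?thesis using a unfolding local_param_def by blast
qed

text \<open>Two unit vectors are orthogonal to the tangent. By \<open>leaves_curve\<close> one of them leads into each region, which singles out
the vector that \<^const>\<open>unit_normal\<close> describes.\<close>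

theorem unit_normal_chart:
  assumes t0: "t0 \<in> J"
  shows "unit_normal \<Omega> \<psi> (\<gamma> t0) = (\<kappa> / speed t0) *\<^sub>R (deriv s t0, - deriv r t0)"
proof -
  define N where "N = (1 / speed t0) *\<^sub>R (deriv s t0, - deriv r t0)"
  have sp: "speed t0 > 0" "(speed t0)\<^sup>2 = (deriv r t0)\<^sup>2 + (deriv s t0)\<^sup>2"
    using speed_pos[OF t0] by (auto simp: speed_def)
  have norm_N: "norm N = 1"
  proof -
    have "(deriv s t0)\<^sup>2 / (speed t0)\<^sup>2 + (deriv r t0)\<^sup>2 / (speed t0)\<^sup>2 = 1"
      using sp(1) by (simp add: add_divide_distrib[symmetric] add.commute sp(2)[symmetric])
    then show ?thesis by (simp add: N_def norm_Pair power_divide)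
  qed
  have leave: "\<forall>\<^sub>F d in at_right 0. \<exists>t\<in>J. \<exists>\<sigma>. \<bar>\<sigma>\<bar> < \<eta> \<and> \<iota> * \<sigma> > 0 \<and> \<gamma> t0 + d *\<^sub>R (\<iota> *\<^sub>R N) = chart_map p r s t \<sigma>"
    if \<iota>: "\<iota> = 1 \<or> \<iota> = -1" for \<iota>
  proof (rule leaves_curve[OF t0 \<iota>])
    let ?Y = "deriv r t0 * deriv s 0 - deriv s t0 * deriv r 0"
    have a: "(\<iota> *\<^sub>R N) \<bullet> normal0 r s = \<iota> * X' t0 / speed t0"
      by (simp add: N_def normal0_def tangential'_def add_divide_distrib[symmetric] algebra_simps)
    have b: "(\<iota> *\<^sub>R N) \<bullet> (deriv r 0, deriv s 0) = - \<iota> * ?Y / speed t0"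
      by (simp add: N_def diff_divide_distrib[symmetric] algebra_simps)
    have "\<iota> * ((\<iota> *\<^sub>R N) \<bullet> normal0 r s * X' t0 - ?Y * ((\<iota> *\<^sub>R N) \<bullet> (deriv r 0, deriv s 0)))
       = (\<iota> * \<iota>) * ((X' t0)\<^sup>2 + ?Y\<^sup>2) / speed t0"
    proof -
      have "i * (i * x / v * x - y * (- i * y / v)) = i * i * (x\<^sup>2 + y\<^sup>2) / v" for i x y v :: real
        by (simp add: power2_eq_square add_divide_distrib algebra_simps)
      then show ?thesis unfolding a b by blast
    qed
    also have "\<dots> > 0"
      using \<iota> sp(1) tangential_pos[OF t0] by (auto intro!: divide_pos_pos add_pos_nonneg)
    finally show "\<iota> * ((\<iota> *\<^sub>R N) \<bullet> normal0 r s * X' t0 - ?Y * ((\<iota> *\<^sub>R N) \<bullet> (deriv r 0, deriv s 0))) > 0" .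
  qed
  have into_pos: "\<forall>\<^sub>F d in at_right 0. \<gamma> t0 + d *\<^sub>R (\<kappa> *\<^sub>R N) \<in> Omega_pos \<Omega> \<psi>"
    using leave[OF kappa] by eventually_elim (use chart_Omega_pos in auto)
  have "- \<kappa> = 1 \<or> - \<kappa> = -1" using kappa by auto
  from leave[OF this] have into_neg: "\<forall>\<^sub>F d in at_right 0. \<gamma> t0 + d *\<^sub>R ((- \<kappa>) *\<^sub>R N) \<in> Omega_neg \<Omega> \<psi>"
    by eventually_elim (use chart_Omega_neg in auto)
  have "unit_normal \<Omega> \<psi> (\<gamma> t0) = \<kappa> *\<^sub>R N"
    unfolding unit_normal_def
  proof (rule the_equality)
    have "norm (\<kappa> *\<^sub>R N) = 1" using kappa norm_N by auto
    moreover obtain r' s' \<epsilon>' where par: "local_param 1 (Gamma \<Omega> \<psi>) (\<gamma> t0) r' s' \<epsilon>'"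
      using smooth gamma_Gamma[OF t0] local_param_1 unfolding smooth_interface_def by blast
    moreover have "(\<kappa> *\<^sub>R N) \<bullet> (deriv r' 0, deriv s' 0) = 0"
      using parallel_tangent[OF t0 par] by (auto simp: N_def)
    ultimately show "norm (\<kappa> *\<^sub>R N) = 1 \<and>
     (\<exists>r s \<epsilon>. local_param 1 (Gamma \<Omega> \<psi>) (\<gamma> t0) r s \<epsilon> \<and> (\<kappa> *\<^sub>R N) \<bullet> (deriv r 0, deriv s 0) = 0) \<and>
     (\<forall>\<^sub>F \<delta> in at_right 0. \<gamma> t0 + \<delta> *\<^sub>R (\<kappa> *\<^sub>R N) \<in> Omega_pos \<Omega> \<psi>)"
      using into_pos by blast
  next
    fix n assume n: "norm n = 1 \<and>
     (\<exists>r s \<epsilon>. local_param 1 (Gamma \<Omega> \<psi>) (\<gamma> t0) r s \<epsilon> \<and> n \<bullet> (deriv r 0, deriv s 0) = 0) \<and>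
     (\<forall>\<^sub>F \<delta> in at_right 0. \<gamma> t0 + \<delta> *\<^sub>R n \<in> Omega_pos \<Omega> \<psi>)"
    obtain r' s' \<epsilon>' where par: "local_param 1 (Gamma \<Omega> \<psi>) (\<gamma> t0) r' s' \<epsilon>'" "n \<bullet> (deriv r' 0, deriv s' 0) = 0"
      using n by blast
    obtain a b where ab: "n = (a, b)" by force
    obtain c where c: "deriv r' 0 = c * deriv r t0" "deriv s' 0 = c * deriv s t0" "c \<noteq> 0"
      using parallel_tangent[OF t0 par(1)] by blast
    have "c * (a * deriv r t0 + b * deriv s t0) = 0" using par(2) by (simp add: ab c(1,2) algebra_simps)
    then have orth: "a * deriv r t0 + b * deriv s t0 = 0" using c(3) by simp
    define \<iota> where "\<iota> = (a * deriv s t0 - b * deriv r t0) / speed t0"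
    have "(a * deriv s t0 - b * deriv r t0) * deriv s t0 = a * (speed t0)\<^sup>2"
      "(a * deriv s t0 - b * deriv r t0) * (- deriv r t0) = b * (speed t0)\<^sup>2"
      unfolding sp(2) using orth by algebra+
    then have nN: "n = \<iota> *\<^sub>R N"
      using sp(1) by (simp add: ab \<iota>_def N_def field_simps power2_eq_square)
    have "\<bar>\<iota>\<bar> = 1" using n nN norm_N by simp
    then consider "\<iota> = \<kappa>" | "\<iota> = - \<kappa>" using kappa by fastforce
    then show "n = \<kappa> *\<^sub>R N"
    proof cases
      case 2
      have "\<forall>\<^sub>F d in at_right 0. \<gamma> t0 + d *\<^sub>R n \<in> Omega_pos \<Omega> \<psi>" using n by blast
      with into_neg have "\<forall>\<^sub>F d in at_right (0::real). False"
        by eventually_elim (use 2 nN in \<open>auto simp: Omega_pos_def Omega_neg_def\<close>)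
      then show ?thesis by simp
    qed (use nN in simp)
  qed
  then show ?thesis by (simp add: N_def)
qed

lemma orientation_chart: "orientation \<Omega> \<psi> p r s = \<kappa>"
proof -
  have sp: "speed 0 > 0" using speed_pos[OF zero_in_J] .
  have "unit_normal \<Omega> \<psi> p \<bullet> (deriv s 0, - deriv r 0) = \<kappa> / speed 0 * ((deriv r 0)\<^sup>2 + (deriv s 0)\<^sup>2)"
    using unit_normal_chart[OF zero_in_J] gamma_0 by (simp add: power2_eq_square algebra_simps)
  then show ?thesis
    using kappa sp regular0 by (auto simp: orientation_def sgn_mult)
qed

end

section \<open>Functions with prescribed jets\<close>

text \<open>The \<open>i\<close>-th derivative of \<open>x ^ k / k!\<close>.\<close>

definition taylor_monomial :: "nat \<Rightarrow> nat \<Rightarrow> real \<Rightarrow> real" where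
  "taylor_monomial k i x = (if i \<le> k then x ^ (k - i) / fact (k - i) else 0)"

lemma taylor_monomial_deriv:
  "(taylor_monomial k i has_real_derivative taylor_monomial k (Suc i) x) (at x)"
proof (cases "Suc i \<le> k")
  case True
  then obtain m where m: "k - i = Suc m" "k - Suc i = m" by (metis Suc_diff_Suc Suc_le_lessD)
  have "((\<lambda>x. x ^ Suc m / fact (Suc m)) has_real_derivative (real (Suc m) * x ^ m / fact (Suc m))) (at x)"
    using DERIV_cdivide[OF DERIV_pow[of "Suc m" x], of "fact (Suc m)"] by (simp del: of_nat_Suc fact_Suc power_Suc)
  moreover have "real (Suc m) * x ^ m / fact (Suc m) = x ^ m / fact m"
    by (simp only: fact_Suc) (simp del: of_nat_Suc)
  ultimately show ?thesis using True m by (simp add: taylor_monomial_def[abs_def])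
next
  case False
  then have "taylor_monomial k i = (\<lambda>x. if i = k then 1 else 0)" by (auto simp: taylor_monomial_def)
  then show ?thesis using False by (simp add: taylor_monomial_def)
qed

lemma taylor_monomial_0: "taylor_monomial k i 0 = (if i = k then 1 else 0)"
  by (auto simp: taylor_monomial_def power_0_left)

text \<open>The partial derivative of index \<open>\<alpha>\<close> of the Taylor polynomial at \<open>p\<close> with the coefficients \<open>U\<close>.\<close>

definition jet_poly :: "nat \<Rightarrow> jet \<Rightarrow> plane \<Rightarrow> nat \<times> nat \<Rightarrow> plane \<Rightarrow> real" where
  "jet_poly n U p \<alpha> q = (\<Sum>\<beta> | deg \<beta> < n. U \<beta> *
     (taylor_monomial (fst \<beta>) (fst \<alpha>) (fst q - fst p) * taylor_monomial (snd \<beta>) (snd \<alpha>) (snd q - snd p)))"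

lemma jet_poly_center: "deg \<alpha> < n \<Longrightarrow> jet_poly n U p \<alpha> p = U \<alpha>"
proof -
  assume "deg \<alpha> < n"
  have "jet_poly n U p \<alpha> p = (\<Sum>\<beta> | deg \<beta> < n. if \<beta> = \<alpha> then U \<alpha> else 0)"
    unfolding jet_poly_def by (intro sum.cong) (auto simp: taylor_monomial_0 prod_eq_iff)
  then show ?thesis using \<open>deg \<alpha> < n\<close> finite_deg_less[of n] by simp
qed

lemma taylor_monomial_shift_derivative:
  "((\<lambda>q. taylor_monomial k i (fst q - c)) has_derivative
     (\<lambda>h. fst h * taylor_monomial k (Suc i) (fst q - c))) (at (q :: plane))"
  "((\<lambda>q. taylor_monomial k i (snd q - c)) has_derivative
     (\<lambda>h. snd h * taylor_monomial k (Suc i) (snd q - c))) (at (q :: plane))"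
proof -
  have f: "((\<lambda>q::plane. fst q - c) has_derivative fst) (at q)" "((\<lambda>q::plane. snd q - c) has_derivative snd) (at q)"
    by (auto intro!: derivative_eq_intros)
  show "((\<lambda>q. taylor_monomial k i (fst q - c)) has_derivative
     (\<lambda>h. fst h * taylor_monomial k (Suc i) (fst q - c))) (at (q :: plane))"
    using has_derivative_compose[OF f(1) taylor_monomial_deriv[unfolded has_field_derivative_def]]
    by (simp add: mult.commute)
  show "((\<lambda>q. taylor_monomial k i (snd q - c)) has_derivative
     (\<lambda>h. snd h * taylor_monomial k (Suc i) (snd q - c))) (at (q :: plane))"
    using has_derivative_compose[OF f(2) taylor_monomial_deriv[unfolded has_field_derivative_def]]
    by (simp add: mult.commute)
qed

lemma jet_poly_derivative:
  "(jet_poly n U p (i, j) has_derivative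
     (\<lambda>h. fst h * jet_poly n U p (Suc i, j) q + snd h * jet_poly n U p (i, Suc j) q)) (at q)"
proof -
  have "((\<lambda>q. jet_poly n U p (i, j) q) has_derivative (\<lambda>h. \<Sum>\<beta> | deg \<beta> < n. U \<beta> *
     (taylor_monomial (fst \<beta>) i (fst q - fst p) * (snd h * taylor_monomial (snd \<beta>) (Suc j) (snd q - snd p)) +
      (fst h * taylor_monomial (fst \<beta>) (Suc i) (fst q - fst p)) * taylor_monomial (snd \<beta>) j (snd q - snd p)))) (at q)"
    unfolding jet_poly_def fst_conv snd_conv
    by (intro has_derivative_sum has_derivative_mult_right has_derivative_mult taylor_monomial_shift_derivative)
  then show ?thesis
    by (simp add: jet_poly_def[abs_def] sum_distrib_left sum.distrib[symmetric] algebra_simps)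
qed

lemma jets2_jet_poly: "jets2 k UNIV (jet_poly n U p)"
  unfolding jets2_def
proof (intro conjI allI impI)
  fix i j :: nat
  show "continuous_on UNIV (jet_poly n U p (i, j))"
    by (rule has_derivative_continuous_on[OF has_derivative_at_withinI[OF jet_poly_derivative]])
qed (rule jet_poly_derivative)

text \<open>Functions of one linear coordinate are used to extend data from the interface to a neighbourhood.\<close>

lemma jets2_ridge:
  assumes "jets1 k I G" "\<And>q. q \<in> V \<Longrightarrow> fst (q - p) * a + snd (q - p) * b \<in> I"
  shows "jets2 k V (\<lambda>\<alpha> q. a ^ fst \<alpha> * b ^ snd \<alpha> * G (deg \<alpha>) (fst (q - p) * a + snd (q - p) * b))"
  unfolding jets2_def
proof (intro conjI allI impI)
  fix i j q assume *: "i + j < k" "q \<in> V"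
  have "((\<lambda>q. fst (q - p) * a + snd (q - p) * b) has_derivative (\<lambda>h. fst h * a + snd h * b)) (at q)"
    by (auto intro!: derivative_eq_intros)
  moreover have "(G (i + j) has_derivative (*) (G (Suc (i + j)) (fst (q - p) * a + snd (q - p) * b)))
      (at (fst (q - p) * a + snd (q - p) * b))"
    using jets1D[OF assms(1) *(1) assms(2)[OF *(2)]] by (simp add: has_field_derivative_def)
  ultimately have "((\<lambda>q. G (i + j) (fst (q - p) * a + snd (q - p) * b)) has_derivative
     (\<lambda>h. G (Suc (i + j)) (fst (q - p) * a + snd (q - p) * b) * (fst h * a + snd h * b))) (at q)"
    by (rule has_derivative_compose)
  from has_derivative_mult_right[OF this, of "a ^ i * b ^ j"]
  show "((\<lambda>q. a ^ fst (i, j) * b ^ snd (i, j) * G (deg (i, j)) (fst (q - p) * a + snd (q - p) * b)) has_derivative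
     (\<lambda>h. fst h * (a ^ fst (Suc i, j) * b ^ snd (Suc i, j) * G (deg (Suc i, j)) (fst (q - p) * a + snd (q - p) * b)) +
          snd h * (a ^ fst (i, Suc j) * b ^ snd (i, Suc j) * G (deg (i, Suc j)) (fst (q - p) * a + snd (q - p) * b)))) (at q)"
    by (simp add: algebra_simps)
next
  fix i j assume "i + j = k"
  have "continuous_on V (\<lambda>q. fst (q - p) * a + snd (q - p) * b)" by (intro continuous_intros)
  then have "continuous_on V (\<lambda>q. G k (fst (q - p) * a + snd (q - p) * b))"
    using jets1_continuous[OF assms(1) order_refl] assms(2)
    by (intro continuous_on_compose2[of I "G k" V]) auto
  then show "continuous_on V (\<lambda>q. a ^ fst (i, j) * b ^ snd (i, j) * G (deg (i, j)) (fst (q - p) * a + snd (q - p) * b))"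
    using \<open>i + j = k\<close> by (auto intro!: continuous_intros)
qed

section \<open>One-sided jets at the interface\<close>

definition problem_data :: "plane set \<Rightarrow> (plane \<Rightarrow> real) \<Rightarrow> plane \<Rightarrow> (plane \<Rightarrow> real) \<Rightarrow> (plane \<Rightarrow> real) \<Rightarrow>
    (plane \<Rightarrow> real) \<Rightarrow> (plane \<Rightarrow> real) \<Rightarrow> slot \<Rightarrow> jet" where
  "problem_data \<Omega> \<psi> p u f g\<^sub>D g\<^sub>N s = (case s of
     Uplus \<Rightarrow> (\<lambda>\<alpha>. side_lim (Omega_pos \<Omega> \<psi>) p (pd \<alpha> u))
   | Fplus \<Rightarrow> (\<lambda>\<alpha>. side_lim (Omega_pos \<Omega> \<psi>) p (pd \<alpha> f))
   | Fminus \<Rightarrow> (\<lambda>\<alpha>. side_lim (Omega_neg \<Omega> \<psi>) p (pd \<alpha> f))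
   | GDirichlet \<Rightarrow> (\<lambda>\<alpha>. pd \<alpha> g\<^sub>D p)
   | GNeumann \<Rightarrow> (\<lambda>\<alpha>. pd \<alpha> g\<^sub>N p))"

context interface_chart
begin

definition is_side :: "plane set \<Rightarrow> bool" where
  "is_side S \<longleftrightarrow> S = Omega_pos \<Omega> \<psi> \<or> S = Omega_neg \<Omega> \<psi>"

lemma is_side_pos: "is_side (Omega_pos \<Omega> \<psi>)" and is_side_neg: "is_side (Omega_neg \<Omega> \<psi>)"
  by (simp_all add: is_side_def)

lemma open_side: "is_side S \<Longrightarrow> open S"
proof -
  assume "is_side S"
  have c: "continuous_on \<Omega> \<psi>"
    using smooth Ck_on_mono[of k \<Omega> \<psi> 0] by (simp add: smooth_interface_def)
  have "Omega_pos \<Omega> \<psi> = \<psi> -` {0<..} \<inter> \<Omega>" "Omega_neg \<Omega> \<psi> = \<psi> -` {..<0} \<inter> \<Omega>"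
    by (auto simp: Omega_pos_def Omega_neg_def)
  moreover have "open (\<psi> -` {0<..} \<inter> \<Omega>)" "open (\<psi> -` {..<0} \<inter> \<Omega>)"
    using continuous_on_open_vimage[THEN iffD1, OF open_Omega c] open_greaterThan open_lessThan by blast+
  ultimately show ?thesis using \<open>is_side S\<close> by (auto simp: is_side_def)
qed

lemma Gamma_not_side: "is_side S \<Longrightarrow> q \<in> Gamma \<Omega> \<psi> \<Longrightarrow> q \<notin> S"
  by (auto simp: is_side_def Gamma_def Omega_pos_def Omega_neg_def)

lemma side_nontrivial:
  assumes "is_side S" "q \<in> Gamma \<Omega> \<psi>"
  shows "at q within S \<noteq> bot"
proof -
  have "q \<in> closure S" using assms smooth by (auto simp: is_side_def smooth_interface_def)
  then have "q islimpt S" using Gamma_not_side[OF assms] by (auto simp: closure_def)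
  then show ?thesis using trivial_limit_within by blast
qed

lemma side_limI:
  "is_side S \<Longrightarrow> q \<in> Gamma \<Omega> \<psi> \<Longrightarrow> (w \<longlongrightarrow> l) (at q within S) \<Longrightarrow> side_lim S q w = l"
  unfolding side_lim_def using side_nontrivial tendsto_Lim by blast

lemma side_lim_tendsto:
  assumes "is_side S" "q \<in> Gamma \<Omega> \<psi>" "Ck_upto m S (Gamma \<Omega> \<psi>) g" "deg \<alpha> \<le> m"
  shows "(pd \<alpha> g \<longlongrightarrow> side_lim S q (pd \<alpha> g)) (at q within S)"
proof -
  obtain l where "(pd \<alpha> g \<longlongrightarrow> l) (at q within S)"
    using assms(2-4) unfolding Ck_upto_def by (metis prod.collapse)
  then show ?thesis using side_limI[OF assms(1,2)] by simp
qed

lemma piecewise_side: "is_side S \<Longrightarrow> piecewise_Ck m \<Omega> \<psi> g \<Longrightarrow> Ck_upto m S (Gamma \<Omega> \<psi>) g"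
  by (auto simp: is_side_def piecewise_Ck_def)

text \<open>To show that \<open>g\<close> is regular up to the interface it suffices to exhibit its derivatives and their limits; this determines
the one-sided jets as well.\<close>

lemma Ck_upto_jets2:
  assumes "is_side S" "jets2 m S v" "\<And>q. q \<in> S \<Longrightarrow> g q = v (0, 0) q"
    and lim: "\<And>\<alpha> q. deg \<alpha> \<le> m \<Longrightarrow> q \<in> Gamma \<Omega> \<psi> \<Longrightarrow> (v \<alpha> \<longlongrightarrow> V \<alpha> q) (at q within S)"
  shows "Ck_upto m S (Gamma \<Omega> \<psi>) g"
    and "\<And>\<alpha> q. deg \<alpha> \<le> m \<Longrightarrow> q \<in> Gamma \<Omega> \<psi> \<Longrightarrow> side_lim S q (pd \<alpha> g) = V \<alpha> q"
proof -
  have *: "(pd \<alpha> g \<longlongrightarrow> V \<alpha> q) (at q within S)" if "deg \<alpha> \<le> m" "q \<in> Gamma \<Omega> \<psi>" for \<alpha> q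
  proof (rule Lim_transform_eventually[OF lim[OF that]])
    obtain i j where \<alpha>: "\<alpha> = (i, j)" by force
    have "\<forall>\<^sub>F z in at q within S. z \<in> S" by (simp add: eventually_at_filter)
    then show "\<forall>\<^sub>F z in at q within S. v \<alpha> z = pd \<alpha> g z"
      by eventually_elim (use jets2_imp_pd[OF open_side[OF assms(1)] assms(2,3)] that \<alpha> in auto)
  qed
  have "\<exists>l. (pd (i, j) g \<longlongrightarrow> l) (at q within S)" if "i + j \<le> m" "q \<in> Gamma \<Omega> \<psi>" for i j q
    using *[of "(i, j)" q] that by auto
  then show "Ck_upto m S (Gamma \<Omega> \<psi>) g"
    unfolding Ck_upto_def using jets2_imp_Ck_on[OF open_side[OF assms(1)] assms(2,3)] by blast
  show "\<And>\<alpha> q. deg \<alpha> \<le> m \<Longrightarrow> q \<in> Gamma \<Omega> \<psi> \<Longrightarrow> side_lim S q (pd \<alpha> g) = V \<alpha> q"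
    using side_limI[OF assms(1)] * by blast
qed

abbreviation rr :: "nat \<Rightarrow> real \<Rightarrow> real" where "rr j \<equiv> (deriv ^^ j) r"
abbreviation ss :: "nat \<Rightarrow> real \<Rightarrow> real" where "ss j \<equiv> (deriv ^^ j) s"
abbreviation side_jets :: "plane set \<Rightarrow> (plane \<Rightarrow> real) \<Rightarrow> real \<Rightarrow> jet" where
  "side_jets S g t \<equiv> (\<lambda>\<alpha>. side_lim S (\<gamma> t) (pd \<alpha> g))"

lemma gamma_eq: "p + (rr 0 t, ss 0 t) = \<gamma> t"
  by (simp add: chart_map_def)

text \<open>Near \<open>p\<close> each region lies on one side of the interface, so that the chain rule for one-sided limits applies to them.\<close>

lemma transversal:
  assumes "is_side S"
  obtains c where "transversal_curve S J rr ss p (c *\<^sub>R normal0 r s) \<eta>"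
proof -
  have g: "\<gamma> t + \<sigma> *\<^sub>R (c *\<^sub>R normal0 r s) = chart_map p r s t (\<sigma> * c)" for t \<sigma> c
    by (simp add: chart_map_def)
  have "transversal_curve S J rr ss p (c *\<^sub>R normal0 r s) \<eta>"
    if c: "c = 1 \<or> c = - 1" and side: "\<And>t \<sigma>. t \<in> J \<Longrightarrow> 0 < \<sigma> \<Longrightarrow> \<sigma> < \<eta> \<Longrightarrow> chart_map p r s t (\<sigma> * c) \<in> S" for c
    unfolding transversal_curve_def gamma_eq g
    using eta r_deriv s_deriv side Gamma_not_side[OF assms gamma_Gamma]
      jets1_continuous[OF r_jets k] jets1_continuous[OF s_jets k] by auto
  moreover have "chart_map p r s t (\<sigma> * \<kappa>) \<in> Omega_pos \<Omega> \<psi>" "chart_map p r s t (\<sigma> * - \<kappa>) \<in> Omega_neg \<Omega> \<psi>"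
    if "t \<in> J" "0 < \<sigma>" "\<sigma> < \<eta>" for t \<sigma>
    using that kappa chart_Omega_pos[of t "\<sigma> * \<kappa>"] chart_Omega_neg[of t "\<sigma> * - \<kappa>"] by auto
  moreover have "- \<kappa> = 1 \<or> - \<kappa> = - 1" using kappa by auto
  ultimately show ?thesis using that kappa assms unfolding is_side_def by metis
qed

lemma chain_jets_side:
  assumes "is_side S" "jets2 m S v" "\<And>\<alpha> t. deg \<alpha> \<le> m \<Longrightarrow> t \<in> J \<Longrightarrow> (v \<alpha> \<longlongrightarrow> V \<alpha> t) (at (\<gamma> t) within S)"
  shows "chain_jets m J rr ss V"
proof -
  obtain c where c: "transversal_curve S J rr ss p (c *\<^sub>R normal0 r s) \<eta>" using transversal[OF assms(1)] .
  then interpret tc: transversal_curve S J rr ss p "c *\<^sub>R normal0 r s" \<eta> .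
  show ?thesis
    by (rule tc.chain_jets_trace[OF assms(2)]) (use assms(3) in \<open>simp add: tc.\<gamma>_def gamma_eq[simplified]\<close>)
qed

lemma chain_jets_trace_side:
  assumes "is_side S" "Ck_upto m S (Gamma \<Omega> \<psi>) g"
  shows "chain_jets m J rr ss (\<lambda>\<alpha> t. side_jets S g t \<alpha>)"
proof (rule chain_jets_side[OF assms(1)])
  show "jets2 m S (\<lambda>\<alpha>. pd \<alpha> g)"
    using assms(2) by (intro jets2_pd open_side assms(1)) (simp add: Ck_upto_def)
  show "(pd \<alpha> g \<longlongrightarrow> side_jets S g t \<alpha>) (at (\<gamma> t) within S)" if "deg \<alpha> \<le> m" "t \<in> J" for \<alpha> t
    by (rule side_lim_tendsto[OF assms(1) gamma_Gamma[OF that(2)] assms(2) that(1)])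
qed

lemma curve_sequence:
  assumes "chain_jets m I rr ss V" "m \<le> k" "I \<subseteq> J"
  shows "jets1 m I (\<lambda>l t. curve_jets (\<lambda>j. rr j t) (\<lambda>j. ss j t) (\<lambda>\<beta>. V \<beta> t) l (0, 0))"
  by (rule chain_jets_curve_jets[OF assms(1) jets1_mono[OF jets1_subset[OF r_jets assms(3)] assms(2)]
      jets1_mono[OF jets1_subset[OF s_jets assms(3)] assms(2)]]) simp

lemma jet_poly_side:
  assumes "is_side S" "\<And>q. q \<in> S \<Longrightarrow> u q = jet_poly n U p (0, 0) q"
  shows "Ck_upto m S (Gamma \<Omega> \<psi>) u"
    and "q \<in> Gamma \<Omega> \<psi> \<Longrightarrow> side_lim S q (pd \<alpha> u) = jet_poly n U p \<alpha> q"
proof -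
  have lim: "(jet_poly n U p \<alpha> \<longlongrightarrow> jet_poly n U p \<alpha> q) (at q within S)" for \<alpha> q
  proof -
    have "continuous (at q) (jet_poly n U p (fst \<alpha>, snd \<alpha>))"
      by (rule has_derivative_continuous[OF jet_poly_derivative])
    then have "continuous (at q) (jet_poly n U p \<alpha>)" by simp
    then show ?thesis
      using continuous_at_imp_continuous_at_within continuous_within by blast
  qed
  note * = Ck_upto_jets2[OF assms(1) jets2_subset[OF jets2_jet_poly subset_UNIV] assms(2) lim]
  show "Ck_upto m S (Gamma \<Omega> \<psi>) u" by (rule *(1)) auto
  show "q \<in> Gamma \<Omega> \<psi> \<Longrightarrow> side_lim S q (pd \<alpha> u) = jet_poly n U p \<alpha> q"
    by (rule *(2)[OF _ order_refl])
qed

end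

section \<open>The interface problem and its jets\<close>

locale interface_point = interface_chart "Suc M" \<Omega> \<psi> p r s \<delta> \<eta> \<kappa>
  for M :: nat and \<Omega> \<psi> p r s \<delta> \<eta> \<kappa> +
  fixes a :: "plane \<Rightarrow> real"
  assumes M: "M > 0" and a_Ck: "piecewise_Ck M \<Omega> \<psi> a" and a_pos: "positive_coefficient \<Omega> \<psi> a"
begin

text \<open>With \<open>flux2\<close>, the partial derivatives of the two components of \<open>a grad u\<close>.\<close>

definition flux1 :: "(plane \<Rightarrow> real) \<Rightarrow> nat \<times> nat \<Rightarrow> plane \<Rightarrow> real" where
  "flux1 u = (\<lambda>\<alpha> q. leib2 (\<lambda>\<beta>. pd \<beta> a q) (jet_dx (\<lambda>\<beta>. pd \<beta> u q)) \<alpha>)"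

definition flux2 :: "(plane \<Rightarrow> real) \<Rightarrow> nat \<times> nat \<Rightarrow> plane \<Rightarrow> real" where
  "flux2 u = (\<lambda>\<alpha> q. leib2 (\<lambda>\<beta>. pd \<beta> a q) (jet_dy (\<lambda>\<beta>. pd \<beta> u q)) \<alpha>)"

lemma flux_0: "flux1 u (0, 0) q = a q * px u q" "flux2 u (0, 0) q = a q * py u q"
  by (simp_all add: flux1_def flux2_def leib2_def jet_dx_def jet_dy_def pd_def)

context
  fixes S u
  assumes S: "is_side S" and u: "Ck_upto (Suc M) S (Gamma \<Omega> \<psi>) u"
begin

lemma jets2_flux: "jets2 M S (flux1 u)" "jets2 M S (flux2 u)"
proof -
  have "jets2 M S (\<lambda>\<alpha>. pd \<alpha> a)"
    using piecewise_side[OF S a_Ck] by (intro jets2_pd open_side S) (simp add: Ck_upto_def)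
  moreover have "jets2 (Suc M) S (\<lambda>\<alpha>. pd \<alpha> u)"
    using u by (intro jets2_pd open_side S) (simp add: Ck_upto_def del: Ck_on.simps)
  ultimately show "jets2 M S (flux1 u)" "jets2 M S (flux2 u)"
    unfolding flux1_def flux2_def
    using jets2_leib2[OF _ jets2_dx, of M S] jets2_leib2[OF _ jets2_dy, of M S] by blast+
qed

lemma flux_limits:
  assumes "deg \<alpha> \<le> M" "q \<in> Gamma \<Omega> \<psi>"
  shows "(flux1 u \<alpha> \<longlongrightarrow> leib2 (\<lambda>\<beta>. side_lim S q (pd \<beta> a)) (jet_dx (\<lambda>\<beta>. side_lim S q (pd \<beta> u))) \<alpha>) (at q within S)"
    "(flux2 u \<alpha> \<longlongrightarrow> leib2 (\<lambda>\<beta>. side_lim S q (pd \<beta> a)) (jet_dy (\<lambda>\<beta>. side_lim S q (pd \<beta> u))) \<alpha>) (at q within S)"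
proof -
  have A: "(pd \<beta> a \<longlongrightarrow> side_lim S q (pd \<beta> a)) (at q within S)" if "deg \<beta> \<le> deg \<alpha>" for \<beta>
    using side_lim_tendsto[OF S assms(2) piecewise_side[OF S a_Ck]] that assms(1) by simp
  have U: "((\<lambda>z. jet_dx (\<lambda>\<beta>. pd \<beta> u z) \<beta>) \<longlongrightarrow> jet_dx (\<lambda>\<beta>. side_lim S q (pd \<beta> u)) \<beta>) (at q within S)"
    "((\<lambda>z. jet_dy (\<lambda>\<beta>. pd \<beta> u z) \<beta>) \<longlongrightarrow> jet_dy (\<lambda>\<beta>. side_lim S q (pd \<beta> u)) \<beta>) (at q within S)"
    if "deg \<beta> \<le> deg \<alpha>" for \<beta>
    using side_lim_tendsto[OF S assms(2) u, of "(Suc (fst \<beta>), snd \<beta>)"]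
      side_lim_tendsto[OF S assms(2) u, of "(fst \<beta>, Suc (snd \<beta>))"] that assms(1)
    by (auto simp: jet_dx_def jet_dy_def case_prod_unfold)
  show "(flux1 u \<alpha> \<longlongrightarrow> leib2 (\<lambda>\<beta>. side_lim S q (pd \<beta> a)) (jet_dx (\<lambda>\<beta>. side_lim S q (pd \<beta> u))) \<alpha>) (at q within S)"
    unfolding flux1_def by (rule leib2_tendsto[OF A U(1)])
  show "(flux2 u \<alpha> \<longlongrightarrow> leib2 (\<lambda>\<beta>. side_lim S q (pd \<beta> a)) (jet_dy (\<lambda>\<beta>. side_lim S q (pd \<beta> u))) \<alpha>) (at q within S)"
    unfolding flux2_def by (rule leib2_tendsto[OF A U(2)])
qed

lemma div_flux_eq:
  assumes "q \<in> S"
  shows "div_flux a u q = pde_jet (\<lambda>\<beta>. pd \<beta> a q) (\<lambda>\<beta>. pd \<beta> u q) (0, 0)"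
proof -
  have "px (flux1 u (0, 0)) q = flux1 u (1, 0) q" "py (flux2 u (0, 0)) q = flux2 u (0, 1) q"
    using px_py_eqI(1)[OF jets2D[OF jets2_flux(1), of 0 0 q]] px_py_eqI(2)[OF jets2D[OF jets2_flux(2), of 0 0 q]]
      assms M by auto
  moreover have "flux1 u (0, 0) = (\<lambda>z. a z * px u z)" "flux2 u (0, 0) = (\<lambda>z. a z * py u z)"
    by (simp_all add: fun_eq_iff flux_0)
  ultimately have "div_flux a u q = flux1 u (1, 0) q + flux2 u (0, 1) q"
    by (simp add: div_flux_def)
  then show ?thesis
    by (simp add: pde_jet_def flux1_def flux2_def)
qed

text \<open>The right-hand side inherits its regularity and its jets from \<open>u\<close> and \<open>a\<close>. This turns the equation into conditions on
the jets of a given solution, and it also shows that a piecewise polynomial \<open>u\<close> has an admissible right-hand side.\<close>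

lemma source_regular:
  assumes "\<And>q. q \<in> S \<Longrightarrow> f q = - div_flux a u q"
  shows "Ck_upto (M - 1) S (Gamma \<Omega> \<psi>) f"
    and "\<And>\<alpha> q. deg \<alpha> \<le> M - 1 \<Longrightarrow> q \<in> Gamma \<Omega> \<psi> \<Longrightarrow> side_lim S q (pd \<alpha> f) =
      - pde_jet (\<lambda>\<beta>. side_lim S q (pd \<beta> a)) (\<lambda>\<beta>. side_lim S q (pd \<beta> u)) \<alpha>"
proof -
  define v where "v = (\<lambda>\<alpha> q. (-1) * jet_dx (\<lambda>\<beta>. flux1 u \<beta> q) \<alpha> + (-1) * jet_dy (\<lambda>\<beta>. flux2 u \<beta> q) \<alpha>)"
  have SM: "Suc (M - 1) = M" using M by simp
  have v_jets: "jets2 (M - 1) S v"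
    unfolding v_def using jets2_flux SM by (intro jets2_comb jets2_dx jets2_dy) auto
  have v_eq: "v \<alpha> q = - pde_jet (\<lambda>\<beta>. pd \<beta> a q) (\<lambda>\<beta>. pd \<beta> u q) \<alpha>" for \<alpha> q
    by (cases \<alpha>) (simp add: v_def pde_jet_def jet_dx_apply jet_dy_apply flux1_def flux2_def)
  have lim: "(v \<alpha> \<longlongrightarrow> - pde_jet (\<lambda>\<beta>. side_lim S q (pd \<beta> a)) (\<lambda>\<beta>. side_lim S q (pd \<beta> u)) \<alpha>) (at q within S)"
    if "deg \<alpha> \<le> M - 1" "q \<in> Gamma \<Omega> \<psi>" for \<alpha> q
  proof -
    obtain i j where \<alpha>: "\<alpha> = (i, j)" by force
    have "deg (Suc i, j) \<le> M" "deg (i, Suc j) \<le> M" using that \<alpha> SM by auto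
    from tendsto_minus[OF tendsto_add[OF flux_limits(1)[OF this(1) that(2)] flux_limits(2)[OF this(2) that(2)]]]
    show ?thesis by (simp add: \<alpha> v_def pde_jet_def jet_dx_apply jet_dy_apply)
  qed
  have f0: "f q = v (0, 0) q" if "q \<in> S" for q
    using assms[OF that] div_flux_eq[OF that] by (simp add: v_eq)
  show "Ck_upto (M - 1) S (Gamma \<Omega> \<psi>) f"
    by (rule Ck_upto_jets2(1)[OF S v_jets f0 lim])
  show "\<And>\<alpha> q. deg \<alpha> \<le> M - 1 \<Longrightarrow> q \<in> Gamma \<Omega> \<psi> \<Longrightarrow> side_lim S q (pd \<alpha> f) =
      - pde_jet (\<lambda>\<beta>. side_lim S q (pd \<beta> a)) (\<lambda>\<beta>. side_lim S q (pd \<beta> u)) \<alpha>"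
    by (rule Ck_upto_jets2(2)[OF S v_jets f0 lim])
qed

lemma flux_sequence:
  "jets1 M J (\<lambda>l t. flux_jet (\<lambda>j. rr j t) (\<lambda>j. ss j t) (side_jets S a t) (side_jets S u t) l)"
proof -
  have c: "chain_jets M J rr ss (\<lambda>\<alpha> t. leib2 (side_jets S a t) (jet_dx (side_jets S u t)) \<alpha>)"
    "chain_jets M J rr ss (\<lambda>\<alpha> t. leib2 (side_jets S a t) (jet_dy (side_jets S u t)) \<alpha>)"
    using chain_jets_side[OF S jets2_flux(1) flux_limits(1)] chain_jets_side[OF S jets2_flux(2) flux_limits(2)]
      gamma_Gamma by blast+
  have "jets1 M J (\<lambda>l t.
      1 * leib (\<lambda>m. curve_jets (\<lambda>j. rr j t) (\<lambda>j. ss j t) (leib2 (side_jets S a t) (jet_dx (side_jets S u t))) m (0, 0))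
        (\<lambda>m. ss (Suc m) t) l +
      (-1) * leib (\<lambda>m. curve_jets (\<lambda>j. rr j t) (\<lambda>j. ss j t) (leib2 (side_jets S a t) (jet_dy (side_jets S u t))) m (0, 0))
        (\<lambda>m. rr (Suc m) t) l)"
    using curve_sequence[OF c(1)] curve_sequence[OF c(2)] r_jets s_jets
    by (intro jets1_comb jets1_leib) (auto simp: jets1_Suc)
  then show ?thesis
    by (simp add: flux_jet_def leib_def sum_subtractf[symmetric] algebra_simps)
qed

lemma normal_flux_limit:
  assumes "t \<in> J"
  shows "side_lim S (\<gamma> t) (\<lambda>z. (a z *\<^sub>R grad u z) \<bullet> unit_normal \<Omega> \<psi> (\<gamma> t)) =
    \<kappa> / speed t * flux_jet (\<lambda>j. rr j t) (\<lambda>j. ss j t) (side_jets S a t) (side_jets S u t) 0"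
proof (rule side_limI[OF S gamma_Gamma[OF assms]])
  have "((\<lambda>z. \<kappa> / speed t * (deriv s t * flux1 u (0, 0) z - deriv r t * flux2 u (0, 0) z)) \<longlongrightarrow>
     \<kappa> / speed t * (deriv s t * leib2 (side_jets S a t) (jet_dx (side_jets S u t)) (0, 0) -
       deriv r t * leib2 (side_jets S a t) (jet_dy (side_jets S u t)) (0, 0))) (at (\<gamma> t) within S)"
    by (intro tendsto_intros flux_limits gamma_Gamma assms) auto
  then show "((\<lambda>z. (a z *\<^sub>R grad u z) \<bullet> unit_normal \<Omega> \<psi> (\<gamma> t)) \<longlongrightarrow>
    \<kappa> / speed t * flux_jet (\<lambda>j. rr j t) (\<lambda>j. ss j t) (side_jets S a t) (side_jets S u t) 0) (at (\<gamma> t) within S)"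
    unfolding unit_normal_chart[OF assms]
    by (simp add: flux_jet_def flux_0 grad_def algebra_simps)
qed

end

lemma rr_Suc_jets: "jets1 M J (\<lambda>j. rr (Suc j))" and ss_Suc_jets: "jets1 M J (\<lambda>j. ss (Suc j))"
  using r_jets s_jets by (simp_all add: jets1_Suc)

lemma speed_sequence:
  obtains L where "jets1 M J L" "\<And>t. t \<in> J \<Longrightarrow> L 0 t = speed t"
    "\<And>j. j \<le> M \<Longrightarrow> L j 0 = speed_jets (\<lambda>j. rr j 0) (\<lambda>j. ss j 0) j"
proof -
  define Q where "Q = (\<lambda>j t. 1 * leib (\<lambda>l. rr (Suc l) t) (\<lambda>l. rr (Suc l) t) j +
    1 * leib (\<lambda>l. ss (Suc l) t) (\<lambda>l. ss (Suc l) t) j)"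
  have Q: "jets1 M J Q" unfolding Q_def by (intro jets1_comb jets1_leib rr_Suc_jets ss_Suc_jets)
  have Q0: "Q 0 t = (deriv r t)\<^sup>2 + (deriv s t)\<^sup>2" for t
    by (simp add: Q_def leib_def power2_eq_square)
  obtain L where L: "jets1 M J L" "\<forall>t\<in>J. L 0 t = Q 0 t powr (1 / 2)"
    using jets1_powr[OF Q, of "1 / 2"] Q0 regular by auto
  have L0: "L 0 t = speed t" if "t \<in> J" for t
    using L(2) that regular[OF that] by (simp add: Q0 powr_half_sqrt speed_def)
  have LL: "leib (\<lambda>l. L l 0) (\<lambda>l. L l 0) j = Q j 0" if "j \<le> M" for j
  proof (rule jets1_unique[OF _ jets1_leib[OF L(1) L(1)] Q _ that zero_in_J])
    fix t assume t: "t \<in> J"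
    show "leib (\<lambda>l. L l t) (\<lambda>l. L l t) 0 = Q 0 t"
      using L0[OF t] regular[OF t] by (simp add: leib_def Q0 speed_def power2_eq_square[symmetric])
  qed simp
  have "L j 0 = speed_jets (\<lambda>j. rr j 0) (\<lambda>j. ss j 0) j" if "j \<le> M" for j
  proof (rule speed_jets_unique[where L = "\<lambda>l. L l 0" and m = M])
    show "L 0 0 > 0" using L0 speed_pos zero_in_J by simp
    show "leib (\<lambda>l. L l 0) (\<lambda>l. L l 0) i = leib (\<lambda>l. rr (Suc l) 0) (\<lambda>l. rr (Suc l) 0) i +
      leib (\<lambda>l. ss (Suc l) 0) (\<lambda>l. ss (Suc l) 0) i" if "i \<le> M" for i
      using LL[OF that] by (simp add: Q_def)
  qed fact
  then show ?thesis using that L(1) L0 by blast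
qed

abbreviation Rj :: "nat \<Rightarrow> real" where "Rj \<equiv> \<lambda>j. rr j 0"
abbreviation Sj :: "nat \<Rightarrow> real" where "Sj \<equiv> \<lambda>j. ss j 0"
abbreviation Apj :: jet where "Apj \<equiv> \<lambda>\<alpha>. side_lim (Omega_pos \<Omega> \<psi>) p (pd \<alpha> a)"
abbreviation Amj :: jet where "Amj \<equiv> \<lambda>\<alpha>. side_lim (Omega_neg \<Omega> \<psi>) p (pd \<alpha> a)"

lemma p_Gamma: "p \<in> Gamma \<Omega> \<psi>" using gamma_Gamma[OF zero_in_J] gamma_0 by simp

lemma nondegenerate: "nondegenerate_jets Rj Sj Apj Amj"
proof
  have "pd (0, 0) a = a" by (simp add: pd_def)
  then show "Apj (0, 0) \<noteq> 0" "Amj (0, 0) \<noteq> 0"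
    using a_pos p_Gamma by (auto simp: positive_coefficient_def)
  show "(Rj 1)\<^sup>2 + (Sj 1)\<^sup>2 > 0" using regular0 by simp
qed

lemma jump_trace: "jump \<Omega> \<psi> (\<gamma> t) u = side_jets (Omega_pos \<Omega> \<psi>) u t (0, 0) - side_jets (Omega_neg \<Omega> \<psi>) u t (0, 0)"
  by (simp add: jump_def pd_def)

lemma jump_flux:
  assumes "piecewise_Ck (Suc M) \<Omega> \<psi> u" "t \<in> J"
  shows "jump \<Omega> \<psi> (\<gamma> t) (\<lambda>z. (a z *\<^sub>R grad u z) \<bullet> unit_normal \<Omega> \<psi> (\<gamma> t)) = \<kappa> / speed t *
    (flux_jet (\<lambda>j. rr j t) (\<lambda>j. ss j t) (side_jets (Omega_pos \<Omega> \<psi>) a t) (side_jets (Omega_pos \<Omega> \<psi>) u t) 0 -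
     flux_jet (\<lambda>j. rr j t) (\<lambda>j. ss j t) (side_jets (Omega_neg \<Omega> \<psi>) a t) (side_jets (Omega_neg \<Omega> \<psi>) u t) 0)"
  using normal_flux_limit[OF is_side_pos piecewise_side[OF is_side_pos assms(1)] assms(2)]
    normal_flux_limit[OF is_side_neg piecewise_side[OF is_side_neg assms(1)] assms(2)]
  by (simp add: jump_def right_diff_distrib)

text \<open>The \<open>l\<close>-th derivative of the jump of \<open>u\<close> along the interface.\<close>

definition dirichlet_jump :: "(plane \<Rightarrow> real) \<Rightarrow> nat \<Rightarrow> real \<Rightarrow> real" where
  "dirichlet_jump u l t =
     curve_jets (\<lambda>j. rr j t) (\<lambda>j. ss j t) (side_jets (Omega_pos \<Omega> \<psi>) u t) l (0, 0) -
     curve_jets (\<lambda>j. rr j t) (\<lambda>j. ss j t) (side_jets (Omega_neg \<Omega> \<psi>) u t) l (0, 0)"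

text \<open>The \<open>l\<close>-th derivative of the jump of the flux along the interface, for the normal vector \<open>(s', - r')\<close>.\<close>

definition neumann_jump :: "(plane \<Rightarrow> real) \<Rightarrow> nat \<Rightarrow> real \<Rightarrow> real" where
  "neumann_jump u l t =
     flux_jet (\<lambda>j. rr j t) (\<lambda>j. ss j t) (side_jets (Omega_pos \<Omega> \<psi>) a t) (side_jets (Omega_pos \<Omega> \<psi>) u t) l -
     flux_jet (\<lambda>j. rr j t) (\<lambda>j. ss j t) (side_jets (Omega_neg \<Omega> \<psi>) a t) (side_jets (Omega_neg \<Omega> \<psi>) u t) l"

lemma jump_sequences:
  assumes "piecewise_Ck (Suc M) \<Omega> \<psi> u"
  shows "jets1 (Suc M) J (dirichlet_jump u)" "jets1 M J (neumann_jump u)"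
proof -
  note Ck = piecewise_side[OF is_side_pos assms] piecewise_side[OF is_side_neg assms]
  show "jets1 (Suc M) J (dirichlet_jump u)"
    using jets1_comb[OF curve_sequence[OF chain_jets_trace_side[OF is_side_pos Ck(1)]]
        curve_sequence[OF chain_jets_trace_side[OF is_side_neg Ck(2)]], of 1 "-1"]
    by (simp add: dirichlet_jump_def[abs_def])
  show "jets1 M J (neumann_jump u)"
    using jets1_comb[OF flux_sequence[OF is_side_pos Ck(1)] flux_sequence[OF is_side_neg Ck(2)], of 1 "-1"]
    by (simp add: neumann_jump_def[abs_def])
qed

lemma datum_sequence:
  assumes "open U" "p \<in> U" "Ck_on m U g" "m \<le> Suc M"
  obtains d where "0 < d" "d \<le> \<delta>" "\<And>t. t \<in> {-d<..<d} \<Longrightarrow> \<gamma> t \<in> U"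
    "jets1 m {-d<..<d} (\<lambda>l t. curve_jets (\<lambda>j. rr j t) (\<lambda>j. ss j t) (\<lambda>\<alpha>. pd \<alpha> g (\<gamma> t)) l (0, 0))"
proof -
  have "continuous_on J (\<lambda>t. p + (rr 0 t, ss 0 t))"
    using jets1_continuous[OF r_jets, of 0] jets1_continuous[OF s_jets, of 0] by (intro continuous_intros) auto
  then have "continuous_on J \<gamma>" by (simp add: gamma_eq[simplified])
  then have "open (\<gamma> -` U \<inter> J)"
    using continuous_on_open_vimage[OF open_greaterThanLessThan] assms(1) by metis
  moreover have "0 \<in> \<gamma> -` U \<inter> J" using zero_in_J gamma_0 assms(2) by simp
  ultimately obtain e where e: "e > 0" "ball 0 e \<subseteq> \<gamma> -` U \<inter> J" using openE by blast
  define d where "d = min e \<delta>"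
  have d: "0 < d" "d \<le> \<delta>" using e(1) delta by (auto simp: d_def)
  have U: "\<gamma> t \<in> U" if "t \<in> {-d<..<d}" for t
  proof -
    have "t \<in> ball 0 e" using that by (auto simp: d_def dist_real_def)
    then show ?thesis using e(2) by blast
  qed
  have sub: "{-d<..<d} \<subseteq> J" using d by auto
  have "chain_jets m {-d<..<d} rr ss (\<lambda>\<alpha> t. pd \<alpha> g (p + (rr 0 t, ss 0 t)))"
  proof (rule chain_jets_compose[OF jets2_pd[OF assms(1,3)]])
    fix t assume t: "t \<in> {-d<..<d}"
    then have tJ: "t \<in> J" using sub by blast
    show "p + (rr 0 t, ss 0 t) \<in> U" using U[OF t] by (simp only: gamma_eq)
    show "(rr 0 has_real_derivative rr 1 t) (at t)" "(ss 0 has_real_derivative ss 1 t) (at t)"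
      using r_deriv[OF tJ] s_deriv[OF tJ] by simp_all
  qed
  then have "chain_jets m {-d<..<d} rr ss (\<lambda>\<alpha> t. pd \<alpha> g (\<gamma> t))" by (simp only: gamma_eq)
  from curve_sequence[OF this assms(4) sub] show ?thesis using that d U by blast
qed

text \<open>Each jump condition is an equality of two functions of the curve parameter. Both sides have explicit sequences of
derivatives, and these agree at \<open>0\<close>.\<close>

theorem interface_problem_jet_system:
  assumes "interface_problem M \<Omega> \<psi> a p u f g\<^sub>D g\<^sub>N"
  shows "jet_system (Suc (Suc M)) Rj Sj Apj Amj \<kappa> (problem_data \<Omega> \<psi> p u f g\<^sub>D g\<^sub>N)
    (\<lambda>\<alpha>. side_lim (Omega_pos \<Omega> \<psi>) p (pd \<alpha> u)) (\<lambda>\<alpha>. side_lim (Omega_neg \<Omega> \<psi>) p (pd \<alpha> u))"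
  unfolding jet_system_def
proof (intro conjI allI impI)
  have u: "piecewise_Ck (Suc M) \<Omega> \<psi> u" and f: "\<And>q. q \<in> \<Omega> - Gamma \<Omega> \<psi> \<Longrightarrow> f q = - div_flux a u q"
    and jumps: "\<And>q. q \<in> Gamma \<Omega> \<psi> \<Longrightarrow> jump \<Omega> \<psi> q u = g\<^sub>D q"
      "\<And>q. q \<in> Gamma \<Omega> \<psi> \<Longrightarrow> jump \<Omega> \<psi> q (\<lambda>z. (a z *\<^sub>R grad u z) \<bullet> unit_normal \<Omega> \<psi> q) = g\<^sub>N q"
    using assms unfolding interface_problem_def by (simp_all del: Ck_on.simps)
  obtain U where U: "open U" "p \<in> U" "Ck_on (Suc M) U g\<^sub>D" "Ck_on M U g\<^sub>N"
    using assms unfolding interface_problem_def by (auto simp del: Ck_on.simps)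
  note Ck = piecewise_side[OF is_side_pos u] piecewise_side[OF is_side_neg u]
  {
    fix \<alpha> :: "nat \<times> nat"
    show "side_lim (Omega_pos \<Omega> \<psi>) p (pd \<alpha> u) = problem_data \<Omega> \<psi> p u f g\<^sub>D g\<^sub>N Uplus \<alpha>"
      by (simp add: problem_data_def)
    assume "deg \<alpha> + 2 < Suc (Suc M)"
    then have \<alpha>: "deg \<alpha> \<le> M - 1" by simp
    have fs: "f q = - div_flux a u q" if "is_side S" "q \<in> S" for q S
      using that by (intro f) (auto simp: is_side_def Omega_pos_def Omega_neg_def Gamma_def)
    show "pde_jet Apj (\<lambda>\<alpha>. side_lim (Omega_pos \<Omega> \<psi>) p (pd \<alpha> u)) \<alpha> = - problem_data \<Omega> \<psi> p u f g\<^sub>D g\<^sub>N Fplus \<alpha>"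
      using source_regular(2)[OF is_side_pos Ck(1) fs[OF is_side_pos] \<alpha> p_Gamma] by (simp add: problem_data_def)
    show "pde_jet Amj (\<lambda>\<alpha>. side_lim (Omega_neg \<Omega> \<psi>) p (pd \<alpha> u)) \<alpha> = - problem_data \<Omega> \<psi> p u f g\<^sub>D g\<^sub>N Fminus \<alpha>"
      using source_regular(2)[OF is_side_neg Ck(2) fs[OF is_side_neg] \<alpha> p_Gamma] by (simp add: problem_data_def)
  }
  {
    fix l assume l: "l < Suc (Suc M)"
    obtain d where d: "0 < d" "d \<le> \<delta>" "\<And>t. t \<in> {-d<..<d} \<Longrightarrow> \<gamma> t \<in> U"
      and seq: "jets1 (Suc M) {-d<..<d} (\<lambda>l t. curve_jets (\<lambda>j. rr j t) (\<lambda>j. ss j t) (\<lambda>\<alpha>. pd \<alpha> g\<^sub>D (\<gamma> t)) l (0, 0))"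
      using datum_sequence[OF U(1-3) order_refl] by blast
    have sub: "{-d<..<d} \<subseteq> J" using d by auto
    have "dirichlet_jump u l 0 = curve_jets Rj Sj (\<lambda>\<alpha>. pd \<alpha> g\<^sub>D (\<gamma> 0)) l (0, 0)"
    proof (rule jets1_unique[OF _ jets1_subset[OF jump_sequences(1)[OF u] sub] seq])
      fix t assume "t \<in> {-d<..<d}"
      then have "t \<in> J" using sub by blast
      from jumps(1)[OF gamma_Gamma[OF this]]
      show "dirichlet_jump u 0 t = curve_jets (\<lambda>j. rr j t) (\<lambda>j. ss j t) (\<lambda>\<alpha>. pd \<alpha> g\<^sub>D (\<gamma> t)) 0 (0, 0)"
        by (simp add: dirichlet_jump_def jump_trace pd_def)
    qed (use l d in auto)
    then show "curve_jets Rj Sj (\<lambda>\<alpha>. side_lim (Omega_pos \<Omega> \<psi>) p (pd \<alpha> u)) l (0, 0) -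
      curve_jets Rj Sj (\<lambda>\<alpha>. side_lim (Omega_neg \<Omega> \<psi>) p (pd \<alpha> u)) l (0, 0) =
      curve_jets Rj Sj (problem_data \<Omega> \<psi> p u f g\<^sub>D g\<^sub>N GDirichlet) l (0, 0)"
      by (simp add: dirichlet_jump_def gamma_0 problem_data_def)
  }
  {
    fix l assume l: "Suc l < Suc (Suc M)"
    obtain d where d: "0 < d" "d \<le> \<delta>" "\<And>t. t \<in> {-d<..<d} \<Longrightarrow> \<gamma> t \<in> U"
      and seq: "jets1 M {-d<..<d} (\<lambda>l t. curve_jets (\<lambda>j. rr j t) (\<lambda>j. ss j t) (\<lambda>\<alpha>. pd \<alpha> g\<^sub>N (\<gamma> t)) l (0, 0))"
      using datum_sequence[OF U(1,2,4) le_SucI[OF order_refl]] by blast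
    have sub: "{-d<..<d} \<subseteq> J" using d by auto
    obtain L where L: "jets1 M J L" "\<And>t. t \<in> J \<Longrightarrow> L 0 t = speed t"
      "\<And>j. j \<le> M \<Longrightarrow> L j 0 = speed_jets Rj Sj j"
      using speed_sequence by blast
    define G where "G = (\<lambda>l t. \<kappa> * leib (\<lambda>i. L i t)
        (\<lambda>i. curve_jets (\<lambda>j. rr j t) (\<lambda>j. ss j t) (\<lambda>\<alpha>. pd \<alpha> g\<^sub>N (\<gamma> t)) i (0, 0)) l + 0 * L l t)"
    have G: "jets1 M {-d<..<d} G"
      unfolding G_def by (intro jets1_comb jets1_leib jets1_subset[OF L(1) sub] seq)
    have "neumann_jump u l 0 = G l 0"
    proof (rule jets1_unique[OF _ jets1_subset[OF jump_sequences(2)[OF u] sub] G])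
      fix t assume "t \<in> {-d<..<d}"
      then have t: "t \<in> J" using sub by blast
      have "\<kappa> / speed t * neumann_jump u 0 t = g\<^sub>N (\<gamma> t)"
        using jumps(2)[OF gamma_Gamma[OF t]] jump_flux[OF u t] by (simp add: neumann_jump_def)
      then have "neumann_jump u 0 t = \<kappa> * (speed t * g\<^sub>N (\<gamma> t))"
        using kappa speed_pos[OF t] by (auto simp: field_simps)
      then show "neumann_jump u 0 t = G 0 t"
        using L(2)[OF t] by (simp add: G_def leib_def pd_def)
    qed (use l d in auto)
    also have "G l 0 = \<kappa> * leib (speed_jets Rj Sj) (\<lambda>i. curve_jets Rj Sj (\<lambda>\<alpha>. pd \<alpha> g\<^sub>N p) i (0, 0)) l"
      using l L(3) by (simp add: G_def leib_def gamma_0)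
    finally show "flux_jet Rj Sj Apj (\<lambda>\<alpha>. side_lim (Omega_pos \<Omega> \<psi>) p (pd \<alpha> u)) l -
      flux_jet Rj Sj Amj (\<lambda>\<alpha>. side_lim (Omega_neg \<Omega> \<psi>) p (pd \<alpha> u)) l =
      \<kappa> * leib (speed_jets Rj Sj) (\<lambda>l. curve_jets Rj Sj (problem_data \<Omega> \<psi> p u f g\<^sub>D g\<^sub>N GNeumann) l (0, 0)) l"
      by (simp add: neumann_jump_def gamma_0 problem_data_def)
  }
qed

text \<open>A function of the parameter becomes a function of the plane by composing it with the coordinate \<open>T \<circ> foot\<close>. If it is
flat at \<open>0\<close>, all derivatives of the extension vanish at \<open>p\<close>.\<close>

lemma extend_from_curve:
  assumes "jets1 m J E" "m \<le> Suc M" "\<And>j. j \<le> m \<Longrightarrow> E j 0 = 0"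
  obtains v where "jets2 m W v" "\<And>t. t \<in> J \<Longrightarrow> v (0, 0) (\<gamma> t) = E 0 t" "\<And>\<alpha>. deg \<alpha> \<le> m \<Longrightarrow> v \<alpha> p = 0"
proof -
  define XX where "XX = (\<lambda>j t. deriv r 0 * rr j t + deriv s 0 * ss j t)"
  have XX0: "XX 0 = X" by (simp add: XX_def tangential_def[abs_def] mult.commute)
  have "XX (Suc 0) t = X' t" for t by (simp add: XX_def tangential'_def mult.commute)
  moreover have "jets1 m J XX"
    unfolding XX_def by (intro jets1_comb jets1_mono[OF r_jets assms(2)] jets1_mono[OF s_jets assms(2)])
  ultimately obtain G where G: "jets1 m (X ` J) G" "\<And>t. t \<in> J \<Longrightarrow> G 0 (X t) = E 0 t"
    "\<And>t. t \<in> J \<Longrightarrow> (\<forall>j\<le>m. E j t = 0) \<Longrightarrow> (\<forall>j\<le>m. G j (X t) = 0)"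
    using jets1_reparametrize[of m J XX T E] tangential_pos open_XJ T_continuous T_X assms(1) unfolding XX0
    by auto
  have foot: "fst (q - p) * deriv r 0 + snd (q - p) * deriv s 0 = foot q" for q
    by (simp add: foot_def inner_prod_def)
  have "foot q \<in> X ` J" if "q \<in> W" for q
    using that by (elim W_cases) (auto simp: foot_chart)
  then have "jets2 m W (\<lambda>\<alpha> q. deriv r 0 ^ fst \<alpha> * deriv s 0 ^ snd \<alpha> * G (deg \<alpha>) (foot q))"
    using jets2_ridge[OF G(1), of W p "deriv r 0" "deriv s 0"] unfolding foot by blast
  then show ?thesis
  proof (rule that)
    show "deriv r 0 ^ fst (0, 0) * deriv s 0 ^ snd (0, 0) * G (deg (0, 0)) (foot (\<gamma> t)) = E 0 t" if "t \<in> J" for t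
      using G(2)[OF that] by (simp add: foot_chart)
    show "deriv r 0 ^ fst \<alpha> * deriv s 0 ^ snd \<alpha> * G (deg \<alpha>) (foot p) = 0" if "deg \<alpha> \<le> m" for \<alpha>
      using G(3)[OF zero_in_J] assms(3) that foot_chart[of 0 0] gamma_0 by simp
  qed
qed

text \<open>A polynomial with the jet \<open>D\<close> matches the prescribed values along the curve up to an error that is flat at \<open>0\<close>;
\<open>extend_from_curve\<close> removes the error without changing the jet at \<open>p\<close>. This is what makes the entries of the jets of
\<open>g\<^sub>D\<close> and \<open>g\<^sub>N\<close> independent, although the problem fixes these functions on the interface only.\<close>

lemma extend_datum:
  assumes "jets1 m J E" "m \<le> Suc M"
    and "\<And>j. j \<le> m \<Longrightarrow> E j 0 = curve_jets Rj Sj D j (0, 0)"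
  obtains g where "Ck_on m W g" "\<And>t. t \<in> J \<Longrightarrow> g (\<gamma> t) = E 0 t" "\<And>\<alpha>. deg \<alpha> \<le> m \<Longrightarrow> pd \<alpha> g p = D \<alpha>"
proof -
  define P where "P = jet_poly (Suc m) D p"
  have P: "chain_jets m J rr ss (\<lambda>\<alpha> t. P \<alpha> (p + (rr 0 t, ss 0 t)))"
    unfolding P_def using r_deriv s_deriv by (intro chain_jets_compose[OF jets2_jet_poly]) auto
  define E' where "E' = (\<lambda>l t. 1 * E l t + (-1) * curve_jets (\<lambda>j. rr j t) (\<lambda>j. ss j t) (\<lambda>\<alpha>. P \<alpha> (\<gamma> t)) l (0, 0))"
  have E': "jets1 m J E'"
    unfolding E'_def using curve_sequence[OF P assms(2) order_refl] by (intro jets1_comb assms(1)) (simp only: gamma_eq)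
  have "E' j 0 = 0" if "j \<le> m" for j
  proof -
    have "curve_jets Rj Sj (\<lambda>\<alpha>. P \<alpha> p) j (0, 0) = curve_jets Rj Sj D j (0, 0)"
      using that by (intro curve_jets_cong) (simp add: P_def jet_poly_center)
    then show ?thesis using assms(3)[OF that] by (simp add: E'_def gamma_0)
  qed
  then obtain v where v: "jets2 m W v" "\<And>t. t \<in> J \<Longrightarrow> v (0, 0) (\<gamma> t) = E' 0 t" "\<And>\<alpha>. deg \<alpha> \<le> m \<Longrightarrow> v \<alpha> p = 0"
    using extend_from_curve[OF E' assms(2)] by blast
  define w where "w = (\<lambda>\<alpha> q. 1 * P \<alpha> q + 1 * v \<alpha> q)"
  have w: "jets2 m W w"
    unfolding w_def P_def by (intro jets2_comb v(1) jets2_subset[OF jets2_jet_poly subset_UNIV])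
  show ?thesis
  proof (rule that[of "w (0, 0)"])
    show "Ck_on m W (w (0, 0))" by (rule jets2_imp_Ck_on[OF open_W w]) simp
    show "w (0, 0) (\<gamma> t) = E 0 t" if "t \<in> J" for t
      using v(2)[OF that] by (simp add: w_def E'_def)
    show "pd \<alpha> (w (0, 0)) p = D \<alpha>" if "deg \<alpha> \<le> m" for \<alpha>
      using jets2_imp_pd[OF open_W w, of "w (0, 0)" "fst \<alpha>" "snd \<alpha>" p] that v(3)[OF that]
        gamma_W[OF zero_in_J] by (simp add: gamma_0 w_def P_def jet_poly_center)
  qed
qed

text \<open>Every choice of the data comes from an interface problem. The jets \<open>Up\<close> and \<open>Um\<close> that solve the system for these
data are realized by polynomials on the two sides, \<open>f\<close> is defined by the equation, and \<open>extend_datum\<close> provides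
\<open>g\<^sub>D\<close> and \<open>g\<^sub>N\<close>.\<close>

theorem realization:
  fixes D :: "slot \<Rightarrow> jet"
  obtains u f g\<^sub>D g\<^sub>N where "interface_problem M \<Omega> \<psi> a p u f g\<^sub>D g\<^sub>N"
    "\<And>s \<alpha>. \<alpha> \<in> data_indices (Suc (Suc M)) s \<Longrightarrow> problem_data \<Omega> \<psi> p u f g\<^sub>D g\<^sub>N s \<alpha> = D s \<alpha>"
proof -
  let ?n = "Suc (Suc M)"
  obtain Up Um where sys: "jet_system ?n Rj Sj Apj Amj \<kappa> D Up Um"
    using nondegenerate_jets.solvable[OF nondegenerate] by blast
  define u where "u = (\<lambda>q. if \<psi> q > 0 then jet_poly ?n Up p (0, 0) q else jet_poly ?n Um p (0, 0) q)"
  have up: "u q = jet_poly ?n Up p (0, 0) q" if "q \<in> Omega_pos \<Omega> \<psi>" for q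
    using that by (simp add: u_def Omega_pos_def)
  have um: "u q = jet_poly ?n Um p (0, 0) q" if "q \<in> Omega_neg \<Omega> \<psi>" for q
    using that by (simp add: u_def Omega_neg_def)
  note Ckp = jet_poly_side(1)[OF is_side_pos up] and Ckm = jet_poly_side(1)[OF is_side_neg um]
  have u: "piecewise_Ck (Suc M) \<Omega> \<psi> u" using Ckp Ckm by (simp add: piecewise_Ck_def)
  have jp: "side_lim (Omega_pos \<Omega> \<psi>) p (pd \<alpha> u) = Up \<alpha>" if "deg \<alpha> < ?n" for \<alpha>
    using jet_poly_side(2)[OF is_side_pos up p_Gamma] that by (simp add: jet_poly_center)
  have jm: "side_lim (Omega_neg \<Omega> \<psi>) p (pd \<alpha> u) = Um \<alpha>" if "deg \<alpha> < ?n" for \<alpha>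
    using jet_poly_side(2)[OF is_side_neg um p_Gamma] that by (simp add: jet_poly_center)
  define f where "f = (\<lambda>q. - div_flux a u q)"
  have f: "piecewise_Ck (M - 1) \<Omega> \<psi> f"
    unfolding piecewise_Ck_def
    by (intro conjI source_regular(1)[OF is_side_pos Ckp] source_regular(1)[OF is_side_neg Ckm])
       (simp_all add: f_def)
  have "dirichlet_jump u j 0 = curve_jets Rj Sj (D GDirichlet) j (0, 0)" if "j \<le> Suc M" for j
  proof -
    have "curve_jets Rj Sj (\<lambda>\<alpha>. side_lim (Omega_pos \<Omega> \<psi>) p (pd \<alpha> u)) j (0, 0) = curve_jets Rj Sj Up j (0, 0)"
      "curve_jets Rj Sj (\<lambda>\<alpha>. side_lim (Omega_neg \<Omega> \<psi>) p (pd \<alpha> u)) j (0, 0) = curve_jets Rj Sj Um j (0, 0)"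
      using that by (auto intro!: curve_jets_cong jp jm)
    then show ?thesis using sys that by (simp add: dirichlet_jump_def gamma_0 jet_system_def)
  qed
  then obtain gD where gD: "Ck_on (Suc M) W gD" "\<And>t. t \<in> J \<Longrightarrow> gD (\<gamma> t) = dirichlet_jump u 0 t"
    "\<And>\<alpha>. deg \<alpha> \<le> Suc M \<Longrightarrow> pd \<alpha> gD p = D GDirichlet \<alpha>"
    using extend_datum[OF jump_sequences(1)[OF u] order_refl] by blast
  \<comment> \<open>\<open>N\<close> lists the derivatives of the jump of the flux in the direction of the unit normal.\<close>
  obtain L where L: "jets1 M J L" "\<And>t. t \<in> J \<Longrightarrow> L 0 t = speed t"
    "\<And>j. j \<le> M \<Longrightarrow> L j 0 = speed_jets Rj Sj j"
    using speed_sequence by blast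
  obtain I where I: "jets1 M J I" "\<forall>t\<in>J. I 0 t = L 0 t powr (- 1)"
    using jets1_powr[OF L(1), of "-1"] L(2) speed_pos by auto
  have I0: "I 0 t = 1 / speed t" if "t \<in> J" for t
    using I(2) L(2) that speed_pos[OF that] by (simp add: powr_minus divide_inverse)
  define N where "N = (\<lambda>l t. \<kappa> * leib (\<lambda>i. I i t) (\<lambda>i. neumann_jump u i t) l + 0 * L l t)"
  have N: "jets1 M J N"
    unfolding N_def by (intro jets1_comb jets1_leib I(1) L(1) jump_sequences(2)[OF u])
  have N0: "N 0 t = \<kappa> / speed t * neumann_jump u 0 t" if "t \<in> J" for t
    using I0[OF that] by (simp add: N_def leib_def)
  define Q where "Q = (\<lambda>l t. \<kappa> * leib (\<lambda>i. L i t) (\<lambda>i. N i t) l + 0 * L l t)"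
  have Q: "jets1 M J Q" unfolding Q_def by (intro jets1_comb jets1_leib N L(1))
  have Q_eq: "Q j 0 = neumann_jump u j 0" if "j \<le> M" for j
  proof (rule jets1_unique[OF _ Q jump_sequences(2)[OF u] _ that zero_in_J])
    fix t assume t: "t \<in> J"
    show "Q 0 t = neumann_jump u 0 t"
      using kappa L(2)[OF t] N0[OF t] speed_pos[OF t] by (auto simp: Q_def leib_def)
  qed simp
  have NJ: "neumann_jump u j 0 = \<kappa> * leib (speed_jets Rj Sj) (\<lambda>l. curve_jets Rj Sj (D GNeumann) l (0, 0)) j"
    if "j \<le> M" for j
  proof -
    have "flux_jet Rj Sj Apj (\<lambda>\<alpha>. side_lim (Omega_pos \<Omega> \<psi>) p (pd \<alpha> u)) j = flux_jet Rj Sj Apj Up j"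
      "flux_jet Rj Sj Amj (\<lambda>\<alpha>. side_lim (Omega_neg \<Omega> \<psi>) p (pd \<alpha> u)) j = flux_jet Rj Sj Amj Um j"
      using that by (auto intro!: flux_jet_cong jp jm)
    then show ?thesis using sys that by (simp add: neumann_jump_def gamma_0 jet_system_def)
  qed
  \<comment> \<open>Both sequences have the same Leibniz product with the derivatives of the speed, whose value is positive; so they agree.\<close>
  have "N j 0 = curve_jets Rj Sj (D GNeumann) j (0, 0)" if "j \<le> M" for j
    using that
  proof (induction j rule: less_induct)
    case (less j)
    have L00: "L 0 0 > 0" using L(2) speed_pos zero_in_J by simp
    have "leib (\<lambda>i. L i 0) (\<lambda>i. N i 0) j = leib (\<lambda>i. L i 0) (\<lambda>i. curve_jets Rj Sj (D GNeumann) i (0, 0)) j"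
    proof -
      have "\<kappa> * leib (\<lambda>i. L i 0) (\<lambda>i. N i 0) j = \<kappa> * leib (speed_jets Rj Sj) (\<lambda>l. curve_jets Rj Sj (D GNeumann) l (0, 0)) j"
        using Q_eq[OF less.prems] NJ[OF less.prems] by (simp add: Q_def)
      moreover have "leib (speed_jets Rj Sj) (\<lambda>l. curve_jets Rj Sj (D GNeumann) l (0, 0)) j =
          leib (\<lambda>i. L i 0) (\<lambda>i. curve_jets Rj Sj (D GNeumann) i (0, 0)) j"
        using less.prems L(3) by (simp add: leib_def)
      ultimately show ?thesis using kappa by auto
    qed
    moreover have "leib F G j = F 0 * G j + (\<Sum>l\<in>{1..j}. real (j choose l) * (F l * G (j - l)))" for F G
    proof -
      have "{..j} = insert 0 {1..j}" by auto
      then show ?thesis by (simp add: leib_def)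
    qed
    moreover have "(\<Sum>l\<in>{1..j}. real (j choose l) * (L l 0 * N (j - l) 0)) =
       (\<Sum>l\<in>{1..j}. real (j choose l) * (L l 0 * curve_jets Rj Sj (D GNeumann) (j - l) (0, 0)))"
      using less by (intro sum.cong) auto
    ultimately show ?case using L00 by simp
  qed
  then obtain gN where gN: "Ck_on M W gN" "\<And>t. t \<in> J \<Longrightarrow> gN (\<gamma> t) = N 0 t"
    "\<And>\<alpha>. deg \<alpha> \<le> M \<Longrightarrow> pd \<alpha> gN p = D GNeumann \<alpha>"
    using extend_datum[OF N le_SucI[OF order_refl]] by blast
  \<comment> \<open>Regularity of the data is required near \<open>p\<close> only, so that elsewhere they can be defined as the jumps themselves.\<close>
  define g\<^sub>D where "g\<^sub>D = (\<lambda>q. if q \<in> W then gD q else jump \<Omega> \<psi> q u)"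
  define g\<^sub>N where "g\<^sub>N = (\<lambda>q. if q \<in> W then gN q else
    jump \<Omega> \<psi> q (\<lambda>z. (a z *\<^sub>R grad u z) \<bullet> unit_normal \<Omega> \<psi> q))"
  have pW: "p \<in> W" using gamma_W[OF zero_in_J] gamma_0 by simp
  have Ck_g: "Ck_on (Suc M) W g\<^sub>D" "Ck_on M W g\<^sub>N"
    using Ck_on_cong[OF open_W _ gD(1), of g\<^sub>D] Ck_on_cong[OF open_W _ gN(1), of g\<^sub>N]
    by (simp_all add: g\<^sub>D_def g\<^sub>N_def del: Ck_on.simps)
  have pd_g: "pd \<alpha> g\<^sub>D p = D GDirichlet \<alpha>" if "deg \<alpha> \<le> Suc M" for \<alpha>
    using jets2_imp_pd[OF open_W jets2_pd[OF open_W gD(1)], of g\<^sub>D "fst \<alpha>" "snd \<alpha>" p] pW that gD(3)[OF that]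
    by (simp add: g\<^sub>D_def pd_def)
  have pd_g': "pd \<alpha> g\<^sub>N p = D GNeumann \<alpha>" if "deg \<alpha> \<le> M" for \<alpha>
    using jets2_imp_pd[OF open_W jets2_pd[OF open_W gN(1)], of g\<^sub>N "fst \<alpha>" "snd \<alpha>" p] pW that gN(3)[OF that]
    by (simp add: g\<^sub>N_def pd_def)
  have J1: "jump \<Omega> \<psi> q u = g\<^sub>D q" if q: "q \<in> Gamma \<Omega> \<psi>" for q
  proof (cases "q \<in> W")
    case True
    then obtain t where t: "t \<in> J" "q = \<gamma> t" using Gamma_W q by blast
    then show ?thesis using True gD(2)[OF t(1)] by (simp add: g\<^sub>D_def dirichlet_jump_def jump_trace)
  qed (simp add: g\<^sub>D_def)
  have J2: "jump \<Omega> \<psi> q (\<lambda>z. (a z *\<^sub>R grad u z) \<bullet> unit_normal \<Omega> \<psi> q) = g\<^sub>N q" if q: "q \<in> Gamma \<Omega> \<psi>" for q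
  proof (cases "q \<in> W")
    case True
    then obtain t where t: "t \<in> J" "q = \<gamma> t" using Gamma_W q by blast
    then show ?thesis using True gN(2)[OF t(1)] N0[OF t(1)] jump_flux[OF u t(1)]
      by (simp add: g\<^sub>N_def neumann_jump_def)
  qed (simp add: g\<^sub>N_def)
  have "interface_problem M \<Omega> \<psi> a p u f g\<^sub>D g\<^sub>N"
    unfolding interface_problem_def
    using u f open_W pW Ck_g J1 J2 by (auto simp: f_def simp del: Ck_on.simps)
  moreover have "problem_data \<Omega> \<psi> p u f g\<^sub>D g\<^sub>N s \<alpha> = D s \<alpha>" if \<alpha>: "\<alpha> \<in> data_indices ?n s" for s \<alpha>
  proof -
    have F: "side_lim S p (pd \<alpha> f) = - pde_jet (\<lambda>\<beta>. side_lim S p (pd \<beta> a)) (\<lambda>\<beta>. side_lim S p (pd \<beta> u)) \<alpha>"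
      if "is_side S" "deg \<alpha> + 2 < ?n" for S
      using source_regular(2)[OF that(1) piecewise_side[OF that(1) u], of f] that(2) p_Gamma by (simp add: f_def)
    have pde: "pde_jet Apj (\<lambda>\<beta>. side_lim (Omega_pos \<Omega> \<psi>) p (pd \<beta> u)) \<alpha> = pde_jet Apj Up \<alpha>"
      "pde_jet Amj (\<lambda>\<beta>. side_lim (Omega_neg \<Omega> \<psi>) p (pd \<beta> u)) \<alpha> = pde_jet Amj Um \<alpha>"
      if "deg \<alpha> + 2 < ?n"
      using that by (auto intro!: pde_jet_cong jp jm)
    show ?thesis
    proof (cases s)
      case Uplus
      then have small: "fst \<alpha> \<le> 1 \<and> deg \<alpha> < ?n" using \<alpha> by (simp add: data_indices_def)
      then have "Up \<alpha> = D Uplus \<alpha>" using sys unfolding jet_system_def by blast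
      then show ?thesis using jp small unfolding Uplus by (simp add: problem_data_def)
    next
      case Fplus
      then have small: "deg \<alpha> + 2 < ?n" using \<alpha> by (simp add: data_indices_def)
      have "side_lim (Omega_pos \<Omega> \<psi>) p (pd \<alpha> f) = - pde_jet Apj Up \<alpha>"
        using F[OF is_side_pos small] pde(1)[OF small] by simp
      also have "pde_jet Apj Up \<alpha> = - D Fplus \<alpha>" using sys small unfolding jet_system_def by blast
      finally show ?thesis unfolding Fplus by (simp add: problem_data_def)
    next
      case Fminus
      then have small: "deg \<alpha> + 2 < ?n" using \<alpha> by (simp add: data_indices_def)
      have "side_lim (Omega_neg \<Omega> \<psi>) p (pd \<alpha> f) = - pde_jet Amj Um \<alpha>"
        using F[OF is_side_neg small] pde(2)[OF small] by simp
      also have "pde_jet Amj Um \<alpha> = - D Fminus \<alpha>" using sys small unfolding jet_system_def by blast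
      finally show ?thesis unfolding Fminus by (simp add: problem_data_def)
    next
      case GDirichlet
      then show ?thesis using pd_g \<alpha> by (simp add: problem_data_def data_indices_def)
    next
      case GNeumann
      then show ?thesis using pd_g' \<alpha> by (simp add: problem_data_def data_indices_def)
    qed
  qed
  ultimately show ?thesis using that by blast
qed

end

section \<open>Existence and uniqueness of the coefficients\<close>

definition slot_coeffs :: "coeffs \<Rightarrow> coeffs \<Rightarrow> coeffs \<Rightarrow> coeffs \<Rightarrow> coeffs \<Rightarrow> slot \<Rightarrow> coeffs" where
  "slot_coeffs Su Sp Sm SD SN s =
     (case s of Uplus \<Rightarrow> Su | Fplus \<Rightarrow> Sp | Fminus \<Rightarrow> Sm | GDirichlet \<Rightarrow> SD | GNeumann \<Rightarrow> SN)"

text \<open>The entries of the data over which the transmission identity sums for the derivative of index \<open>\<beta>\<close>.\<close>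

definition admissible :: "nat \<Rightarrow> nat \<times> nat \<Rightarrow> slot \<Rightarrow> (nat \<times> nat) set" where
  "admissible M \<beta> s = {\<alpha> \<in> data_indices (Suc (Suc M)) s. s = Uplus \<longrightarrow> deg \<alpha> \<le> deg \<beta>}"

lemma finite_slot: "finite (UNIV :: slot set)"
  unfolding UNIV_slot by simp

lemma admissible_simps:
  assumes "M > 0"
  shows "admissible M \<beta> Uplus = {\<alpha> \<in> LamV1 (M + 1). deg \<alpha> \<le> deg \<beta>}"
    "admissible M \<beta> Fplus = Lam (M - 1)" "admissible M \<beta> Fminus = Lam (M - 1)"
    "admissible M \<beta> GDirichlet = Lam (M + 1)" "admissible M \<beta> GNeumann = Lam M"
  using assms by (auto simp: admissible_def data_indices_def LamV1_def Lam_def)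

lemma LamV1_iff: "\<beta> \<in> LamV1 (M + 1) \<longleftrightarrow> fst \<beta> \<le> 1 \<and> deg \<beta> < Suc (Suc M)"
  by (auto simp: LamV1_def Lam_def)

lemma finite_admissible: "finite (admissible M \<beta> s)"
  by (simp add: admissible_def finite_data_indices)

lemma transmission_identity_slots:
  assumes "M > 0"
  shows "transmission_identity M \<Omega> \<psi> p u f g\<^sub>D g\<^sub>N Su Sp Sm SD SN \<longleftrightarrow>
    (\<forall>\<beta>\<in>LamV1 (M + 1). side_lim (Omega_neg \<Omega> \<psi>) p (pd \<beta> u) =
      (\<Sum>s\<in>UNIV. \<Sum>\<alpha>\<in>admissible M \<beta> s.
         slot_coeffs Su Sp Sm SD SN s \<beta> \<alpha> * problem_data \<Omega> \<psi> p u f g\<^sub>D g\<^sub>N s \<alpha>))"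
  unfolding transmission_identity_def UNIV_slot
  by (simp add: admissible_simps[OF assms] slot_coeffs_def problem_data_def sum.distrib algebra_simps)

lemma same_coeffs_slots:
  assumes "M > 0"
    and "\<And>\<beta> s \<alpha>. \<beta> \<in> LamV1 (M + 1) \<Longrightarrow> \<alpha> \<in> admissible M \<beta> s \<Longrightarrow>
      slot_coeffs Su Sp Sm SD SN s \<beta> \<alpha> = slot_coeffs Tu Tp Tm TD TN s \<beta> \<alpha>"
  shows "same_coeffs M Tu Tp Tm TD TN Su Sp Sm SD SN"
  unfolding same_coeffs_def
  using assms(2)[where s = Uplus] assms(2)[where s = Fplus] assms(2)[where s = Fminus]
    assms(2)[where s = GDirichlet] assms(2)[where s = GNeumann]
  by (auto simp: admissible_simps[OF assms(1)] slot_coeffs_def simp del: One_nat_def)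

context interface_point
begin

text \<open>The jets of a solution solve the system, so they are superpositions of the unit responses; triangularity removes the
terms that the identity does not contain.\<close>

lemma universal_transmission:
  "universal_coeffs M \<Omega> \<psi> a p
     (transmission (Suc (Suc M)) Rj Sj Apj Amj \<kappa> Uplus) (transmission (Suc (Suc M)) Rj Sj Apj Amj \<kappa> Fplus)
     (transmission (Suc (Suc M)) Rj Sj Apj Amj \<kappa> Fminus) (transmission (Suc (Suc M)) Rj Sj Apj Amj \<kappa> GDirichlet)
     (transmission (Suc (Suc M)) Rj Sj Apj Amj \<kappa> GNeumann)"
  unfolding universal_coeffs_def transmission_identity_slots[OF M]
proof (intro allI impI ballI)
  fix u f g\<^sub>D g\<^sub>N \<beta>
  assume prob: "interface_problem M \<Omega> \<psi> a p u f g\<^sub>D g\<^sub>N" and \<beta>: "\<beta> \<in> LamV1 (M + 1)"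
  let ?T = "transmission (Suc (Suc M)) Rj Sj Apj Amj \<kappa>"
  let ?D = "problem_data \<Omega> \<psi> p u f g\<^sub>D g\<^sub>N"
  interpret nd: nondegenerate_jets Rj Sj Apj Amj by (rule nondegenerate)
  have "side_lim (Omega_neg \<Omega> \<psi>) p (pd \<beta> u) =
      (\<Sum>s\<in>UNIV. \<Sum>\<alpha>\<in>data_indices (Suc (Suc M)) s. ?T s \<beta> \<alpha> * ?D s \<alpha>)"
    by (rule nd.superposition[OF interface_problem_jet_system[OF prob]]) (use \<beta> LamV1_iff in blast)
  also have "\<dots> = (\<Sum>s\<in>UNIV. \<Sum>\<alpha>\<in>admissible M \<beta> s. ?T s \<beta> \<alpha> * ?D s \<alpha>)"
  proof (rule sum.cong[OF refl])
    fix s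
    have "?T s \<beta> \<alpha> = 0" if "\<alpha> \<in> data_indices (Suc (Suc M)) s - admissible M \<beta> s" for \<alpha>
      using that nd.transmission_triangular[of \<alpha> "Suc (Suc M)" \<beta>]
      by (auto simp: admissible_def data_indices_def)
    then show "(\<Sum>\<alpha>\<in>data_indices (Suc (Suc M)) s. ?T s \<beta> \<alpha> * ?D s \<alpha>) = (\<Sum>\<alpha>\<in>admissible M \<beta> s. ?T s \<beta> \<alpha> * ?D s \<alpha>)"
      by (intro sum.mono_neutral_right finite_data_indices) (auto simp: admissible_def)
  qed
  also have "\<dots> = (\<Sum>s\<in>UNIV. \<Sum>\<alpha>\<in>admissible M \<beta> s.
      slot_coeffs (?T Uplus) (?T Fplus) (?T Fminus) (?T GDirichlet) (?T GNeumann) s \<beta> \<alpha> * ?D s \<alpha>)"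
    by (intro sum.cong refl) (simp add: slot_coeffs_def split: slot.split)
  finally show "side_lim (Omega_neg \<Omega> \<psi>) p (pd \<beta> u) = \<dots>" .
qed

text \<open>For data that realize a unit datum, each of the two identities collapses to a single coefficient, and both have the same
left-hand side.\<close>

lemma universal_unique:
  assumes S: "universal_coeffs M \<Omega> \<psi> a p Su Sp Sm SD SN" and T: "universal_coeffs M \<Omega> \<psi> a p Tu Tp Tm TD TN"
  shows "same_coeffs M Tu Tp Tm TD TN Su Sp Sm SD SN"
proof (rule same_coeffs_slots[OF M])
  fix \<beta> s \<alpha>
  assume \<beta>: "\<beta> \<in> LamV1 (M + 1)" and \<alpha>: "\<alpha> \<in> admissible M \<beta> s"
  obtain u f g\<^sub>D g\<^sub>N where prob: "interface_problem M \<Omega> \<psi> a p u f g\<^sub>D g\<^sub>N"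
    and D: "\<And>s' \<alpha>'. \<alpha>' \<in> data_indices (Suc (Suc M)) s' \<Longrightarrow>
      problem_data \<Omega> \<psi> p u f g\<^sub>D g\<^sub>N s' \<alpha>' = jet_unit s \<alpha> s' \<alpha>'"
    using realization[of "jet_unit s \<alpha>"] by blast
  have collapse: "(\<Sum>s'\<in>UNIV. \<Sum>\<alpha>'\<in>admissible M \<beta> s'. C s' \<beta> \<alpha>' * problem_data \<Omega> \<psi> p u f g\<^sub>D g\<^sub>N s' \<alpha>') = C s \<beta> \<alpha>"
    for C :: "slot \<Rightarrow> coeffs"
  proof -
    have "(\<Sum>s'\<in>UNIV. \<Sum>\<alpha>'\<in>admissible M \<beta> s'. C s' \<beta> \<alpha>' * problem_data \<Omega> \<psi> p u f g\<^sub>D g\<^sub>N s' \<alpha>') =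
        (\<Sum>s'\<in>UNIV. if s' = s then C s \<beta> \<alpha> else 0)"
    proof (rule sum.cong[OF refl])
      fix s'
      have "(\<Sum>\<alpha>'\<in>admissible M \<beta> s'. C s' \<beta> \<alpha>' * problem_data \<Omega> \<psi> p u f g\<^sub>D g\<^sub>N s' \<alpha>') =
          (\<Sum>\<alpha>'\<in>admissible M \<beta> s'. if \<alpha>' = \<alpha> then (if s' = s then C s \<beta> \<alpha> else 0) else 0)"
        by (intro sum.cong refl) (auto simp: D admissible_def jet_unit_def)
      also have "\<dots> = (if s' = s then C s \<beta> \<alpha> else 0)"
        using \<alpha> finite_admissible by auto
      finally show "(\<Sum>\<alpha>'\<in>admissible M \<beta> s'. C s' \<beta> \<alpha>' * problem_data \<Omega> \<psi> p u f g\<^sub>D g\<^sub>N s' \<alpha>') =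
        (if s' = s then C s \<beta> \<alpha> else 0)" .
    qed
    also have "\<dots> = C s \<beta> \<alpha>" by (simp add: finite_slot)
    finally show ?thesis .
  qed
  have "side_lim (Omega_neg \<Omega> \<psi>) p (pd \<beta> u) = slot_coeffs Su Sp Sm SD SN s \<beta> \<alpha>"
  proof -
    have ti: "transmission_identity M \<Omega> \<psi> p u f g\<^sub>D g\<^sub>N Su Sp Sm SD SN"
      using S prob unfolding universal_coeffs_def by blast
    show ?thesis
      using bspec[OF iffD1[OF transmission_identity_slots[OF M] ti] \<beta>] by (simp only: collapse)
  qed
  moreover have "side_lim (Omega_neg \<Omega> \<psi>) p (pd \<beta> u) = slot_coeffs Tu Tp Tm TD TN s \<beta> \<alpha>"
  proof -
    have ti: "transmission_identity M \<Omega> \<psi> p u f g\<^sub>D g\<^sub>N Tu Tp Tm TD TN"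
      using T prob unfolding universal_coeffs_def by blast
    show ?thesis
      using bspec[OF iffD1[OF transmission_identity_slots[OF M] ti] \<beta>] by (simp only: collapse)
  qed
  ultimately show "slot_coeffs Su Sp Sm SD SN s \<beta> \<alpha> = slot_coeffs Tu Tp Tm TD TN s \<beta> \<alpha>" by simp
qed

end

lemma interface_setting_point:
  assumes "0 < M" "open \<Omega>" "interface_setting M \<Omega> \<psi> a p r s \<epsilon>"
  obtains \<delta> \<eta> \<kappa> where "interface_point M \<Omega> \<psi> p r s \<delta> \<eta> \<kappa> a"
proof -
  have "smooth_interface (Suc M) \<Omega> \<psi>" "p \<in> Gamma \<Omega> \<psi>" "local_param (Suc M) (Gamma \<Omega> \<psi>) p r s \<epsilon>"
    and a: "piecewise_Ck M \<Omega> \<psi> a" "positive_coefficient \<Omega> \<psi> a"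
    using assms(3) by (simp_all add: interface_setting_def)
  then obtain \<delta> \<eta> \<kappa> where "interface_chart (Suc M) \<Omega> \<psi> p r s \<delta> \<eta> \<kappa>"
    using interface_chart_exists[OF assms(2), of "Suc M"] by (metis le_add1 plus_1_eq_Suc)
  then show ?thesis
    using that assms(1) a by (simp add: interface_point_def interface_point_axioms_def)
qed

definition const_jet :: "real \<Rightarrow> jet" where
  "const_jet c = (\<lambda>\<alpha>. if \<alpha> = (0, 0) then c else 0)"

theorem theorem2p7:
  fixes M :: nat
  assumes "0 < M"
  shows "\<exists>(Tu :: (nat \<Rightarrow> real) \<Rightarrow> (nat \<Rightarrow> real) \<Rightarrow> (nat \<times> nat \<Rightarrow> real) \<Rightarrow> (nat \<times> nat \<Rightarrow> real) \<Rightarrow> coeffs)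
      Tp Tm TD (TN :: real \<Rightarrow> (nat \<Rightarrow> real) \<Rightarrow> (nat \<Rightarrow> real) \<Rightarrow> (nat \<times> nat \<Rightarrow> real) \<Rightarrow> (nat \<times> nat \<Rightarrow> real) \<Rightarrow> coeffs)
      (P :: (nat \<Rightarrow> real) \<Rightarrow> (nat \<Rightarrow> real) \<Rightarrow> real \<Rightarrow> real \<Rightarrow> coeffs).
    \<forall>l\<^sub>1 l\<^sub>2 l\<^sub>3 l\<^sub>4 \<Omega> \<psi> a p r s \<epsilon> R S A\<^sub>p A\<^sub>m \<sigma>.
      \<Omega> = {l\<^sub>1<..<l\<^sub>2} \<times> {l\<^sub>3<..<l\<^sub>4} \<and> interface_setting M \<Omega> \<psi> a p r s \<epsilon> \<and>
      R = curve_jet (M + 1) r \<and> S = curve_jet (M + 1) s \<and>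
      A\<^sub>p = side_jet M (Omega_pos \<Omega> \<psi>) p a \<and> A\<^sub>m = side_jet M (Omega_neg \<Omega> \<psi>) p a \<and>
      \<sigma> = orientation \<Omega> \<psi> p r s \<longrightarrow>
        universal_coeffs M \<Omega> \<psi> a p
          (Tu R S A\<^sub>p A\<^sub>m) (Tp R S A\<^sub>p A\<^sub>m) (Tm R S A\<^sub>p A\<^sub>m) (TD R S A\<^sub>p A\<^sub>m) (TN \<sigma> R S A\<^sub>p A\<^sub>m) \<and>
        (\<forall>Su Sp Sm SD SN. universal_coeffs M \<Omega> \<psi> a p Su Sp Sm SD SN \<longrightarrow>
          same_coeffs M
            (Tu R S A\<^sub>p A\<^sub>m) (Tp R S A\<^sub>p A\<^sub>m) (Tm R S A\<^sub>p A\<^sub>m) (TD R S A\<^sub>p A\<^sub>m) (TN \<sigma> R S A\<^sub>p A\<^sub>m)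
            Su Sp Sm SD SN) \<and>
        (\<forall>\<alpha>\<in>LamV1 (M + 1). \<forall>\<beta>\<in>LamV1 (M + 1). deg \<alpha> = deg \<beta> \<longrightarrow>
          Tu R S A\<^sub>p A\<^sub>m \<beta> \<alpha> = P R S (A\<^sub>p (0, 0)) (A\<^sub>m (0, 0)) \<beta> \<alpha>) \<and>
        Tu R S A\<^sub>p A\<^sub>m (0, 0) (0, 0) = 1 \<and>
        (\<forall>\<beta>\<in>LamV1 (M + 1). \<beta> \<noteq> (0, 0) \<longrightarrow> Tu R S A\<^sub>p A\<^sub>m \<beta> (0, 0) = 0)"
proof -
  let ?n = "Suc (Suc M)"
  define coef where "coef = (\<lambda>s R S Ap Am. transmission ?n R S Ap Am 1 s)"
  define TN where "TN = (\<lambda>\<sigma> R S Ap Am. transmission ?n R S Ap Am \<sigma> GNeumann)"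
  define P where "P = (\<lambda>R S a b. transmission ?n R S (const_jet a) (const_jet b) 1 Uplus)"
  have main: "universal_coeffs M \<Omega> \<psi> a p (coef Uplus R S Ap Am) (coef Fplus R S Ap Am) (coef Fminus R S Ap Am)
          (coef GDirichlet R S Ap Am) (TN \<sigma> R S Ap Am) \<and>
        (\<forall>Su Sp Sm SD SN. universal_coeffs M \<Omega> \<psi> a p Su Sp Sm SD SN \<longrightarrow>
          same_coeffs M (coef Uplus R S Ap Am) (coef Fplus R S Ap Am) (coef Fminus R S Ap Am)
            (coef GDirichlet R S Ap Am) (TN \<sigma> R S Ap Am) Su Sp Sm SD SN) \<and>
        (\<forall>\<alpha>\<in>LamV1 (M + 1). \<forall>\<beta>\<in>LamV1 (M + 1). deg \<alpha> = deg \<beta> \<longrightarrow>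
          coef Uplus R S Ap Am \<beta> \<alpha> = P R S (Ap (0, 0)) (Am (0, 0)) \<beta> \<alpha>) \<and>
        coef Uplus R S Ap Am (0, 0) (0, 0) = 1 \<and>
        (\<forall>\<beta>\<in>LamV1 (M + 1). \<beta> \<noteq> (0, 0) \<longrightarrow> coef Uplus R S Ap Am \<beta> (0, 0) = 0)"
    if \<Omega>: "\<Omega> = {l\<^sub>1<..<l\<^sub>2} \<times> {l\<^sub>3<..<l\<^sub>4}" and setting: "interface_setting M \<Omega> \<psi> a p r s \<epsilon>"
      and R: "R = curve_jet (M + 1) r" and S: "S = curve_jet (M + 1) s"
      and Ap: "Ap = side_jet M (Omega_pos \<Omega> \<psi>) p a" and Am: "Am = side_jet M (Omega_neg \<Omega> \<psi>) p a"
      and \<sigma>: "\<sigma> = orientation \<Omega> \<psi> p r s"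
    for l\<^sub>1 l\<^sub>2 l\<^sub>3 l\<^sub>4 \<Omega> \<psi> a p r s \<epsilon> R S Ap Am \<sigma>
  proof -
    have "open \<Omega>" unfolding \<Omega> by (intro open_Times) auto
    then obtain \<delta> \<eta> \<kappa> where "interface_point M \<Omega> \<psi> p r s \<delta> \<eta> \<kappa> a"
      using interface_setting_point[OF assms _ setting] by blast
    then interpret interface_point M \<Omega> \<psi> p r s \<delta> \<eta> \<kappa> a .
    have jets: "transmission ?n R S Ap Am = transmission ?n Rj Sj Apj Amj"
      by (rule transmission_cong) (auto simp: R S Ap Am curve_jet_def side_jet_def Lam_def)
    have \<sigma>\<kappa>: "\<sigma> = \<kappa>" using \<sigma> orientation_chart by simp
    have coef: "coef s R S Ap Am = transmission ?n Rj Sj Apj Amj \<kappa> s" if "s \<noteq> GNeumann" for s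
      using transmission_orientation[OF that] by (simp add: coef_def jets fun_eq_iff)
    have TN: "TN \<sigma> R S Ap Am = transmission ?n Rj Sj Apj Amj \<kappa> GNeumann"
      by (simp add: TN_def jets \<sigma>\<kappa>)
    have univ: "universal_coeffs M \<Omega> \<psi> a p (coef Uplus R S Ap Am) (coef Fplus R S Ap Am) (coef Fminus R S Ap Am)
          (coef GDirichlet R S Ap Am) (TN \<sigma> R S Ap Am)"
      using universal_transmission by (simp add: coef TN)
    have nd: "nondegenerate_jets R S Ap Am"
      using nondegenerate assms
      by (simp add: nondegenerate_jets_def R S Ap Am curve_jet_def side_jet_def Lam_def)
    then have nd0: "nondegenerate_jets R S (const_jet (Ap (0, 0))) (const_jet (Am (0, 0)))"
      by (simp add: nondegenerate_jets_def const_jet_def)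
    have top: "coef Uplus R S Ap Am \<beta> \<alpha> = P R S (Ap (0, 0)) (Am (0, 0)) \<beta> \<alpha>"
      if "\<beta> \<in> LamV1 (M + 1)" "deg \<alpha> = deg \<beta>" for \<alpha> \<beta>
      unfolding coef_def P_def
      by (rule transmission_top[OF nd nd0 _ _ that(2)]) (use that(1) LamV1_iff in \<open>auto simp: const_jet_def\<close>)
    have const: "coef Uplus R S Ap Am \<beta> (0, 0) = (if \<beta> = (0, 0) then 1 else 0)" if "\<beta> \<in> LamV1 (M + 1)" for \<beta>
      unfolding coef_def by (rule transmission_const[OF nd]) (use that LamV1_iff in blast)
    have "(0, 0) \<in> LamV1 (M + 1)" by (simp add: LamV1_def Lam_def)
    then show ?thesis
      using univ universal_unique[OF _ univ] const
      by (intro conjI ballI allI impI top) simp_all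
  qed
  show ?thesis
    by (rule exI[of _ "coef Uplus"], rule exI[of _ "coef Fplus"], rule exI[of _ "coef Fminus"],
        rule exI[of _ "coef GDirichlet"], rule exI[of _ TN], rule exI[of _ P], intro allI impI, elim conjE,
        rule main)
qed

end
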